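(* Let $k,n\ge3$ and $g\ge1$, and let $Q=B_{k,n}(\widehat\Sigma_g)/\Gamma_3(B_{k,n}(\widehat\Sigma_g))$. (i) The group $Q$ is isomorphic to a semi-direct product of the form $(\mathbb Z^3\times\mathbb Z^{2g})\rtimes\mathbb Z^{2g}$, the first factor $\mathbb Z^3$ being generated by $\{\sigma,\tilde\sigma,\zeta\}$, the second factor $\mathbb Z^{2g}$ by $\{a_1,\dots,a_g,\tilde a_1,\dots,\tilde a_g\}$, and the third factor $\mathbb Z^{2g}$ by $\{b_1,\dots,b_g,\tilde b_1,\dots,\tilde b_g\}$. (ii) Any element $\gamma$ of $Q$ may be written uniquely in the form $$\gamma=\sigma^p\tilde\sigma^q\zeta^r\prod_{i=1}^g a_i^{m_i}\tilde a_i^{\widetilde m_i}\prod_{i=1}^g b_i^{n_i}\tilde b_i^{\widetilde n_i},\qquad p,q,r,m_i,\widetilde m_i,n_i,\widetilde n_i\in\mathbb Z.$$ (iii) The centre of $Q$ is the free Abelian group of rank three generated by $\sigma,\tilde\sigma$ and $\zeta$.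
   Context: For a connected surface $\Sigma$, $B_{k,n}(\Sigma)=\pi_1(\mathbb F_{k+n}(\Sigma)/(S_k\times S_n))$, where $\mathbb F_m(\Sigma)=\{(x_1,\dots,x_m)\in\Sigma^m: x_i\neq x_j\ (i\ne j)\}$. $\widehat\Sigma_g$ is a compact connected orientable surface of genus $g$ with one boundary component. $\Gamma_1(G)=G$, $\Gamma_i(G)=[G,\Gamma_{i-1}(G)]$; $[x,y]=xyx^{-1}y^{-1}$, $x^y=y^{-1}xy$. Presentation of $B_{k,n}(\widehat\Sigma_g)$. Generators: $S=\{\sigma_1,\dots,\sigma_{k-1}\}$, $\widetilde S=\{\tilde\sigma_1,\dots,\tilde\sigma_{n-1}\}$, $AB=\{a_1,b_1,\dots,a_g,b_g\}$, $\widetilde{AB}=\{\tilde a_1,\tilde b_1,\dots,\tilde a_g,\tilde b_g\}$, $Z=\{\zeta_1,\dots,\zeta_n\}$. Write $c<d$ for $c\in\{a_i,b_i\}$, $d\in\{a_j,b_j\}$, $i<j$. Relations (for all indices for which they make sense): (a) $\sigma_i\sigma_j=\sigma_j\sigma_i$ for $|i-j|\ge2$; $\sigma_i\sigma_{i+1}\sigma_i=\sigma_{i+1}\sigma_i\sigma_{i+1}$; $c\sigma_i=\sigma_ic$ for $i\neq1$, $c\in AB\cup Z$; $c\sigma_1c\sigma_1=\sigma_1c\sigma_1c$ for $c\in AB\cup Z$; $a_i\sigma_1b_i=\sigma_1b_i\sigma_1a_i\sigma_1$; $\sigma_1^{-1}c\sigma_1$ commutes with $d$ for $c,d\in AB$,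 $c<d$; $\sigma_1^{-1}\zeta_i\sigma_1$ commutes with every $c\in AB$, and with $\zeta_j$ for $i<j$. (b) The relations of (a) among $S\cup AB$ only, with $k$ replaced by $n$ and $\sigma_i,a_i,b_i$ by $\tilde\sigma_i,\tilde a_i,\tilde b_i$. (c) $\tilde\sigma_i,\tilde a_i,\tilde b_i$ commute with every $\sigma_j$; $\tilde\sigma_i$ commutes with $a_j,b_j$; $\tilde\sigma_i\zeta_{i+1}\tilde\sigma_i^{-1}=\zeta_i$; $\tilde\sigma_i\zeta_i\tilde\sigma_i^{-1}=\zeta_i^{-1}\zeta_{i+1}\zeta_i$; $\tilde\sigma_i\zeta_j\tilde\sigma_i^{-1}=\zeta_j$ for $j\ne i,i+1$; for $(\tilde x,x)=(\tilde a_i,a_i)$ or $(\tilde b_i,b_i)$: $\tilde x\zeta_1\tilde x^{-1}=\zeta_1^{x\zeta_1}$, $\tilde x\zeta_j\tilde x^{-1}=\zeta_j^{[x^{-1},\zeta_1^{-1}]}$ for $j\ne1$, $\tilde xx\tilde x^{-1}=\zeta_1^{-1}x\zeta_1$, and for $d\in\{a_j,b_j\}$, $\tilde xd\tilde x^{-1}=d^{[x^{-1},\zeta_1^{-1}]}$ if $i>j$, $\tilde xd\tilde x^{-1}=d$ if $j>i$; $\tilde a_ib_i\tilde a_i^{-1}=b_i\zeta_1$; $\tilde b_ia_i\tilde b_i^{-1}=\zeta_1^{-1}a_i[b_i^{-1},\zeta_1^{-1}]$. In the quotient $Q$, all $\sigma_i$ (resp. all $\tilde\sigma_i$, all $\zeta_i$)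 have a common image, denoted $\sigma$ (resp. $\tilde\sigma$, $\zeta$), and the images of $a_i,b_i,\tilde a_i,\tilde b_i$ keep their names. *)

theory Defs
  imports "HOL-Analysis.Analysis" "HOL-Algebra.Algebra"
begin

section \<open>Surface braid groups\<close>

subsection \<open>The fundamental group of a topological space\<close>

definition loops :: "'a topology \<Rightarrow> 'a \<Rightarrow> (real \<Rightarrow> 'a) set" where
  "loops Y x = {p. pathin Y p \<and> p 0 = x \<and> p 1 = x}"

definition loop_homotopic :: "'a topology \<Rightarrow> 'a \<Rightarrow> (real \<Rightarrow> 'a) \<Rightarrow> (real \<Rightarrow> 'a) \<Rightarrow> bool" where
  "loop_homotopic Y x p q \<longleftrightarrow>
     homotopic_with (\<lambda>h. h 0 = x \<and> h 1 = x) (top_of_set {0..1}) Y p q"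

definition loop_join :: "(real \<Rightarrow> 'a) \<Rightarrow> (real \<Rightarrow> 'a) \<Rightarrow> real \<Rightarrow> 'a" where
  "loop_join p q = (\<lambda>t. if t \<le> 1/2 then p (2 * t) else q (2 * t - 1))"

definition fundamental_group :: "'a topology \<Rightarrow> 'a \<Rightarrow> (real \<Rightarrow> 'a) set monoid" where
  "fundamental_group Y x =
     \<lparr>carrier = loops Y x // {(p, q). p \<in> loops Y x \<and> q \<in> loops Y x \<and> loop_homotopic Y x p q},
      monoid.mult = (\<lambda>C D. {r \<in> loops Y x. \<exists>p\<in>C. \<exists>q\<in>D. loop_homotopic Y x (loop_join p q) r}),
      one = {r \<in> loops Y x. loop_homotopic Y x (\<lambda>_. x) r}\<rparr>"

subsection \<open>Configuration spaces and their orbit spaces\<close>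

definition quotient_topology :: "'a topology \<Rightarrow> ('a \<Rightarrow> 'b) \<Rightarrow> 'b topology" where
  "quotient_topology Y f =
     topology (\<lambda>U. U \<subseteq> f ` topspace Y \<and> openin Y {x \<in> topspace Y. f x \<in> U})"

lemma openin_quotient_topology:
  "openin (quotient_topology Y f) U \<longleftrightarrow>
     U \<subseteq> f ` topspace Y \<and> openin Y {x \<in> topspace Y. f x \<in> U}"
proof -
  have "istopology (\<lambda>U. U \<subseteq> f ` topspace Y \<and> openin Y {x \<in> topspace Y. f x \<in> U})"
    unfolding istopology_def
  proof (intro conjI allI impI)
    fix S T assume *: "S \<subseteq> f ` topspace Y \<and> openin Y {x \<in> topspace Y. f x \<in> S}"
      "T \<subseteq> f ` topspace Y \<and> openin Y {x \<in> topspace Y. f x \<in> T}"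
    show "S \<inter> T \<subseteq> f ` topspace Y" using * by blast
    have "{x \<in> topspace Y. f x \<in> S \<inter> T} =
        {x \<in> topspace Y. f x \<in> S} \<inter> {x \<in> topspace Y. f x \<in> T}" by blast
    then show "openin Y {x \<in> topspace Y. f x \<in> S \<inter> T}" using * by auto
  next
    fix \<K> assume *: "\<forall>K\<in>\<K>. K \<subseteq> f ` topspace Y \<and> openin Y {x \<in> topspace Y. f x \<in> K}"
    show "\<Union>\<K> \<subseteq> f ` topspace Y" using * by blast
    have "{x \<in> topspace Y. f x \<in> \<Union>\<K>} = (\<Union>K\<in>\<K>. {x \<in> topspace Y. f x \<in> K})" by blast
    then show "openin Y {x \<in> topspace Y. f x \<in> \<Union>\<K>}" using * by auto
  qed
  then show ?thesis
    by (simp add: quotient_topology_def topology_inverse')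
qed

lemma topspace_quotient_topology: "topspace (quotient_topology Y f) = f ` topspace Y"
proof -
  have "{x \<in> topspace Y. f x \<in> f ` topspace Y} = topspace Y" by blast
  then have "openin (quotient_topology Y f) (f ` topspace Y)"
    by (simp add: openin_quotient_topology)
  then show ?thesis
    by (meson openin_quotient_topology openin_subset openin_topspace subset_antisym)
qed

lemma quotient_map_quotient_topology: "quotient_map Y (quotient_topology Y f) f"
  unfolding quotient_map_def
  by (simp add: topspace_quotient_topology openin_quotient_topology)

definition configuration_space :: "nat \<Rightarrow> 'a topology \<Rightarrow> (nat \<Rightarrow> 'a) topology" where
  "configuration_space m S =
     subtopology (product_topology (\<lambda>_. S) {1..m}) {x. inj_on x {1..m}}"

definition configuration_orbit :: "nat \<Rightarrow> nat \<Rightarrow> (nat \<Rightarrow> 'a) \<Rightarrow> (nat \<Rightarrow> 'a) set" where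
  "configuration_orbit k n x =
     {x \<circ> (p \<circ> q) | p q. p permutes {1..k} \<and> q permutes {k+1..k+n}}"

definition orbit_configuration_space :: "nat \<Rightarrow> nat \<Rightarrow> 'a topology \<Rightarrow> (nat \<Rightarrow> 'a) set topology" where
  "orbit_configuration_space k n S =
     quotient_topology (configuration_space (k + n) S) (configuration_orbit k n)"

definition surface_braid_group ::
    "nat \<Rightarrow> nat \<Rightarrow> 'a topology \<Rightarrow> (nat \<Rightarrow> 'a) set \<Rightarrow> (real \<Rightarrow> (nat \<Rightarrow> 'a) set) set monoid" where
  "surface_braid_group k n S x = fundamental_group (orbit_configuration_space k n S) x"

subsection \<open>The compact orientable surface of genus \<open>g\<close> with one boundary component\<close>

text \<open>
  The standard polygonal model: the boundary circle of the closed unit disc is divided into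
  \<open>4g + 1\<close> arcs, the \<open>j\<close>-th one being \<open>rim_point g ` {j..j+1}\<close>. The first \<open>4g\<close> are glued
  according to the word \<open>\<alpha>\<^sub>1 \<beta>\<^sub>1 \<alpha>\<^sub>1\<inverse> \<beta>\<^sub>1\<inverse> \<dots> \<alpha>\<^sub>g \<beta>\<^sub>g \<alpha>\<^sub>g\<inverse> \<beta>\<^sub>g\<inverse>\<close>. All vertices get identified, so
  that the last arc, which is left free, becomes the boundary circle. By the classification of
  surfaces, every compact connected orientable surface of genus \<open>g\<close> with one boundary component
  is homeomorphic to this quotient.
\<close>

definition rim_point :: "nat \<Rightarrow> real \<Rightarrow> complex" where
  "rim_point g s = cis (2 * pi * s / (4 * real g + 1))"

inductive rim_glued :: "nat \<Rightarrow> complex \<Rightarrow> complex \<Rightarrow> bool" for g where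
  "i < g \<Longrightarrow> t \<in> {0..1} \<Longrightarrow>
     rim_glued g (rim_point g (4 * real i + t)) (rim_point g (4 * real i + 3 - t))"
| "i < g \<Longrightarrow> t \<in> {0..1} \<Longrightarrow>
     rim_glued g (rim_point g (4 * real i + 1 + t)) (rim_point g (4 * real i + 4 - t))"

definition genus_surface_one_boundary :: "nat \<Rightarrow> 'a topology \<Rightarrow> bool" where
  "genus_surface_one_boundary g S \<longleftrightarrow>
     (\<exists>f. quotient_map (top_of_set (cball 0 1)) S f \<and>
          (\<forall>x\<in>cball 0 1. \<forall>y\<in>cball 0 1. f x = f y \<longleftrightarrow> equivclp (rim_glued g) x y))"

section \<open>Group theory\<close>

subsection \<open>Presentations\<close>

text \<open>
  A letter \<open>(x, True)\<close> stands for the generator \<open>x\<close>, and \<open>(x, False)\<close> for its inverse. A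
  relation \<open>l = r\<close> is the pair of words \<open>(l, r)\<close>.
\<close>

type_synonym 'x gword = "('x \<times> bool) list"

definition word_inv :: "'x gword \<Rightarrow> 'x gword" where
  "word_inv w = rev (map (\<lambda>(x, e). (x, \<not> e)) w)"

definition word_commutator :: "'x gword \<Rightarrow> 'x gword \<Rightarrow> 'x gword" where
  "word_commutator u v = u @ v @ word_inv u @ word_inv v"

definition word_conj :: "'x gword \<Rightarrow> 'x gword \<Rightarrow> 'x gword" where
  "word_conj u v = word_inv v @ u @ v"

inductive word_eq :: "'x set \<Rightarrow> ('x gword \<times> 'x gword) set \<Rightarrow> 'x gword \<Rightarrow> 'x gword \<Rightarrow> bool"
  for Y R where
  refl: "w \<in> lists (Y \<times> UNIV) \<Longrightarrow> word_eq Y R w w"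
| sym: "word_eq Y R u v \<Longrightarrow> word_eq Y R v u"
| trans: "word_eq Y R u v \<Longrightarrow> word_eq Y R v w \<Longrightarrow> word_eq Y R u w"
| cancel: "u \<in> lists (Y \<times> UNIV) \<Longrightarrow> v \<in> lists (Y \<times> UNIV) \<Longrightarrow> x \<in> Y \<Longrightarrow>
     word_eq Y R (u @ [(x, e), (x, \<not> e)] @ v) (u @ v)"
| relation: "u \<in> lists (Y \<times> UNIV) \<Longrightarrow> v \<in> lists (Y \<times> UNIV) \<Longrightarrow> (l, r) \<in> R \<Longrightarrow>
     l \<in> lists (Y \<times> UNIV) \<Longrightarrow> r \<in> lists (Y \<times> UNIV) \<Longrightarrow>
     word_eq Y R (u @ l @ v) (u @ r @ v)"

definition word_class :: "'x set \<Rightarrow> ('x gword \<times> 'x gword) set \<Rightarrow> 'x gword \<Rightarrow> 'x gword set" where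
  "word_class Y R w = {v. word_eq Y R w v}"

definition presented_group :: "'x set \<Rightarrow> ('x gword \<times> 'x gword) set \<Rightarrow> 'x gword set monoid" where
  "presented_group Y R =
     \<lparr>carrier = word_class Y R ` lists (Y \<times> UNIV),
      monoid.mult = (\<lambda>C D. {w. \<exists>u\<in>C. \<exists>v\<in>D. word_eq Y R (u @ v) w}),
      one = word_class Y R []\<rparr>"

subsection \<open>Lower central series, centre, semi-direct products\<close>

definition commutator_subgroup :: "('a, 'b) monoid_scheme \<Rightarrow> 'a set \<Rightarrow> 'a set \<Rightarrow> 'a set" where
  "commutator_subgroup G H K =
     generate G {x \<otimes>\<^bsub>G\<^esub> y \<otimes>\<^bsub>G\<^esub> inv\<^bsub>G\<^esub> x \<otimes>\<^bsub>G\<^esub> inv\<^bsub>G\<^esub> y | x y. x \<in> H \<and> y \<in> K}"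

text \<open>The series is indexed from \<open>1\<close>; the value at \<open>0\<close> is a dummy.\<close>

fun lower_central :: "('a, 'b) monoid_scheme \<Rightarrow> nat \<Rightarrow> 'a set" where
  "lower_central G 0 = carrier G"
| "lower_central G (Suc 0) = carrier G"
| "lower_central G (Suc (Suc i)) = commutator_subgroup G (carrier G) (lower_central G (Suc i))"

definition group_centre :: "('a, 'b) monoid_scheme \<Rightarrow> 'a set" where
  "group_centre G = {x \<in> carrier G. \<forall>y\<in>carrier G. x \<otimes>\<^bsub>G\<^esub> y = y \<otimes>\<^bsub>G\<^esub> x}"

definition semidirect_product ::
    "('a, 'c) monoid_scheme \<Rightarrow> ('b, 'd) monoid_scheme \<Rightarrow> ('b \<Rightarrow> 'a \<Rightarrow> 'a) \<Rightarrow> ('a \<times> 'b) monoid" where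
  "semidirect_product N H \<theta> =
     \<lparr>carrier = carrier N \<times> carrier H,
      monoid.mult = (\<lambda>(x, h) (y, h'). (x \<otimes>\<^bsub>N\<^esub> \<theta> h y, h \<otimes>\<^bsub>H\<^esub> h')),
      one = (\<one>\<^bsub>N\<^esub>, \<one>\<^bsub>H\<^esub>)\<rparr>"

definition int_power_group :: "nat \<Rightarrow> (nat \<Rightarrow> int) monoid" where
  "int_power_group r = product_group {1..r} (\<lambda>_. integer_group)"

definition ordered_prod :: "('a, 'b) monoid_scheme \<Rightarrow> nat \<Rightarrow> (nat \<Rightarrow> 'a) \<Rightarrow> 'a" where
  "ordered_prod G m f = foldr (\<lambda>i y. f i \<otimes>\<^bsub>G\<^esub> y) [1..<Suc m] \<one>\<^bsub>G\<^esub>"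

section \<open>The presentation of the mixed surface braid groups\<close>

text \<open>A trailing \<open>t\<close> in a constructor name, or a prime in a variable name, stands for a tilde.\<close>

datatype braid_gen = Sig nat | Sigt nat | A nat | B nat | At nat | Bt nat | Zeta nat

definition braid_gens :: "nat \<Rightarrow> nat \<Rightarrow> nat \<Rightarrow> braid_gen set" where
  "braid_gens k n g = Sig ` {1..<k} \<union> Sigt ` {1..<n} \<union> A ` {1..g} \<union> B ` {1..g}
     \<union> At ` {1..g} \<union> Bt ` {1..g} \<union> Zeta ` {1..n}"

abbreviation (input) relator :: "'x gword \<Rightarrow> 'x gword \<Rightarrow> 'x gword \<times> 'x gword" (infix "\<doteq>" 50) where
  "u \<doteq> v \<equiv> (u, v)"

text \<open>
  The words \<open>s i\<close>, \<open>a i\<close>, \<open>b i\<close> play the role of \<open>\<sigma>\<^sub>i\<close>, \<open>a\<^sub>i\<close>, \<open>b\<^sub>i\<close>; these relations occur twice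
  in the presentation, once without and once with tildes.
\<close>

definition surface_relations ::
    "nat \<Rightarrow> nat \<Rightarrow> (nat \<Rightarrow> 'x gword) \<Rightarrow> (nat \<Rightarrow> 'x gword) \<Rightarrow> (nat \<Rightarrow> 'x gword)
       \<Rightarrow> ('x gword \<times> 'x gword) set" where
  "surface_relations m g s a b =
     {s i @ s j \<doteq> s j @ s i | i j. i \<in> {1..<m} \<and> j \<in> {1..<m} \<and> (i + 2 \<le> j \<or> j + 2 \<le> i)}
   \<union> {s i @ s (i+1) @ s i \<doteq> s (i+1) @ s i @ s (i+1) | i. 1 \<le> i \<and> i + 1 < m}
   \<union> {c @ s i \<doteq> s i @ c | c i. c \<in> a ` {1..g} \<union> b ` {1..g} \<and> i \<in> {1..<m} \<and> i \<noteq> 1}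
   \<union> {c @ s 1 @ c @ s 1 \<doteq> s 1 @ c @ s 1 @ c | c. c \<in> a ` {1..g} \<union> b ` {1..g}}
   \<union> {a i @ s 1 @ b i \<doteq> s 1 @ b i @ s 1 @ a i @ s 1 | i. i \<in> {1..g}}
   \<union> {word_conj c (s 1) @ d \<doteq> d @ word_conj c (s 1) | c d i j.
        i \<in> {1..g} \<and> j \<in> {1..g} \<and> i < j \<and> c \<in> {a i, b i} \<and> d \<in> {a j, b j}}"

definition zeta_relations ::
    "nat \<Rightarrow> nat \<Rightarrow> nat \<Rightarrow> (nat \<Rightarrow> 'x gword) \<Rightarrow> (nat \<Rightarrow> 'x gword) \<Rightarrow> (nat \<Rightarrow> 'x gword)
       \<Rightarrow> (nat \<Rightarrow> 'x gword) \<Rightarrow> ('x gword \<times> 'x gword) set" where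
  "zeta_relations k n g s a b z =
     {z l @ s i \<doteq> s i @ z l | l i. l \<in> {1..n} \<and> i \<in> {1..<k} \<and> i \<noteq> 1}
   \<union> {z l @ s 1 @ z l @ s 1 \<doteq> s 1 @ z l @ s 1 @ z l | l. l \<in> {1..n}}
   \<union> {word_conj (z l) (s 1) @ c \<doteq> c @ word_conj (z l) (s 1) | l c.
        l \<in> {1..n} \<and> c \<in> a ` {1..g} \<union> b ` {1..g}}
   \<union> {word_conj (z i) (s 1) @ z j \<doteq> z j @ word_conj (z i) (s 1) | i j.
        i \<in> {1..n} \<and> j \<in> {1..n} \<and> i < j}"

definition mixed_relations ::
    "nat \<Rightarrow> nat \<Rightarrow> nat \<Rightarrow> (nat \<Rightarrow> 'x gword) \<Rightarrow> (nat \<Rightarrow> 'x gword) \<Rightarrow> (nat \<Rightarrow> 'x gword)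
       \<Rightarrow> (nat \<Rightarrow> 'x gword) \<Rightarrow> (nat \<Rightarrow> 'x gword) \<Rightarrow> (nat \<Rightarrow> 'x gword) \<Rightarrow> (nat \<Rightarrow> 'x gword)
       \<Rightarrow> ('x gword \<times> 'x gword) set" where
  "mixed_relations k n g s s' a b a' b' z =
     {y @ s j \<doteq> s j @ y | y j. y \<in> s' ` {1..<n} \<union> a' ` {1..g} \<union> b' ` {1..g} \<and> j \<in> {1..<k}}
   \<union> {s' i @ c \<doteq> c @ s' i | i c. i \<in> {1..<n} \<and> c \<in> a ` {1..g} \<union> b ` {1..g}}
   \<union> {s' i @ z (i+1) @ word_inv (s' i) \<doteq> z i | i. i \<in> {1..<n}}
   \<union> {s' i @ z i @ word_inv (s' i) \<doteq> word_inv (z i) @ z (i+1) @ z i | i. i \<in> {1..<n}}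
   \<union> {s' i @ z j @ word_inv (s' i) \<doteq> z j | i j.
        i \<in> {1..<n} \<and> j \<in> {1..n} \<and> j \<noteq> i \<and> j \<noteq> i + 1}
   \<union> (\<Union>i\<in>{1..g}. \<Union>(xt, x)\<in>{(a' i, a i), (b' i, b i)}.
        {xt @ z 1 @ word_inv xt \<doteq> word_conj (z 1) (x @ z 1)}
      \<union> {xt @ z j @ word_inv xt \<doteq>
           word_conj (z j) (word_commutator (word_inv x) (word_inv (z 1))) | j.
           j \<in> {1..n} \<and> j \<noteq> 1}
      \<union> {xt @ x @ word_inv xt \<doteq> word_inv (z 1) @ x @ z 1}
      \<union> {xt @ d @ word_inv xt \<doteq>
           word_conj d (word_commutator (word_inv x) (word_inv (z 1))) | d j.
           j \<in> {1..g} \<and> j < i \<and> d \<in> {a j, b j}}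
      \<union> {xt @ d @ word_inv xt \<doteq> d | d j. j \<in> {1..g} \<and> i < j \<and> d \<in> {a j, b j}})
   \<union> {a' i @ b i @ word_inv (a' i) \<doteq> b i @ z 1 | i. i \<in> {1..g}}
   \<union> {b' i @ a i @ word_inv (b' i) \<doteq>
        word_inv (z 1) @ a i @ word_commutator (word_inv (b i)) (word_inv (z 1)) | i. i \<in> {1..g}}"

definition braid_relations ::
    "nat \<Rightarrow> nat \<Rightarrow> nat \<Rightarrow> (braid_gen gword \<times> braid_gen gword) set" where
  "braid_relations k n g =
    (let s = (\<lambda>i. [(Sig i, True)]); s' = (\<lambda>i. [(Sigt i, True)]);
         a = (\<lambda>i. [(A i, True)]); b = (\<lambda>i. [(B i, True)]);
         a' = (\<lambda>i. [(At i, True)]); b' = (\<lambda>i. [(Bt i, True)]);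
         z = (\<lambda>i. [(Zeta i, True)])
     in surface_relations k g s a b \<union> zeta_relations k n g s a b z
        \<union> surface_relations n g s' a' b' \<union> mixed_relations k n g s s' a b a' b' z)"

definition braid_gen_class :: "nat \<Rightarrow> nat \<Rightarrow> nat \<Rightarrow> braid_gen \<Rightarrow> braid_gen gword set" where
  "braid_gen_class k n g x = word_class (braid_gens k n g) (braid_relations k n g) [(x, True)]"

end

theory Submission
  imports Defs
begin

text \<open>
  Modulo the third term of the lower central series, the relations identify all \<open>\<sigma>\<^sub>i\<close>,
  and likewise all \<open>\<sigma>t\<^sub>i\<close> and all \<open>\<zeta>\<^sub>i\<close>, and the three resulting elements become central. The
  surviving relations say that the \<open>a\<close>'s, with and without tilde, commute with each other, that so
  do the \<open>b\<close>'s, and that the commutators of the former with the latter are products of the central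
  elements. Such a group is a quotient of a semidirect product of Heisenberg type, whose action is
  given by an integral bilinear form. Conversely that semidirect product satisfies all relations of
  the presentation and is nilpotent of class two, so that the universal properties of the
  presentation and of the quotient give a map back; the two maps are inverse on generators. The
  centre is read off from the nondegeneracy of the bilinear form.
\<close>

section \<open>Presented groups\<close>

text \<open>The bound 3 on \<open>k\<close> and \<open>n\<close> enters as follows. The relations
  make \<sigma>_2, not \<sigma>_1, commute with all a_i, b_i and \<zeta>_j, and \<sigma>t_2 commute
  with \<zeta>_1. Once commutators are central, the braid relation forces \<sigma>_1 = \<sigma>_2,
  so \<sigma>_1 inherits these commutations. Conjugation by \<sigma>_1 and \<zeta>_1 then disappears
  from the relations, and what remains is [a_i, b_i] = \<sigma>^2, [at_i, bt_i] = \<sigma>t^2 and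
  [at_i, b_i] = [a_i, bt_i] = \<zeta>. These exponents are the constants of the bilinear form; they
  enter negated because the form records what is picked up when a \<open>b\<close> moves to the
  right past an \<open>a\<close>.

  The surviving relations are packaged twice: \<open>surface_braid_quotient\<close> keeps the names
  of the presentation, \<open>heisenberg_generators\<close> uses numbered coordinates. Both the
  quotient and the Heisenberg model are shown to be instances, the quotient passing from names to
  numbers and the model from numbers to names.\<close>

definition word_eval :: "('a, 'b) monoid_scheme \<Rightarrow> ('x \<Rightarrow> 'a) \<Rightarrow> 'x gword \<Rightarrow> 'a" where
  "word_eval G v w =
     foldr (\<lambda>(x, e) y. (if e then v x else inv\<^bsub>G\<^esub> (v x)) \<otimes>\<^bsub>G\<^esub> y) w \<one>\<^bsub>G\<^esub>"

lemma word_eval_Nil [simp]: "word_eval G v [] = \<one>\<^bsub>G\<^esub>"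
  by (simp add: word_eval_def)

lemma word_eval_Cons [simp]:
  "word_eval G v ((x, e) # w) = (if e then v x else inv\<^bsub>G\<^esub> (v x)) \<otimes>\<^bsub>G\<^esub> word_eval G v w"
  by (simp add: word_eval_def)

context group
begin

lemma word_eval_closed [simp]:
  "v \<in> Y \<rightarrow> carrier G \<Longrightarrow> w \<in> lists (Y \<times> UNIV) \<Longrightarrow> word_eval G v w \<in> carrier G"
  by (induction w) (auto simp: Pi_iff)

lemma word_eval_append:
  "v \<in> Y \<rightarrow> carrier G \<Longrightarrow> u \<in> lists (Y \<times> UNIV) \<Longrightarrow> w \<in> lists (Y \<times> UNIV) \<Longrightarrow>
     word_eval G v (u @ w) = word_eval G v u \<otimes> word_eval G v w"
proof (induction u)
  case (Cons p u)
  then show ?case by (cases p) (auto simp: m_assoc Pi_iff)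
qed simp

text \<open>Soundness of derivations: each rule of \<open>word_eq\<close> preserves values in a
  group where the relations hold. This is what makes evaluation well defined on classes.\<close>

lemma word_eval_cong_word_eq:
  assumes v: "v \<in> Y \<rightarrow> carrier G"
    and R: "\<And>l r. (l, r) \<in> R \<Longrightarrow> word_eval G v l = word_eval G v r"
  shows "word_eq Y R u w \<Longrightarrow> word_eval G v u = word_eval G v w"
proof (induction rule: word_eq.induct)
  case (cancel u w x e)
  then have "v x \<in> carrier G" using v by auto
  then have "word_eval G v ([(x, e), (x, \<not> e)]) = \<one>" by (cases e) simp_all
  moreover have "[(x, e), (x, \<not> e)] \<in> lists (Y \<times> UNIV)" using cancel by simp
  moreover have "[(x, e), (x, \<not> e)] @ w \<in> lists (Y \<times> UNIV)" using cancel by simp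
  ultimately show ?case using cancel v
    by (metis l_one word_eval_append word_eval_closed)
next
  case (relation u w l r)
  have "l @ w \<in> lists (Y \<times> UNIV)" "r @ w \<in> lists (Y \<times> UNIV)"
    using relation by auto
  then show ?case using relation R[of l r] v
    by (simp add: word_eval_append[where Y = Y])
qed simp_all

end

lemma word_eq_lists:
  "word_eq Y R u w \<Longrightarrow> u \<in> lists (Y \<times> UNIV) \<and> w \<in> lists (Y \<times> UNIV)"
  by (induction rule: word_eq.induct) auto

lemma word_inv_lists [simp]: "word_inv w \<in> lists (Y \<times> UNIV) \<longleftrightarrow> w \<in> lists (Y \<times> UNIV)"
  by (auto simp: word_inv_def)

lemma word_eq_append_left:
  "word_eq Y R u w \<Longrightarrow> t \<in> lists (Y \<times> UNIV) \<Longrightarrow> word_eq Y R (t @ u) (t @ w)"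
proof (induction rule: word_eq.induct)
  case (cancel u w x e)
  then show ?case using word_eq.cancel[of "t @ u" Y w x R e] by simp
next
  case (relation u w l r)
  then show ?case using word_eq.relation[of "t @ u" Y w l r R] by simp
qed (simp_all add: word_eq.refl, (blast intro: word_eq.intros)+)

lemma word_eq_append_right:
  "word_eq Y R u w \<Longrightarrow> t \<in> lists (Y \<times> UNIV) \<Longrightarrow> word_eq Y R (u @ t) (w @ t)"
proof (induction rule: word_eq.induct)
  case (cancel u w x e)
  then show ?case using word_eq.cancel[of u Y "w @ t" x R e] by simp
next
  case (relation u w l r)
  then show ?case using word_eq.relation[of u Y "w @ t" l r R] by simp
qed (simp_all add: word_eq.refl, (blast intro: word_eq.intros)+)

lemma word_eq_append:
  "word_eq Y R u u' \<Longrightarrow> word_eq Y R w w' \<Longrightarrow> word_eq Y R (u @ w) (u' @ w')"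
  by (meson word_eq.trans word_eq_append_left word_eq_append_right word_eq_lists)

lemma word_eq_inv_left:
  "w \<in> lists (Y \<times> UNIV) \<Longrightarrow> word_eq Y R (word_inv w @ w) []"
proof (induction w)
  case Nil
  then show ?case by (simp add: word_inv_def word_eq.refl)
next
  case (Cons p w)
  obtain x e where p: "p = (x, e)" by (cases p)
  \<comment> \<open>The second letter carries the sign \<open>\<not> \<not> e\<close> so that the
    pair has the shape that \<open>cancel\<close> requires at sign \<open>\<not> e\<close>.\<close>
  have "word_eq Y R (word_inv w @ [(x, \<not> e), (x, \<not> \<not> e)] @ w) (word_inv w @ w)"
    using Cons by (intro word_eq.cancel) (auto simp: p)
  moreover have "word_inv (p # w) @ p # w = word_inv w @ [(x, \<not> e), (x, \<not> \<not> e)] @ w"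
    by (simp add: word_inv_def p)
  ultimately show ?case using Cons by (metis lists.simps list.inject list.distinct(1) word_eq.trans)
qed

text \<open>Only \<open>w\<close> has to be a word over \<open>Y\<close>: reflexivity puts
  \<open>w\<close> into its own class, and equality of the classes then yields a derivation from
  \<open>u\<close> to \<open>w\<close>.\<close>

lemma word_class_eq_iff:
  "w \<in> lists (Y \<times> UNIV) \<Longrightarrow> word_class Y R u = word_class Y R w \<longleftrightarrow> word_eq Y R u w"
  unfolding word_class_def by (blast intro: word_eq.intros)

lemma mult_presented_group:
  assumes "u \<in> lists (Y \<times> UNIV)" "w \<in> lists (Y \<times> UNIV)"
  shows "word_class Y R u \<otimes>\<^bsub>presented_group Y R\<^esub> word_class Y R w = word_class Y R (u @ w)"
proof (rule Set.set_eqI, rule iffI)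
  fix t
  assume "t \<in> word_class Y R u \<otimes>\<^bsub>presented_group Y R\<^esub> word_class Y R w"
  then show "t \<in> word_class Y R (u @ w)"
    by (auto simp: presented_group_def word_class_def intro: word_eq.trans word_eq_append)
next
  fix t
  assume "t \<in> word_class Y R (u @ w)"
  then show "t \<in> word_class Y R u \<otimes>\<^bsub>presented_group Y R\<^esub> word_class Y R w"
    using assms by (auto simp: presented_group_def word_class_def intro: word_eq.refl)
qed

lemma carrier_presented_group:
  "carrier (presented_group Y R) = word_class Y R ` lists (Y \<times> UNIV)"
  by (simp add: presented_group_def)

lemma one_presented_group: "\<one>\<^bsub>presented_group Y R\<^esub> = word_class Y R []"
  by (simp add: presented_group_def)

lemma group_presented_group: "group (presented_group Y R)"
proof (rule groupI)
  show "\<exists>y\<in>carrier (presented_group Y R). y \<otimes>\<^bsub>presented_group Y R\<^esub> x = \<one>\<^bsub>presented_group Y R\<^esub>"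
    if x: "x \<in> carrier (presented_group Y R)" for x
  proof -
    obtain w where w: "w \<in> lists (Y \<times> UNIV)" "x = word_class Y R w"
      using x unfolding carrier_presented_group by blast
    then have "word_class Y R (word_inv w) \<otimes>\<^bsub>presented_group Y R\<^esub> x = \<one>\<^bsub>presented_group Y R\<^esub>"
      by (simp add: mult_presented_group one_presented_group word_class_eq_iff word_eq_inv_left)
    moreover have "word_class Y R (word_inv w) \<in> carrier (presented_group Y R)"
      unfolding carrier_presented_group by (rule imageI) (simp only: word_inv_lists w(1))
    ultimately show ?thesis by blast
  qed
qed (auto simp: carrier_presented_group one_presented_group mult_presented_group
       simp del: in_lists_conv_set del: in_listsD)

text \<open>Together with \<open>hom_word_eval\<close> this computes any homomorphism out of a
  presented group from its values on the letters, and it shows that the letters generate.\<close>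

lemma word_eval_presented_group:
  assumes "w \<in> lists (Y \<times> UNIV)"
  shows "word_eval (presented_group Y R) (\<lambda>x. word_class Y R [(x, True)]) w = word_class Y R w"
  using assms
proof (induction w)
  case Nil
  then show ?case by (simp add: one_presented_group)
next
  case (Cons p w)
  obtain x e where p: "p = (x, e)" by (cases p)
  interpret P: group "presented_group Y R" by (rule group_presented_group)
  have x: "x \<in> Y" and w: "w \<in> lists (Y \<times> UNIV)" using Cons p by auto
  have "inv\<^bsub>presented_group Y R\<^esub> word_class Y R [(x, True)] = word_class Y R [(x, False)]"
  proof (rule P.inv_equality)
    show "word_class Y R [(x, False)] \<otimes>\<^bsub>presented_group Y R\<^esub> word_class Y R [(x, True)]
        = \<one>\<^bsub>presented_group Y R\<^esub>"
      using x word_eq_inv_left[of "[(x, True)]" Y R]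
      by (simp add: mult_presented_group one_presented_group word_class_eq_iff word_inv_def)
  qed (use x in \<open>auto simp: carrier_presented_group\<close>)
  then show ?case using Cons x w
    by (cases e) (simp_all add: p mult_presented_group)
qed

lemma hom_word_eval:
  assumes h: "h \<in> hom G H" and G: "group G" and H: "group H"
    and v: "v \<in> Y \<rightarrow> carrier G" and w: "w \<in> lists (Y \<times> UNIV)"
  shows "h (word_eval G v w) = word_eval H (\<lambda>x. h (v x)) w"
proof -
  interpret group_hom G H h using h G H by (simp add: group_hom_def group_hom_axioms_def)
  show ?thesis using w
  proof (induction w)
    case (Cons p w)
    then show ?case using v by (cases p) (auto simp: Pi_iff G.word_eval_closed[OF v])
  qed simp
qed

text \<open>Von Dyck's theorem: evaluation at values that satisfy the relations is constant on
  classes, hence descends to the presented group.\<close>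

lemma presented_group_hom_exists:
  assumes H: "group H" and v: "v \<in> Y \<rightarrow> carrier H"
    and R: "\<And>l r. (l, r) \<in> R \<Longrightarrow> word_eval H v l = word_eval H v r"
  obtains h where "h \<in> hom (presented_group Y R) H"
    and "\<And>x. x \<in> Y \<Longrightarrow> h (word_class Y R [(x, True)]) = v x"
proof -
  interpret group H by (rule H)
  \<comment> \<open>The described value is unique because a class contains its representative and
    all its members evaluate to the same element.\<close>
  define h where "h C = (THE y. \<forall>w\<in>C. y = word_eval H v w)" for C
  have h: "h (word_class Y R w) = word_eval H v w" if "w \<in> lists (Y \<times> UNIV)" for w
    unfolding h_def
  proof (rule the_equality)
    show "\<forall>u\<in>word_class Y R w. word_eval H v w = word_eval H v u"
      using word_eval_cong_word_eq[OF v R] by (auto simp: word_class_def)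
  qed (use that in \<open>auto simp: word_class_def intro: word_eq.refl\<close>)
  show thesis
  proof
    show "h \<in> hom (presented_group Y R) H"
      by (rule homI)
        (auto simp: carrier_presented_group mult_presented_group h v word_eval_append[OF v]
          word_eval_closed[OF v] simp del: in_lists_conv_set del: in_listsD)
    show "h (word_class Y R [(x, True)]) = v x" if "x \<in> Y" for x
      using that funcset_mem[OF v that] by (simp add: h)
  qed
qed

lemma (in group) word_eval_in_generate:
  "v \<in> Y \<rightarrow> carrier G \<Longrightarrow> w \<in> lists (Y \<times> UNIV) \<Longrightarrow> word_eval G v w \<in> generate G (v ` Y)"
proof (induction w)
  case (Cons p w)
  then show ?case by (cases p) (auto intro: generate.intros)
qed (auto intro: generate.intros)

section \<open>Fundamental groups and lower central series\<close>

lemma loops_const: "x \<in> topspace Y \<Longrightarrow> (\<lambda>_. x) \<in> loops Y x"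
  by (simp add: loops_def pathin_const)

text \<open>Needed so that two homotopy classes with a common loop coincide.\<close>

lemma loop_homotopic_equiv:
  "equiv (loops Y x) {(p, q). p \<in> loops Y x \<and> q \<in> loops Y x \<and> loop_homotopic Y x p q}"
proof (rule equivI)
  show "refl_on (loops Y x) {(p, q). p \<in> loops Y x \<and> q \<in> loops Y x \<and> loop_homotopic Y x p q}"
    by (auto simp: refl_on_def loop_homotopic_def homotopic_with_refl loops_def pathin_def)
  show "sym {(p, q). p \<in> loops Y x \<and> q \<in> loops Y x \<and> loop_homotopic Y x p q}"
    by (auto simp: sym_def loop_homotopic_def homotopic_with_sym)
  show "trans {(p, q). p \<in> loops Y x \<and> q \<in> loops Y x \<and> loop_homotopic Y x p q}"
    unfolding trans_def loop_homotopic_def by (blast intro: homotopic_with_trans)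
qed auto

lemma one_fundamental_group_closed:
  assumes "x \<in> topspace Y"
  shows "\<one>\<^bsub>fundamental_group Y x\<^esub> \<in> carrier (fundamental_group Y x)"
proof -
  have "\<one>\<^bsub>fundamental_group Y x\<^esub> =
      {(p, q). p \<in> loops Y x \<and> q \<in> loops Y x \<and> loop_homotopic Y x p q} `` {\<lambda>_. x}"
    using loops_const[OF assms] by (auto simp: fundamental_group_def)
  then show ?thesis
    using quotientI[OF loops_const[OF assms],
        of "{(p, q). p \<in> loops Y x \<and> q \<in> loops Y x \<and> loop_homotopic Y x p q}"]
    by (simp add: fundamental_group_def)
qed

text \<open>Joining the constant loop with itself returns it on the nose, so both sides contain the
  constant loop, and classes that meet are equal. That the product is a class at all is a
  hypothesis, since it will come from the structure transported along an isomorphism and not from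
  homotopies of joins.\<close>

lemma one_fundamental_group_idem:
  assumes x: "x \<in> topspace Y"
    and closed: "\<one>\<^bsub>fundamental_group Y x\<^esub> \<otimes>\<^bsub>fundamental_group Y x\<^esub> \<one>\<^bsub>fundamental_group Y x\<^esub>
      \<in> carrier (fundamental_group Y x)"
  shows "\<one>\<^bsub>fundamental_group Y x\<^esub> \<otimes>\<^bsub>fundamental_group Y x\<^esub> \<one>\<^bsub>fundamental_group Y x\<^esub>
      = \<one>\<^bsub>fundamental_group Y x\<^esub>"
proof -
  let ?r = "{(p, q). p \<in> loops Y x \<and> q \<in> loops Y x \<and> loop_homotopic Y x p q}"
  have c: "(\<lambda>_. x) \<in> loops Y x" using x by (rule loops_const)
  then have r: "loop_homotopic Y x (\<lambda>_. x) (\<lambda>_. x)"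
    using loop_homotopic_equiv[of Y x] by (auto simp: equiv_def refl_on_def)
  have "loop_join (\<lambda>_. x) (\<lambda>_. x) = (\<lambda>_. x)" by (auto simp: loop_join_def)
  then have 1: "(\<lambda>_. x) \<in> \<one>\<^bsub>fundamental_group Y x\<^esub> \<otimes>\<^bsub>fundamental_group Y x\<^esub> \<one>\<^bsub>fundamental_group Y x\<^esub>"
    using c r by (force simp: fundamental_group_def)
  have 2: "(\<lambda>_. x) \<in> \<one>\<^bsub>fundamental_group Y x\<^esub>"
    using c r by (simp add: fundamental_group_def)
  have carrier: "carrier (fundamental_group Y x) = loops Y x // ?r"
    by (simp add: fundamental_group_def)
  show ?thesis
    using quotient_disj[OF loop_homotopic_equiv closed[unfolded carrier]
        one_fundamental_group_closed[OF x, unfolded carrier]] 1 2 by blast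
qed

text \<open>
  The unit of \<open>fundamental_group Y x\<close> is an idempotent of the carrier, hence equal to the unit
  transported from \<open>P\<close>; no property of path composition is needed.
\<close>

lemma group_fundamental_group_iso:
  assumes P: "group P" and h: "h \<in> iso P (fundamental_group Y x)" and x: "x \<in> topspace Y"
  shows "group (fundamental_group Y x)"
proof -
  let ?G = "fundamental_group Y x"
  have G: "group (?G\<lparr>one := h \<one>\<^bsub>P\<^esub>\<rparr>)"
    using group.iso_imp_img_group[OF P h] .
  interpret G': group "?G\<lparr>one := h \<one>\<^bsub>P\<^esub>\<rparr>" by (rule G)
  have o: "\<one>\<^bsub>?G\<^esub> \<in> carrier ?G" using x by (rule one_fundamental_group_closed)
  have "\<one>\<^bsub>?G\<^esub> \<otimes>\<^bsub>?G\<^esub> \<one>\<^bsub>?G\<^esub> = \<one>\<^bsub>?G\<^esub>"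
    using G'.m_closed[of "\<one>\<^bsub>?G\<^esub>" "\<one>\<^bsub>?G\<^esub>"] o by (intro one_fundamental_group_idem x) simp
  then have "\<one>\<^bsub>?G\<^esub> = h \<one>\<^bsub>P\<^esub>"
    using G'.r_cancel_one[of "\<one>\<^bsub>?G\<^esub>" "\<one>\<^bsub>?G\<^esub>"] o by simp
  then have "?G\<lparr>one := h \<one>\<^bsub>P\<^esub>\<rparr> = ?G" by (metis monoid.surjective monoid.update_convs(2))
  then show ?thesis using G by simp
qed

section \<open>Commutators and the lower central series\<close>

context group
begin

lemma commute_inv:
  assumes "x \<otimes> u = u \<otimes> x" "x \<in> carrier G" "u \<in> carrier G"
  shows "inv x \<otimes> u = u \<otimes> inv x"
proof -
  have "inv x \<otimes> u = inv x \<otimes> (u \<otimes> x) \<otimes> inv x"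
    using assms(2,3) by (simp add: m_assoc)
  also have "\<dots> = inv x \<otimes> (x \<otimes> u) \<otimes> inv x"
    by (simp add: assms(1))
  also have "\<dots> = u \<otimes> inv x"
    using assms(2,3) by (simp flip: m_assoc)
  finally show ?thesis .
qed

lemma commute_mult:
  assumes "x \<otimes> u = u \<otimes> x" "y \<otimes> u = u \<otimes> y"
    "x \<in> carrier G" "y \<in> carrier G" "u \<in> carrier G"
  shows "(x \<otimes> y) \<otimes> u = u \<otimes> (x \<otimes> y)"
  using assms by (metis m_assoc)

lemma commutator_conj:
  assumes "x \<in> carrier G" "y \<in> carrier G" "u \<in> carrier G"
  shows "u \<otimes> (x \<otimes> y \<otimes> inv x \<otimes> inv y) \<otimes> inv u =
    (u \<otimes> x \<otimes> inv u) \<otimes> (u \<otimes> y \<otimes> inv u) \<otimes> inv (u \<otimes> x \<otimes> inv u) \<otimes> inv (u \<otimes> y \<otimes> inv u)"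
  using assms by (simp add: m_assoc inv_mult_group) (simp add: inv_solve_left flip: m_assoc)

text \<open>A conjugate of [x, y] is the commutator of the conjugates, and \<open>H\<close> is
  normal, so already the generating set is stable under conjugation.\<close>

lemma commutator_subgroup_normal:
  assumes H: "H \<lhd> G"
  shows "commutator_subgroup G (carrier G) H \<lhd> G"
proof -
  interpret H: normal H G by (rule H)
  let ?C = "{x \<otimes> y \<otimes> inv x \<otimes> inv y | x y. x \<in> carrier G \<and> y \<in> H}"
  have C: "?C \<subseteq> carrier G" by auto
  show ?thesis
    unfolding commutator_subgroup_def
  proof (rule normal_generateI[OF C])
    fix c u
    assume "c \<in> ?C" and u: "u \<in> carrier G"
    then obtain x y where xy: "x \<in> carrier G" "y \<in> H" "c = x \<otimes> y \<otimes> inv x \<otimes> inv y" by blast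
    then have "u \<otimes> c \<otimes> inv u = (u \<otimes> x \<otimes> inv u) \<otimes> (u \<otimes> y \<otimes> inv u)
        \<otimes> inv (u \<otimes> x \<otimes> inv u) \<otimes> inv (u \<otimes> y \<otimes> inv u)"
      using u commutator_conj[of x y u] by simp
    moreover have "u \<otimes> y \<otimes> inv u \<in> H" using xy u by (simp add: H.inv_op_closed2)
    moreover have "u \<otimes> x \<otimes> inv u \<in> carrier G" using xy u by simp
    ultimately show "u \<otimes> c \<otimes> inv u \<in> ?C" by blast
  qed
qed

lemma lower_central_normal: "lower_central G i \<lhd> G"
proof (induction i)
  case (Suc i)
  then show ?case by (cases i) (simp_all add: normal_self commutator_subgroup_normal)
qed (simp add: normal_self)

end

text \<open>For y in the second term of the series, h y commutes with the image of \<open>h\<close>,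
  so \<open>h\<close> sends every [x, y] to the unit.\<close>

lemma (in group) hom_vanishes_on_lower_central_3:
  assumes H: "group H" and h: "h \<in> hom G H"
    and class2: "\<And>x y u. x \<in> carrier H \<Longrightarrow> y \<in> carrier H \<Longrightarrow> u \<in> carrier H \<Longrightarrow>
      (x \<otimes>\<^bsub>H\<^esub> y \<otimes>\<^bsub>H\<^esub> inv\<^bsub>H\<^esub> x \<otimes>\<^bsub>H\<^esub> inv\<^bsub>H\<^esub> y) \<otimes>\<^bsub>H\<^esub> u = u \<otimes>\<^bsub>H\<^esub> (x \<otimes>\<^bsub>H\<^esub> y \<otimes>\<^bsub>H\<^esub> inv\<^bsub>H\<^esub> x \<otimes>\<^bsub>H\<^esub> inv\<^bsub>H\<^esub> y)"
  shows "h ` lower_central G 3 \<subseteq> {\<one>\<^bsub>H\<^esub>}"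
proof -
  interpret h: group_hom G H h using H h by (simp add: group_hom_def group_hom_axioms_def)
  \<comment> \<open>The preimage of the centraliser of the image of \<open>h\<close>. As it is a
    subgroup, only the commutators that generate the second term have to be tested.\<close>
  let ?Z = "{x \<in> carrier G. \<forall>u\<in>carrier G. h x \<otimes>\<^bsub>H\<^esub> h u = h u \<otimes>\<^bsub>H\<^esub> h x}"
  have Z: "subgroup ?Z G"
  proof (rule subgroupI)
    fix a assume "a \<in> ?Z"
    then have a: "a \<in> carrier G" "\<And>u. u \<in> carrier G \<Longrightarrow> h a \<otimes>\<^bsub>H\<^esub> h u = h u \<otimes>\<^bsub>H\<^esub> h a" by auto
    have "inv\<^bsub>H\<^esub> h a \<otimes>\<^bsub>H\<^esub> h u = h u \<otimes>\<^bsub>H\<^esub> inv\<^bsub>H\<^esub> h a" if "u \<in> carrier G" for u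
      using a(2)[OF that] that a(1) by (metis h.H.commute_inv h.hom_closed)
    then show "inv a \<in> ?Z" using a by simp
  next
    fix a b assume "a \<in> ?Z" "b \<in> ?Z"
    then have ab: "a \<in> carrier G" "b \<in> carrier G"
      and comm: "\<And>u. u \<in> carrier G \<Longrightarrow> h a \<otimes>\<^bsub>H\<^esub> h u = h u \<otimes>\<^bsub>H\<^esub> h a"
        "\<And>u. u \<in> carrier G \<Longrightarrow> h b \<otimes>\<^bsub>H\<^esub> h u = h u \<otimes>\<^bsub>H\<^esub> h b"
      by blast+
    have "h a \<otimes>\<^bsub>H\<^esub> h b \<otimes>\<^bsub>H\<^esub> h u = h u \<otimes>\<^bsub>H\<^esub> (h a \<otimes>\<^bsub>H\<^esub> h b)" if "u \<in> carrier G" for u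
      using h.H.commute_mult[OF comm(1)[OF that] comm(2)[OF that]] ab that by simp
    then show "a \<otimes> b \<in> ?Z" using ab by simp
  qed auto
  have 2: "lower_central G 2 \<subseteq> ?Z"
    unfolding numeral_2_eq_2 lower_central.simps commutator_subgroup_def
  proof (rule generate_subgroup_incl[OF _ Z], clarify, intro conjI ballI)
    fix x y u assume "x \<in> carrier G" "y \<in> carrier G" "u \<in> carrier G"
    then show "h (x \<otimes> y \<otimes> inv x \<otimes> inv y) \<otimes>\<^bsub>H\<^esub> h u = h u \<otimes>\<^bsub>H\<^esub> h (x \<otimes> y \<otimes> inv x \<otimes> inv y)"
      using class2[of "h x" "h y" "h u"] by simp
  qed simp
  have "lower_central G 3 = commutator_subgroup G (carrier G) (lower_central G 2)"
    by (simp add: numeral_3_eq_3 numeral_2_eq_2)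
  also have "\<dots> \<subseteq> kernel G H h"
    unfolding commutator_subgroup_def
  proof (rule generate_subgroup_incl[OF _ h.subgroup_kernel], safe)
    fix x y assume x: "x \<in> carrier G" and y: "y \<in> lower_central G 2"
    then have "y \<in> carrier G" "h y \<otimes>\<^bsub>H\<^esub> h x = h x \<otimes>\<^bsub>H\<^esub> h y" using 2 by auto
    moreover have "h y \<otimes>\<^bsub>H\<^esub> h x \<otimes>\<^bsub>H\<^esub> inv\<^bsub>H\<^esub> h x = h y"
      using x \<open>y \<in> carrier G\<close> by (subst h.H.m_assoc) simp_all
    ultimately show "x \<otimes> y \<otimes> inv x \<otimes> inv y \<in> kernel G H h"
      using x by (simp add: kernel_def)
  qed
  finally show ?thesis by (auto simp: kernel_def)
qed

lemma (in normal) FactGroup_hom_exists: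
  assumes K: "group K" and h: "h \<in> hom G K" and ker: "h ` H \<subseteq> {\<one>\<^bsub>K\<^esub>}"
  obtains f where "f \<in> hom (G Mod H) K" and "\<And>x. x \<in> carrier G \<Longrightarrow> f (H #> x) = h x"
proof -
  interpret h: group_hom G K h using K h by (simp add: group_hom_def group_hom_axioms_def is_group)
  \<comment> \<open>A homomorphism that kills \<open>H\<close> is constant on every coset, so the
    image of a coset is a singleton.\<close>
  define f where "f C = the_elem (h ` C)" for C
  have f: "f (H #> x) = h x" if "x \<in> carrier G" for x
  proof -
    have "h y = h x" if y: "y \<in> H #> x" for y
      using y ker \<open>x \<in> carrier G\<close> subset by (auto simp: r_coset_def)
    moreover have "x \<in> H #> x" using that by (rule rcos_self) (rule is_subgroup)
    ultimately have "h ` (H #> x) = {h x}" by blast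
    then show ?thesis by (simp add: f_def)
  qed
  show thesis
  proof
    show "f \<in> hom (G Mod H) K"
      by (rule homI) (auto simp: FactGroup_def RCOSETS_def f rcos_sum)
  qed (rule f)
qed

text \<open>The quotient has nilpotency class at most two: for lifts a, b, c of x, y, u and k =
  [a, b], the element [c, k] lies in the third term and dies in the quotient.\<close>

lemma (in group) FactGroup_lower_central_3_class2:
  assumes "x \<in> carrier (G Mod lower_central G 3)" "y \<in> carrier (G Mod lower_central G 3)"
    "u \<in> carrier (G Mod lower_central G 3)"
  defines "Q \<equiv> G Mod lower_central G 3"
  shows "(x \<otimes>\<^bsub>Q\<^esub> y \<otimes>\<^bsub>Q\<^esub> inv\<^bsub>Q\<^esub> x \<otimes>\<^bsub>Q\<^esub> inv\<^bsub>Q\<^esub> y) \<otimes>\<^bsub>Q\<^esub> u = u \<otimes>\<^bsub>Q\<^esub> (x \<otimes>\<^bsub>Q\<^esub> y \<otimes>\<^bsub>Q\<^esub> inv\<^bsub>Q\<^esub> x \<otimes>\<^bsub>Q\<^esub> inv\<^bsub>Q\<^esub> y)"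
proof -
  interpret N: normal "lower_central G 3" G by (rule lower_central_normal)
  interpret Q: group Q unfolding Q_def by (rule N.factorgroup_is_group)
  define p where "p x = lower_central G 3 #> x" for x
  have p: "group_hom G Q p"
    using N.r_coset_hom_Mod N.factorgroup_is_group
    by (simp add: group_hom_def group_hom_axioms_def Q_def p_def[abs_def])
  interpret p: group_hom G Q p by (rule p)
  obtain a b c where abc: "a \<in> carrier G" "b \<in> carrier G" "c \<in> carrier G" "x = p a" "y = p b" "u = p c"
    using assms by (auto simp: FactGroup_def RCOSETS_def p_def)
  let ?k = "a \<otimes> b \<otimes> inv a \<otimes> inv b"
  have 2: "?k \<in> lower_central G 2"
    unfolding numeral_2_eq_2 lower_central.simps commutator_subgroup_def
    using abc by (intro generate.incl) auto
  have "c \<otimes> ?k \<otimes> inv c \<otimes> inv ?k \<in> commutator_subgroup G (carrier G) (lower_central G 2)"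
    unfolding commutator_subgroup_def using abc 2 by (intro generate.incl) auto
  then have "c \<otimes> ?k \<otimes> inv c \<otimes> inv ?k \<in> lower_central G 3"
    by (simp add: numeral_3_eq_3 numeral_2_eq_2)
  then have "p (c \<otimes> ?k \<otimes> inv c \<otimes> inv ?k) = \<one>\<^bsub>Q\<^esub>"
    by (simp add: p_def Q_def FactGroup_def N.rcos_const)
  \<comment> \<open>Written as c k = [c, k] (k c), the vanishing of [c, k] becomes
    commutation.\<close>
  moreover have "c \<otimes> k = (c \<otimes> k \<otimes> inv c \<otimes> inv k) \<otimes> (k \<otimes> c)" if "k \<in> carrier G" for k
    using that abc(3) by (simp add: m_assoc) (simp flip: m_assoc)
  ultimately have "p (c \<otimes> ?k) = \<one>\<^bsub>Q\<^esub> \<otimes>\<^bsub>Q\<^esub> p (?k \<otimes> c)"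
    using abc p.hom_mult[of "c \<otimes> ?k \<otimes> inv c \<otimes> inv ?k" "?k \<otimes> c"] by simp
  then show ?thesis using abc by simp
qed

section \<open>Products of powers\<close>

definition power_prod :: "('a, 'b) monoid_scheme \<Rightarrow> nat \<Rightarrow> (nat \<Rightarrow> 'a) \<Rightarrow> (nat \<Rightarrow> int) \<Rightarrow> 'a" where
  "power_prod G r x m = ordered_prod G r (\<lambda>i. x i [^]\<^bsub>G\<^esub> m i)"

declare One_nat_def [simp del]

lemma Pi_Suc_atLeastAtMost:
  "x \<in> {1..Suc r} \<rightarrow> C \<longleftrightarrow> x \<in> {1..r} \<rightarrow> C \<and> x (Suc r) \<in> C"
proof -
  have "{1..Suc r} = insert (Suc r) {1..r}" by auto
  then show ?thesis by (auto simp: Pi_iff)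
qed

context group
begin

lemma foldr_mult_closed:
  "(\<And>i. i \<in> set is \<Longrightarrow> f i \<in> carrier G) \<Longrightarrow> y \<in> carrier G \<Longrightarrow>
     foldr (\<lambda>i y. f i \<otimes> y) is y \<in> carrier G"
  by (induction "is") auto

text \<open>The fold is unwound from the left, whereas inductions on the number of factors add one
  at the right end; extracting the start value mediates between the two.\<close>

lemma foldr_mult_start:
  "(\<And>i. i \<in> set is \<Longrightarrow> f i \<in> carrier G) \<Longrightarrow> y \<in> carrier G \<Longrightarrow>
     foldr (\<lambda>i y. f i \<otimes> y) is y = foldr (\<lambda>i y. f i \<otimes> y) is \<one> \<otimes> y"
  by (induction "is") (auto simp: m_assoc foldr_mult_closed)

lemma ordered_prod_0 [simp]: "ordered_prod G 0 f = \<one>"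
  by (simp add: ordered_prod_def)

lemma ordered_prod_closed [simp]:
  "f \<in> {1..r} \<rightarrow> carrier G \<Longrightarrow> ordered_prod G r f \<in> carrier G"
  unfolding ordered_prod_def by (rule foldr_mult_closed) auto

lemma ordered_prod_Suc:
  assumes "f \<in> {1..Suc r} \<rightarrow> carrier G"
  shows "ordered_prod G (Suc r) f = ordered_prod G r f \<otimes> f (Suc r)"
proof -
  have f: "f i \<in> carrier G" if "i \<in> {1..Suc r}" for i using assms that by blast
  have "ordered_prod G (Suc r) f = foldr (\<lambda>i y. f i \<otimes> y) [1..<Suc r] (f (Suc r) \<otimes> \<one>)"
    by (simp add: ordered_prod_def)
  also have "\<dots> = ordered_prod G r f \<otimes> (f (Suc r) \<otimes> \<one>)"
    unfolding ordered_prod_def using f[of "Suc r"] by (intro foldr_mult_start) (auto intro: f)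
  finally show ?thesis using f[of "Suc r"] by simp
qed

lemma ordered_prod_cong:
  "(\<And>i. i \<in> {1..r} \<Longrightarrow> f i = f' i) \<Longrightarrow> ordered_prod G r f = ordered_prod G r f'"
  unfolding ordered_prod_def by (rule foldr_cong) auto

text \<open>Pure reassociation: the factors need not commute. It turns a product over the numbered
  generators into the product of pairs (plain, tilde) of the normal form.\<close>

lemma ordered_prod_double:
  assumes "f \<in> {1..2 * g} \<rightarrow> carrier G"
  shows "ordered_prod G (2 * g) f = ordered_prod G g (\<lambda>i. f (2 * i - 1) \<otimes> f (2 * i))"
  using assms
proof (induction g)
  case (Suc g)
  have c: "f i \<in> carrier G" if "1 \<le> i" "i \<le> Suc (Suc (2 * g))" for i
    using Suc.prems that by auto
  have f: "f \<in> {1..Suc (Suc (2 * g))} \<rightarrow> carrier G" "f \<in> {1..Suc (2 * g)} \<rightarrow> carrier G" "f \<in> {1..2 *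
      g} \<rightarrow> carrier G"
    using c by auto
  have "ordered_prod G (2 * Suc g) f = ordered_prod G (2 * g) f \<otimes> f (Suc (2 * g)) \<otimes> f (Suc (Suc (2 * g)))"
    using f by (simp add: ordered_prod_Suc)
  also have "\<dots> = ordered_prod G g (\<lambda>i. f (2 * i - 1) \<otimes> f (2 * i)) \<otimes> (f (Suc (2 * g)) \<otimes> f (Suc (Suc (2 * g))))"
    using c[of "Suc (2 * g)"] c[of "Suc (Suc (2 * g))"] ordered_prod_closed[OF f(3)]
    by (simp only: m_assoc Suc.IH[OF f(3)])
  also have "\<dots> = ordered_prod G (Suc g) (\<lambda>i. f (2 * i - 1) \<otimes> f (2 * i))"
    by (subst ordered_prod_Suc) (auto intro!: m_closed c)
  finally show ?case .
qed simp

lemma power_prod_closed [simp]: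
  "x \<in> {1..r} \<rightarrow> carrier G \<Longrightarrow> power_prod G r x m \<in> carrier G"
  unfolding power_prod_def by (rule ordered_prod_closed) auto

lemma power_prod_0 [simp]: "power_prod G 0 x m = \<one>"
  by (simp add: power_prod_def)

lemma power_prod_Suc:
  "x \<in> {1..Suc r} \<rightarrow> carrier G \<Longrightarrow>
     power_prod G (Suc r) x m = power_prod G r x m \<otimes> x (Suc r) [^] m (Suc r)"
  unfolding power_prod_def by (rule ordered_prod_Suc) auto

lemma power_prod_cong:
  "(\<And>i. i \<in> {1..r} \<Longrightarrow> m i = m' i) \<Longrightarrow> power_prod G r x m = power_prod G r x m'"
  unfolding power_prod_def by (rule ordered_prod_cong) simp

lemma commute_nat_pow:
  "x \<otimes> u = u \<otimes> x \<Longrightarrow> x \<in> carrier G \<Longrightarrow> u \<in> carrier G \<Longrightarrow> x [^] (n::nat) \<otimes> u = u \<otimes> x [^] n"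
  by (induction n) (simp_all add: commute_mult)

lemma commute_int_pow:
  "x \<otimes> u = u \<otimes> x \<Longrightarrow> x \<in> carrier G \<Longrightarrow> u \<in> carrier G \<Longrightarrow> x [^] (n::int) \<otimes> u = u \<otimes> x [^] n"
  by (cases n rule: int_cases2) (simp_all add: int_pow_int int_pow_neg commute_nat_pow commute_inv)

lemma commute_power_prod:
  "x \<in> {1..r} \<rightarrow> carrier G \<Longrightarrow> u \<in> carrier G \<Longrightarrow>
     (\<And>i. i \<in> {1..r} \<Longrightarrow> x i \<otimes> u = u \<otimes> x i) \<Longrightarrow>
     power_prod G r x m \<otimes> u = u \<otimes> power_prod G r x m"
proof (induction r)
  case (Suc r)
  have c: "x \<in> {1..r} \<rightarrow> carrier G" "x (Suc r) \<in> carrier G"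
    using Suc.prems(1) by (simp_all only: Pi_Suc_atLeastAtMost)
  have "power_prod G r x m \<otimes> u = u \<otimes> power_prod G r x m"
    by (rule Suc.IH) (use c Suc.prems in auto)
  moreover have "x (Suc r) [^] m (Suc r) \<otimes> u = u \<otimes> x (Suc r) [^] m (Suc r)"
    by (rule commute_int_pow) (use c Suc.prems in auto)
  ultimately show ?case
    unfolding power_prod_Suc[OF Suc.prems(1)]
    using c Suc.prems(2) by (intro commute_mult) simp_all
qed simp

lemma power_prod_add:
  assumes "x \<in> {1..r} \<rightarrow> carrier G"
    and "\<And>i j. i \<in> {1..r} \<Longrightarrow> j \<in> {1..r} \<Longrightarrow> x i \<otimes> x j = x j \<otimes> x i"
  shows "power_prod G r x (\<lambda>i. m i + m' i) = power_prod G r x m \<otimes> power_prod G r x m'"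
  using assms
proof (induction r)
  case (Suc r)
  let ?u = "x (Suc r) [^] m (Suc r)" and ?P = "power_prod G r x"
  have x: "x \<in> {1..r} \<rightarrow> carrier G" "x (Suc r) \<in> carrier G"
    using Suc.prems(1) by (simp_all only: Pi_Suc_atLeastAtMost)
  have c: "?u \<in> carrier G" "\<And>m. ?P m \<in> carrier G" "x (Suc r) [^] m' (Suc r) \<in> carrier G"
    using x by simp_all
  have "?P m' \<otimes> ?u = ?u \<otimes> ?P m'"
  proof (rule commute_power_prod)
    show "x i \<otimes> ?u = ?u \<otimes> x i" if "i \<in> {1..r}" for i
      by (rule commute_int_pow[symmetric]) (use that x Suc.prems(2) in auto)
  qed (use x in auto)
  then have "?P m \<otimes> ?P m' \<otimes> (?u \<otimes> x (Suc r) [^] m' (Suc r)) = ?P m \<otimes> ?u \<otimes> (?P m' \<otimes> x (Suc r) [^] m' (Suc r))"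
    using c by (metis m_assoc m_closed)
  moreover have "?P (\<lambda>i. m i + m' i) = ?P m \<otimes> ?P m'" by (rule Suc.IH) (use x Suc.prems in auto)
  ultimately show ?case
    using x(2) by (simp add: power_prod_Suc[OF Suc.prems(1)] int_pow_mult)
qed simp

lemma power_prod_zero: "x \<in> {1..r} \<rightarrow> carrier G \<Longrightarrow> power_prod G r x (\<lambda>_. 0) = \<one>"
  by (induction r) (simp_all add: power_prod_Suc Pi_Suc_atLeastAtMost[simplified])

lemma power_prod_single:
  "x \<in> {1..r} \<rightarrow> carrier G \<Longrightarrow> j \<in> {1..r} \<Longrightarrow>
     power_prod G r x (\<lambda>i. if i = j then 1 else 0) = x j"
proof (induction r)
  case (Suc r)
  have x: "x \<in> {1..r} \<rightarrow> carrier G" "x (Suc r) \<in> carrier G"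
    using Suc.prems(1) by (simp_all only: Pi_Suc_atLeastAtMost)
  show ?case
  proof (cases "j = Suc r")
    case True
    have "power_prod G r x (\<lambda>i. if i = j then 1 else 0) = power_prod G r x (\<lambda>_. 0)"
      by (rule power_prod_cong) (use True in auto)
    also have "\<dots> = \<one>" by (rule power_prod_zero) (rule x)
    finally show ?thesis
      using x(2) True by (simp add: power_prod_Suc[OF Suc.prems(1)])
  next
    case False
    then have "power_prod G r x (\<lambda>i. if i = j then 1 else 0) = x j"
      by (intro Suc.IH) (use x Suc.prems in auto)
    moreover have "x j \<in> carrier G" using Suc.prems by blast
    ultimately show ?thesis
      using False by (simp add: power_prod_Suc[OF Suc.prems(1)])
  qed
qed simp

end

lemma hom_power_prod:
  assumes "group G" "group H" "h \<in> hom G H" "x \<in> {1..r} \<rightarrow> carrier G"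
  shows "h (power_prod G r x m) = power_prod H r (\<lambda>i. h (x i)) m"
proof -
  interpret group_hom G H h using assms by (simp add: group_hom_def group_hom_axioms_def)
  show ?thesis using assms(4)
  proof (induction r)
    case (Suc r)
    have x: "x \<in> {1..r} \<rightarrow> carrier G" "x (Suc r) \<in> carrier G"
      using Suc.prems(1) by (simp_all only: Pi_Suc_atLeastAtMost)
    have "(\<lambda>i. h (x i)) \<in> {1..Suc r} \<rightarrow> carrier H"
      using Suc.prems by (simp add: Pi_iff)
    then show ?case
      using x Suc.IH by (simp add: G.power_prod_Suc[OF Suc.prems] H.power_prod_Suc hom_int_pow)
  qed simp
qed

section \<open>The free abelian groups of finite rank\<close>

lemma group_int_power_group [simp]: "group (int_power_group r)"
  by (simp add: int_power_group_def)

lemma carrier_int_power_group: "carrier (int_power_group r) = ({1..r} \<rightarrow>\<^sub>E UNIV)"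
  by (simp add: int_power_group_def)

lemma one_int_power_group: "\<one>\<^bsub>int_power_group r\<^esub> = (\<lambda>i\<in>{1..r}. 0)"
  by (simp add: int_power_group_def)

lemma mult_int_power_group: "m \<otimes>\<^bsub>int_power_group r\<^esub> m' = (\<lambda>i\<in>{1..r}. m i + m' i)"
  by (simp add: int_power_group_def)

lemma restrict_in_int_power_group [simp]: "restrict m {1..r} \<in> carrier (int_power_group r)"
  by (simp add: carrier_int_power_group)

definition int_unit :: "nat \<Rightarrow> nat \<Rightarrow> nat \<Rightarrow> int" where
  "int_unit r j = (\<lambda>i\<in>{1..r}. if i = j then 1 else 0)"

lemma int_unit_closed [simp]: "int_unit r j \<in> carrier (int_power_group r)"
  by (simp add: int_unit_def)

lemma (in group) power_prod_int_unit:
  "x \<in> {1..r} \<rightarrow> carrier G \<Longrightarrow> j \<in> {1..r} \<Longrightarrow> power_prod G r x (int_unit r j) = x j"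
  using power_prod_single[of x r j] power_prod_cong[of r "int_unit r j" "\<lambda>i. if i = j then 1 else 0" x]
  by (simp add: int_unit_def)

text \<open>The universal property of Z^r for commuting elements; by
  \<open>power_prod_int_unit\<close> the basis vectors go to the given elements.\<close>

lemma (in group) power_prod_hom:
  assumes "x \<in> {1..r} \<rightarrow> carrier G"
    and "\<And>i j. i \<in> {1..r} \<Longrightarrow> j \<in> {1..r} \<Longrightarrow> x i \<otimes> x j = x j \<otimes> x i"
  shows "power_prod G r x \<in> hom (int_power_group r) G"
proof (rule homI)
  fix m m'
  have "power_prod G r x (m \<otimes>\<^bsub>int_power_group r\<^esub> m') = power_prod G r x (\<lambda>i. m i + m' i)"
    by (rule power_prod_cong) (simp add: mult_int_power_group)
  then show "power_prod G r x (m \<otimes>\<^bsub>int_power_group r\<^esub> m') = power_prod G r x m \<otimes> power_prod G r x m'"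
    using power_prod_add[OF assms] by simp
qed (use power_prod_closed assms(1) in blast)

lemma int_power_group_int_pow:
  assumes "m \<in> carrier (int_power_group r)"
  shows "m [^]\<^bsub>int_power_group r\<^esub> (n::int) = (\<lambda>i\<in>{1..r}. n * m i)"
proof -
  interpret group "int_power_group r" by simp
  have nat: "m [^]\<^bsub>int_power_group r\<^esub> (k::nat) = (\<lambda>i\<in>{1..r}. int k * m i)" for k
    by (induction k) (auto simp: one_int_power_group mult_int_power_group algebra_simps)
  have inv: "inv\<^bsub>int_power_group r\<^esub> u = (\<lambda>i\<in>{1..r}. - u i)" if "u \<in> carrier (int_power_group r)" for u
    by (rule inv_equality) (use that in \<open>auto simp: one_int_power_group mult_int_power_group\<close>)
  show ?thesis
    by (cases n rule: int_cases2) (auto simp: int_pow_int int_pow_neg nat inv assms)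
qed

lemma power_prod_int_units:
  assumes "m \<in> carrier (int_power_group r)"
  shows "power_prod (int_power_group r) r (int_unit r) m = m"
proof -
  interpret group "int_power_group r" by simp
  \<comment> \<open>Partial products truncate \<open>m\<close>: after \<open>q\<close> factors the
    coordinates beyond \<open>q\<close> are still zero. The case \<open>q = r\<close> is the
    claim.\<close>
  have "power_prod (int_power_group r) q (int_unit r) m = (\<lambda>i\<in>{1..r}. if i \<le> q then m i else 0)"
    if "q \<le> r" for q
    using that
  proof (induction q)
    case 0
    then show ?case by (auto simp: one_int_power_group)
  next
    case (Suc q)
    have "power_prod (int_power_group r) (Suc q) (int_unit r) m =
        (\<lambda>i\<in>{1..r}. if i \<le> q then m i else 0) \<otimes>\<^bsub>int_power_group r\<^esub> (\<lambda>i\<in>{1..r}. m (Suc q) * int_unit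
            r (Suc q) i)"
      using Suc by (simp add: power_prod_Suc int_power_group_int_pow del: restrict_apply)
    also have "\<dots> = (\<lambda>i\<in>{1..r}. if i \<le> Suc q then m i else 0)"
      by (auto simp: mult_int_power_group int_unit_def fun_eq_iff le_Suc_eq)
    finally show ?case .
  qed
  from this[of r] show ?thesis
    using assms by (auto simp: carrier_int_power_group PiE_def extensional_def fun_eq_iff)
qed

lemma (in group) power_prod_image:
  assumes c: "x \<in> {1..r} \<rightarrow> carrier G"
    and comm: "\<And>i j. i \<in> {1..r} \<Longrightarrow> j \<in> {1..r} \<Longrightarrow> x i \<otimes> x j = x j \<otimes> x i"
  shows "power_prod G r x ` carrier (int_power_group r) = generate G (x ` {1..r})"
proof
  have gen: "subgroup (generate G (x ` {1..r})) G"
    using c by (intro generate_is_subgroup) auto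
  have "power_prod G q x m \<in> generate G (x ` {1..r})" if "q \<le> r" for m q
    using that
  proof (induction q)
    case (Suc q)
    have "x (Suc q) \<in> generate G (x ` {1..r})" using Suc.prems by (intro generate.incl) simp
    then have "x (Suc q) [^] m (Suc q) \<in> generate G (x ` {1..r})"
      using subgroup_int_pow_closed[OF gen] by simp
    moreover have "power_prod G (Suc q) x m = power_prod G q x m \<otimes> x (Suc q) [^] m (Suc q)"
      by (rule power_prod_Suc) (use Suc.prems c in auto)
    ultimately show ?case using Suc by (simp add: subgroup.m_closed[OF gen])
  qed (simp add: generate.one)
  then show "power_prod G r x ` carrier (int_power_group r) \<subseteq> generate G (x ` {1..r})" by auto
  interpret h: group_hom "int_power_group r" G "power_prod G r x"
    using power_prod_hom[OF c comm] is_group by (simp add: group_hom_def group_hom_axioms_def)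
  show "generate G (x ` {1..r}) \<subseteq> power_prod G r x ` carrier (int_power_group r)"
  proof (rule generate_subgroup_incl[OF _ h.img_is_subgroup])
    show "x ` {1..r} \<subseteq> power_prod G r x ` carrier (int_power_group r)"
      using power_prod_int_unit[OF c] int_unit_closed by (metis (no_types, lifting) image_iff image_subsetI)
  qed
qed

lemma int_power_group_iso_free: "int_power_group r \<cong> free_Abelian_group {1..r}"
proof -
  \<comment> \<open>Over a finite index set the finite support condition of the direct sum is
    vacuous, so sum and product coincide.\<close>
  have "carrier (sum_group {1..r} (\<lambda>_. integer_group)) = carrier (int_power_group r)"
    by (simp add: carrier_sum_group int_power_group_def)
  then have "int_power_group r = sum_group {1..r} (\<lambda>_. integer_group)"
    by (simp add: sum_group_def int_power_group_def)
  then show ?thesis using isomorphic_sum_integer_group by metis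
qed

section \<open>Semidirect products of Heisenberg type\<close>

text \<open>The bilinear map Z^t x Z^s \<rightarrow> Z^r with structure constants
  \<open>e j i k\<close>: the exponent of the \<open>k\<close>-th central generator that appears
  when the \<open>j\<close>-th generator of the acting factor moves past the \<open>i\<close>-th
  generator of the second factor.\<close>

definition bilinear_shift :: "nat \<Rightarrow> nat \<Rightarrow> nat \<Rightarrow> (nat \<Rightarrow> nat \<Rightarrow> nat \<Rightarrow> int)
    \<Rightarrow> (nat \<Rightarrow> int) \<Rightarrow> (nat \<Rightarrow> int) \<Rightarrow> nat \<Rightarrow> int" where
  "bilinear_shift r s t e h m = (\<lambda>k\<in>{1..r}. \<Sum>j\<in>{1..t}. \<Sum>i\<in>{1..s}. h j * m i * e j i k)"

text \<open>A shear: it fixes the second coordinate and translates the central one. It is restricted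
  to the carrier because elements of \<open>AutoGroup\<close> are extensional functions.\<close>

definition heisenberg_action :: "nat \<Rightarrow> nat \<Rightarrow> nat \<Rightarrow> (nat \<Rightarrow> nat \<Rightarrow> nat \<Rightarrow> int)
    \<Rightarrow> (nat \<Rightarrow> int) \<Rightarrow> (nat \<Rightarrow> int) \<times> (nat \<Rightarrow> int) \<Rightarrow> (nat \<Rightarrow> int) \<times> (nat \<Rightarrow> int)" where
  "heisenberg_action r s t e h =
     (\<lambda>(z, m)\<in>carrier (int_power_group r \<times>\<times> int_power_group s).
        (z \<otimes>\<^bsub>int_power_group r\<^esub> bilinear_shift r s t e h m, m))"

abbreviation heisenberg_product where
  "heisenberg_product r s t e \<equiv> semidirect_product (int_power_group r \<times>\<times> int_power_group s)
     (int_power_group t) (heisenberg_action r s t e)"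

lemma bilinear_shift_closed [simp]: "bilinear_shift r s t e h m \<in> carrier (int_power_group r)"
  by (simp add: bilinear_shift_def)

lemma bilinear_shift_add_left:
  "bilinear_shift r s t e (h \<otimes>\<^bsub>int_power_group t\<^esub> h') m =
     bilinear_shift r s t e h m \<otimes>\<^bsub>int_power_group r\<^esub> bilinear_shift r s t e h' m"
  by (auto simp: bilinear_shift_def mult_int_power_group algebra_simps sum.distrib)

lemma bilinear_shift_add_right:
  "bilinear_shift r s t e h (m \<otimes>\<^bsub>int_power_group s\<^esub> m') =
     bilinear_shift r s t e h m \<otimes>\<^bsub>int_power_group r\<^esub> bilinear_shift r s t e h m'"
  by (auto simp: bilinear_shift_def mult_int_power_group algebra_simps sum.distrib)

lemma bilinear_shift_one_left [simp]:
  "bilinear_shift r s t e \<one>\<^bsub>int_power_group t\<^esub> m = \<one>\<^bsub>int_power_group r\<^esub>"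
  by (auto simp: bilinear_shift_def one_int_power_group)

lemma bilinear_shift_one_right [simp]:
  "bilinear_shift r s t e h \<one>\<^bsub>int_power_group s\<^esub> = \<one>\<^bsub>int_power_group r\<^esub>"
  by (auto simp: bilinear_shift_def one_int_power_group)

lemma bilinear_shift_units:
  assumes "j \<in> {1..t}" "i \<in> {1..s}"
  shows "bilinear_shift r s t e (int_unit t j) (int_unit s i) = restrict (e j i) {1..r}"
proof -
  have "(\<Sum>j'\<in>{1..t}. \<Sum>i'\<in>{1..s}. int_unit t j j' * int_unit s i i' * e j' i' k) =
      (\<Sum>j'\<in>{1..t}. if j' = j then \<Sum>i'\<in>{1..s}. if i' = i then e j i k else 0 else 0)" for k
    using assms by (intro sum.cong refl) (auto simp: int_unit_def mult_delta_left)
  then show ?thesis using assms by (auto simp: bilinear_shift_def)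
qed

lemma comm_int_power_group:
  "m \<otimes>\<^bsub>int_power_group r\<^esub> m' = m' \<otimes>\<^bsub>int_power_group r\<^esub> m"
  by (simp add: mult_int_power_group add.commute)

lemma heisenberg_action_apply:
  "z \<in> carrier (int_power_group r) \<Longrightarrow> m \<in> carrier (int_power_group s) \<Longrightarrow>
     heisenberg_action r s t e h (z, m) = (z \<otimes>\<^bsub>int_power_group r\<^esub> bilinear_shift r s t e h m, m)"
  by (simp add: heisenberg_action_def)

lemma group_int_power_groups [simp]: "group (int_power_group r \<times>\<times> int_power_group s)"
  by (simp add: DirProd_group)

text \<open>Shears compose by adding their translations, and these are linear in
  \<open>h\<close>.\<close>

lemma heisenberg_action_compose:
  "compose (carrier (int_power_group r \<times>\<times> int_power_group s))
     (heisenberg_action r s t e h) (heisenberg_action r s t e h') =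
   heisenberg_action r s t e (h \<otimes>\<^bsub>int_power_group t\<^esub> h')"
proof -
  interpret R: group "int_power_group r" by simp
  have "z \<otimes>\<^bsub>int_power_group r\<^esub> b \<otimes>\<^bsub>int_power_group r\<^esub> b' = z \<otimes>\<^bsub>int_power_group r\<^esub> (b'
      \<otimes>\<^bsub>int_power_group r\<^esub> b)" for z b b'
    by (auto simp: mult_int_power_group)
  then show ?thesis
    by (auto simp: fun_eq_iff compose_def heisenberg_action_def bilinear_shift_add_left)
qed

lemma heisenberg_action_one:
  "heisenberg_action r s t e \<one>\<^bsub>int_power_group t\<^esub> =
     (\<lambda>x\<in>carrier (int_power_group r \<times>\<times> int_power_group s). x)"
proof -
  interpret R: group "int_power_group r" by simp
  show ?thesis by (auto simp: heisenberg_action_def fun_eq_iff)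
qed

lemma heisenberg_action_closed:
  "heisenberg_action r s t e h \<in> hom (int_power_group r \<times>\<times> int_power_group s) (int_power_group r \<times>\<times>
      int_power_group s)"
proof -
  interpret R: group "int_power_group r" by simp
  interpret S: group "int_power_group s" by simp
  have "(z \<otimes>\<^bsub>int_power_group r\<^esub> z') \<otimes>\<^bsub>int_power_group r\<^esub> (b \<otimes>\<^bsub>int_power_group r\<^esub> b') =
      (z \<otimes>\<^bsub>int_power_group r\<^esub> b) \<otimes>\<^bsub>int_power_group r\<^esub> (z' \<otimes>\<^bsub>int_power_group r\<^esub> b')" for z z' b b'
    by (auto simp: mult_int_power_group)
  then show ?thesis
    by (intro homI) (auto simp: heisenberg_action_apply bilinear_shift_add_right)
qed

lemma heisenberg_action_hom:
  "heisenberg_action r s t e \<in> hom (int_power_group t) (AutoGroup (int_power_group r \<times>\<times> int_power_group s))"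
proof -
  let ?N = "int_power_group r \<times>\<times> int_power_group s" and ?H = "int_power_group t"
  let ?\<theta> = "heisenberg_action r s t e"
  interpret H: group ?H by simp
  \<comment> \<open>Opposite elements act by mutually inverse maps; this supplies the bijectivity
    demanded of an automorphism.\<close>
  have inv: "compose (carrier ?N) (?\<theta> h) (?\<theta> h') = (\<lambda>x\<in>carrier ?N. x)"
    if "h \<otimes>\<^bsub>?H\<^esub> h' = \<one>\<^bsub>?H\<^esub>" for h h'
    by (simp only: heisenberg_action_compose that heisenberg_action_one)
  have Bij: "?\<theta> h \<in> Bij (carrier ?N)" if h: "h \<in> carrier ?H" for h
  proof -
    have "?\<theta> h (?\<theta> (inv\<^bsub>?H\<^esub> h) x) = x" "?\<theta> (inv\<^bsub>?H\<^esub> h) (?\<theta> h x) = x" if "x \<in> carrier ?N" for x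
      using fun_cong[OF inv[of h "inv\<^bsub>?H\<^esub> h"], of x] fun_cong[OF inv[of "inv\<^bsub>?H\<^esub> h" h], of x] h that
      by (simp_all add: compose_def del: carrier_DirProd)
    moreover have "?\<theta> h x \<in> carrier ?N" if "x \<in> carrier ?N" for h x
      using heisenberg_action_closed that by (rule hom_in_carrier)
    ultimately have "bij_betw (?\<theta> h) (carrier ?N) (carrier ?N)"
      by (intro bij_betwI[where g = "?\<theta> (inv\<^bsub>?H\<^esub> h)"]) auto
    then show ?thesis by (simp add: Bij_def heisenberg_action_def)
  qed
  show ?thesis
  proof (rule homI)
    show "?\<theta> h \<in> carrier (AutoGroup ?N)" if "h \<in> carrier ?H" for h
      using Bij[OF that] heisenberg_action_closed by (simp add: AutoGroup_def auto_def)
    show "?\<theta> (h \<otimes>\<^bsub>?H\<^esub> h') = ?\<theta> h \<otimes>\<^bsub>AutoGroup ?N\<^esub> ?\<theta> h'" if "h \<in> carrier ?H" "h' \<in> carrier ?H" for h h'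
      using Bij[OF that(1)] Bij[OF that(2)]
      by (simp add: AutoGroup_def BijGroup_def heisenberg_action_compose del: carrier_DirProd)
  qed
qed

lemma carrier_heisenberg_product:
  "carrier (heisenberg_product r s t e) =
     (carrier (int_power_group r) \<times> carrier (int_power_group s)) \<times> carrier (int_power_group t)"
  by (simp add: semidirect_product_def)

lemma one_heisenberg_product:
  "\<one>\<^bsub>heisenberg_product r s t e\<^esub> =
     ((\<one>\<^bsub>int_power_group r\<^esub>, \<one>\<^bsub>int_power_group s\<^esub>), \<one>\<^bsub>int_power_group t\<^esub>)"
  by (simp add: semidirect_product_def)

lemma mult_heisenberg_product:
  assumes "z' \<in> carrier (int_power_group r)" "m' \<in> carrier (int_power_group s)"
  shows "((z, m), h) \<otimes>\<^bsub>heisenberg_product r s t e\<^esub> ((z', m'), h') =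
     ((z \<otimes>\<^bsub>int_power_group r\<^esub> z' \<otimes>\<^bsub>int_power_group r\<^esub> bilinear_shift r s t e h m',
       m \<otimes>\<^bsub>int_power_group s\<^esub> m'), h \<otimes>\<^bsub>int_power_group t\<^esub> h')"
  using assms by (auto simp: semidirect_product_def heisenberg_action_apply mult_int_power_group)

lemma group_heisenberg_product: "group (heisenberg_product r s t e)"
proof -
  interpret R: group "int_power_group r" by simp
  interpret S: group "int_power_group s" by simp
  interpret T: group "int_power_group t" by simp
  have inv: "\<exists>y\<in>carrier (heisenberg_product r s t e). y \<otimes>\<^bsub>heisenberg_product r s t e\<^esub> x =
      \<one>\<^bsub>heisenberg_product r s t e\<^esub>"
    if x: "x \<in> carrier (heisenberg_product r s t e)" for x
  proof -
    obtain z m h where zmh: "x = ((z, m), h)" "z \<in> carrier (int_power_group r)"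
      "m \<in> carrier (int_power_group s)" "h \<in> carrier (int_power_group t)"
      using x by (auto simp: carrier_heisenberg_product)
    let ?h = "inv\<^bsub>int_power_group t\<^esub> h"
    \<comment> \<open>The inverse in the central coordinate must also cancel the shift produced when
      \<open>?h\<close> moves past \<open>m\<close>.\<close>
    let ?z = "inv\<^bsub>int_power_group r\<^esub> (z \<otimes>\<^bsub>int_power_group r\<^esub> bilinear_shift r s t e ?h m)"
    have "((?z, inv\<^bsub>int_power_group s\<^esub> m), ?h) \<otimes>\<^bsub>heisenberg_product r s t e\<^esub> x = \<one>\<^bsub>heisenberg_product r s t e\<^esub>"
      unfolding zmh(1) mult_heisenberg_product[OF zmh(2,3)] one_heisenberg_product
      using zmh by (simp add: R.m_assoc)
    then show ?thesis using zmh by (force simp: carrier_heisenberg_product)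
  qed
  \<comment> \<open>Associativity in the central coordinate: both bracketings collect the same three
    cross terms, \<open>b\<close> from h and m', \<open>c\<close> from h and m'', \<open>d\<close>
    from h' and m''.\<close>
  have assoc: "(z \<otimes>\<^bsub>int_power_group r\<^esub> z' \<otimes>\<^bsub>int_power_group r\<^esub> b) \<otimes>\<^bsub>int_power_group r\<^esub> z''
      \<otimes>\<^bsub>int_power_group r\<^esub> (c \<otimes>\<^bsub>int_power_group r\<^esub> d)
     = z \<otimes>\<^bsub>int_power_group r\<^esub> (z' \<otimes>\<^bsub>int_power_group r\<^esub> z'' \<otimes>\<^bsub>int_power_group r\<^esub> d) \<otimes>\<^bsub>int_power_group
         r\<^esub> (b \<otimes>\<^bsub>int_power_group r\<^esub> c)"
    for z z' z'' b c d
    by (auto simp: mult_int_power_group)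
  show ?thesis
  proof (rule groupI, goal_cases)
    case (1 x y)
    then show ?case by (auto simp: carrier_heisenberg_product mult_heisenberg_product)
  next
    case (3 x y u)
    then show ?case
      by (auto simp: carrier_heisenberg_product mult_heisenberg_product bilinear_shift_add_left
          bilinear_shift_add_right S.m_assoc T.m_assoc assoc)
  next
    case (4 x)
    then show ?case
      by (auto simp: carrier_heisenberg_product one_heisenberg_product mult_heisenberg_product)
  qed (use inv in \<open>auto simp: carrier_heisenberg_product one_heisenberg_product\<close>)
qed

text \<open>Only relations are assumed, neither generation nor independence. The Heisenberg product
  itself is an instance, and so is the braid quotient before anything is known about its
  size.\<close>

locale heisenberg_generators = group G for G (structure) +
  fixes r s t :: nat and e :: "nat \<Rightarrow> nat \<Rightarrow> nat \<Rightarrow> int" and c x y :: "nat \<Rightarrow> 'a"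
  assumes c_closed: "c \<in> {1..r} \<rightarrow> carrier G"
    and x_closed: "x \<in> {1..s} \<rightarrow> carrier G"
    and y_closed: "y \<in> {1..t} \<rightarrow> carrier G"
    and c_central: "k \<in> {1..r} \<Longrightarrow> u \<in> carrier G \<Longrightarrow> c k \<otimes> u = u \<otimes> c k"
    and x_comm: "i \<in> {1..s} \<Longrightarrow> i' \<in> {1..s} \<Longrightarrow> x i \<otimes> x i' = x i' \<otimes> x i"
    and y_comm: "j \<in> {1..t} \<Longrightarrow> j' \<in> {1..t} \<Longrightarrow> y j \<otimes> y j' = y j' \<otimes> y j"
    and y_x: "j \<in> {1..t} \<Longrightarrow> i \<in> {1..s} \<Longrightarrow>
      y j \<otimes> x i = power_prod G r c (e j i) \<otimes> (x i \<otimes> y j)"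
begin

abbreviation \<gamma> where "\<gamma> \<equiv> power_prod G r c"

text \<open>\<open>d\<close> is a choice of exponents for the commutator [u, v] in the central
  generators. The rules below express that commutators with central values are multiplicative in an
  argument and change sign when the arguments are exchanged.\<close>

definition twist :: "(nat \<Rightarrow> int) \<Rightarrow> 'a \<Rightarrow> 'a \<Rightarrow> bool" where
  "twist d u v \<longleftrightarrow> u \<otimes> v = \<gamma> d \<otimes> (v \<otimes> u)"

lemma \<gamma>_closed [simp]: "\<gamma> d \<in> carrier G"
  using c_closed by simp

lemma \<gamma>_central: "u \<in> carrier G \<Longrightarrow> \<gamma> d \<otimes> u = u \<otimes> \<gamma> d"
  by (rule commute_power_prod[OF c_closed]) (rule c_central | assumption)+

lemma c_comm: "k \<in> {1..r} \<Longrightarrow> k' \<in> {1..r} \<Longrightarrow> c k \<otimes> c k' = c k' \<otimes> c k"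
  by (rule c_central) (use c_closed in blast)+

lemma \<gamma>_add: "\<gamma> (\<lambda>k. d k + d' k) = \<gamma> d \<otimes> \<gamma> d'"
  by (rule power_prod_add[OF c_closed c_comm])

lemma \<gamma>_neg: "\<gamma> d \<otimes> \<gamma> (\<lambda>k. - d k) = \<one>"
  using \<gamma>_add[of d "\<lambda>k. - d k"] power_prod_zero[OF c_closed] by simp

lemma twist_mult:
  assumes "twist d u v" "twist d' u' v" and [simp]: "u \<in> carrier G" "u' \<in> carrier G" "v \<in> carrier G"
  shows "twist (\<lambda>k. d k + d' k) (u \<otimes> u') v"
proof -
  have "u \<otimes> u' \<otimes> v = u \<otimes> (\<gamma> d' \<otimes> (v \<otimes> u'))"
    using assms by (simp add: twist_def m_assoc)
  also have "\<dots> = \<gamma> d' \<otimes> (u \<otimes> v) \<otimes> u'"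
    using \<gamma>_central[of u d'] by (simp flip: m_assoc)
  also have "\<dots> = \<gamma> d' \<otimes> (\<gamma> d \<otimes> (v \<otimes> u)) \<otimes> u'"
    using assms by (simp add: twist_def)
  also have "\<dots> = \<gamma> d \<otimes> \<gamma> d' \<otimes> (v \<otimes> (u \<otimes> u'))"
    using \<gamma>_central[of "\<gamma> d" d'] by (simp flip: m_assoc)
  finally show ?thesis by (simp add: twist_def \<gamma>_add)
qed

lemma twist_commute:
  assumes "twist d u v" and [simp]: "u \<in> carrier G" "v \<in> carrier G"
  shows "twist (\<lambda>k. - d k) v u"
proof -
  have "\<gamma> (\<lambda>k. - d k) \<otimes> (u \<otimes> v) = (\<gamma> (\<lambda>k. - d k) \<otimes> \<gamma> d) \<otimes> (v \<otimes> u)"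
    using assms by (simp add: twist_def m_assoc)
  also have "\<gamma> (\<lambda>k. - d k) \<otimes> \<gamma> d = \<one>"
    using \<gamma>_neg[of d] \<gamma>_central[of "\<gamma> d" "\<lambda>k. - d k"] by simp
  finally show ?thesis by (simp add: twist_def)
qed

lemma twist_one: "v \<in> carrier G \<Longrightarrow> twist (\<lambda>k. 0) \<one> v"
  by (simp add: twist_def power_prod_zero[OF c_closed])

lemma twist_inv:
  assumes "twist d u v" and [simp]: "u \<in> carrier G" "v \<in> carrier G"
  shows "twist (\<lambda>k. - d k) (inv u) v"
proof -
  have "inv u \<otimes> v = inv u \<otimes> (v \<otimes> u) \<otimes> inv u"
    by (simp add: m_assoc)
  also have "\<dots> = inv u \<otimes> (\<gamma> (\<lambda>k. - d k) \<otimes> (u \<otimes> v)) \<otimes> inv u"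
    using twist_commute[OF assms] by (simp add: twist_def)
  also have "\<dots> = (inv u \<otimes> \<gamma> (\<lambda>k. - d k)) \<otimes> u \<otimes> v \<otimes> inv u"
    by (simp add: m_assoc)
  also have "\<dots> = (\<gamma> (\<lambda>k. - d k) \<otimes> inv u) \<otimes> u \<otimes> v \<otimes> inv u"
    using \<gamma>_central[of "inv u" "\<lambda>k. - d k"] by simp
  also have "\<dots> = \<gamma> (\<lambda>k. - d k) \<otimes> (inv u \<otimes> u) \<otimes> v \<otimes> inv u"
    by (simp add: m_assoc del: l_inv)
  finally show ?thesis by (simp add: twist_def m_assoc)
qed

lemma twist_nat_pow:
  assumes "twist d u v" and [simp]: "u \<in> carrier G" "v \<in> carrier G"
  shows "twist (\<lambda>k. int n * d k) (u [^] n) v"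
proof (induction n)
  case (Suc n)
  from twist_mult[OF this assms(1)] show ?case by (simp add: algebra_simps)
qed (simp add: twist_one)

lemma twist_int_pow:
  assumes "twist d u v" and [simp]: "u \<in> carrier G" "v \<in> carrier G"
  shows "twist (\<lambda>k. n * d k) (u [^] (n::int)) v"
proof (cases n rule: int_cases2)
  case (nonneg m)
  then show ?thesis using twist_nat_pow[OF assms] by (simp add: int_pow_int)
next
  case (nonpos m)
  then show ?thesis using twist_inv[OF twist_nat_pow[OF assms]] by (simp add: int_pow_neg int_pow_int)
qed

lemma twist_power_prod:
  assumes "u \<in> {1..q} \<rightarrow> carrier G" "v \<in> carrier G" "\<And>j. j \<in> {1..q} \<Longrightarrow> twist (d j) (u j) v"
  shows "twist (\<lambda>k. \<Sum>j\<in>{1..q}. h j * d j k) (power_prod G q u h) v"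
  using assms
proof (induction q)
  case (Suc q)
  have u: "u \<in> {1..q} \<rightarrow> carrier G" "u (Suc q) \<in> carrier G"
    using Suc.prems(1) by (simp_all only: Pi_Suc_atLeastAtMost)
  have "twist (\<lambda>k. \<Sum>j\<in>{1..q}. h j * d j k) (power_prod G q u h) v"
    using Suc u by simp
  moreover have "twist (\<lambda>k. h (Suc q) * d (Suc q) k) (u (Suc q) [^] h (Suc q)) v"
    using Suc.prems u by (intro twist_int_pow) simp_all
  ultimately show ?case
    using twist_mult u Suc.prems(2) by (simp add: power_prod_Suc[OF Suc.prems(1)])
qed (simp add: twist_one)

definition normal_form :: "((nat \<Rightarrow> int) \<times> (nat \<Rightarrow> int)) \<times> (nat \<Rightarrow> int) \<Rightarrow> 'a" where
  "normal_form = (\<lambda>((z, m), h). \<gamma> z \<otimes> power_prod G s x m \<otimes> power_prod G t y h)"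

lemma y_x_power_prod:
  "power_prod G t y h \<otimes> power_prod G s x m =
     \<gamma> (bilinear_shift r s t e h m) \<otimes> (power_prod G s x m \<otimes> power_prod G t y h)"
proof -
  have y: "y j \<in> carrier G" if "j \<in> {1..t}" for j using y_closed that by blast
  have x: "x i \<in> carrier G" if "i \<in> {1..s}" for i using x_closed that by blast
  \<comment> \<open>Expansion into a power product is available in the left argument only. The pair
    is therefore exchanged at the cost of a sign, expanded over the \<open>x i\<close>, exchanged
    back, and finally expanded over the \<open>y j\<close>.\<close>
  have "twist (\<lambda>k. \<Sum>i\<in>{1..s}. m i * - e j i k) (power_prod G s x m) (y j)" if "j \<in> {1..t}" for j
    using y_x[OF that] x y[OF that]
    by (intro twist_power_prod x_closed twist_commute) (simp_all add: twist_def)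
  then have "twist (\<lambda>k. \<Sum>i\<in>{1..s}. m i * e j i k) (y j) (power_prod G s x m)" if "j \<in> {1..t}" for j
    using twist_commute[OF _ power_prod_closed[OF x_closed] y[OF that]] that
    by (fastforce simp: sum_negf)
  then have "twist (\<lambda>k. \<Sum>j\<in>{1..t}. h j * (\<Sum>i\<in>{1..s}. m i * e j i k)) (power_prod G t y h) (power_prod G s x m)"
    using x_closed by (intro twist_power_prod y_closed) simp_all
  moreover have "\<gamma> (\<lambda>k. \<Sum>j\<in>{1..t}. h j * (\<Sum>i\<in>{1..s}. m i * e j i k)) = \<gamma> (bilinear_shift r s t e h m)"
    by (rule power_prod_cong) (simp add: bilinear_shift_def sum_distrib_left mult.assoc)
  ultimately show ?thesis by (simp add: twist_def)
qed

text \<open>When two normal words are collected into one, central factors move freely, and the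
  single nontrivial exchange, of the \<open>y\<close>-part on the left with the
  \<open>x\<close>-part on the right, contributes exactly the bilinear term of the product
  law.\<close>

lemma normal_form_hom: "normal_form \<in> hom (heisenberg_product r s t e) G"
proof (rule homI)
  fix u v
  assume "u \<in> carrier (heisenberg_product r s t e)" "v \<in> carrier (heisenberg_product r s t e)"
  then obtain z m h z' m' h' where uv: "u = ((z, m), h)" "v = ((z', m'), h')"
    and [simp]: "z \<in> carrier (int_power_group r)" "m \<in> carrier (int_power_group s)"
    "h \<in> carrier (int_power_group t)" "z' \<in> carrier (int_power_group r)"
    "m' \<in> carrier (int_power_group s)" "h' \<in> carrier (int_power_group t)"
    by (auto simp: carrier_heisenberg_product)
  interpret R: group "int_power_group r" by simp
  let ?X = "power_prod G s x" and ?Y = "power_prod G t y"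
  let ?b = "bilinear_shift r s t e h m'"
  have "\<gamma> \<in> hom (int_power_group r) G" "?X \<in> hom (int_power_group s) G" "?Y \<in> hom (int_power_group t) G"
    by (rule power_prod_hom[OF c_closed c_comm] power_prod_hom[OF x_closed x_comm]
        power_prod_hom[OF y_closed y_comm]; assumption)+
  note hom = this[THEN hom_mult]
  have [simp]: "?X m \<in> carrier G" "?Y h \<in> carrier G" for m h using x_closed y_closed by simp_all
  have "normal_form u \<otimes> normal_form v = \<gamma> z \<otimes> (?X m \<otimes> (?Y h \<otimes> \<gamma> z') \<otimes> ?X m' \<otimes> ?Y h')"
    by (simp add: uv normal_form_def m_assoc)
  also have "\<dots> = \<gamma> z \<otimes> (?X m \<otimes> (\<gamma> z' \<otimes> ?Y h) \<otimes> ?X m' \<otimes> ?Y h')"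
    using \<gamma>_central[of "?Y h" z'] by simp
  also have "\<dots> = \<gamma> z \<otimes> ((?X m \<otimes> \<gamma> z') \<otimes> (?Y h \<otimes> ?X m') \<otimes> ?Y h')"
    by (simp add: m_assoc)
  also have "\<dots> = \<gamma> z \<otimes> ((\<gamma> z' \<otimes> ?X m) \<otimes> (\<gamma> ?b \<otimes> (?X m' \<otimes> ?Y h)) \<otimes> ?Y h')"
    using \<gamma>_central[of "?X m" z'] by (simp add: y_x_power_prod)
  also have "\<dots> = \<gamma> z \<otimes> \<gamma> z' \<otimes> (?X m \<otimes> \<gamma> ?b) \<otimes> ?X m' \<otimes> ?Y h \<otimes> ?Y h'"
    by (simp add: m_assoc)
  also have "\<dots> = \<gamma> z \<otimes> \<gamma> z' \<otimes> (\<gamma> ?b \<otimes> ?X m) \<otimes> ?X m' \<otimes> ?Y h \<otimes> ?Y h'"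
    using \<gamma>_central[of "?X m" ?b] by simp
  also have "\<dots> = normal_form (u \<otimes>\<^bsub>heisenberg_product r s t e\<^esub> v)"
    by (simp add: uv mult_heisenberg_product normal_form_def hom m_assoc)
  finally show "normal_form (u \<otimes>\<^bsub>heisenberg_product r s t e\<^esub> v) = normal_form u \<otimes> normal_form v" by simp
qed (use x_closed y_closed in \<open>auto simp: normal_form_def\<close>)

end

section \<open>The three coordinate subgroups of the Heisenberg product and its nilpotency\<close>

definition heisenberg_c :: "nat \<Rightarrow> nat \<Rightarrow> nat \<Rightarrow> (nat \<Rightarrow> int) \<Rightarrow> ((nat \<Rightarrow> int) \<times> (nat \<Rightarrow> int)) \<times> (nat \<Rightarrow> int)" where
  "heisenberg_c r s t z = ((z, \<one>\<^bsub>int_power_group s\<^esub>), \<one>\<^bsub>int_power_group t\<^esub>)"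

definition heisenberg_x :: "nat \<Rightarrow> nat \<Rightarrow> nat \<Rightarrow> (nat \<Rightarrow> int) \<Rightarrow> ((nat \<Rightarrow> int) \<times> (nat \<Rightarrow> int)) \<times> (nat \<Rightarrow> int)" where
  "heisenberg_x r s t m = ((\<one>\<^bsub>int_power_group r\<^esub>, m), \<one>\<^bsub>int_power_group t\<^esub>)"

definition heisenberg_y :: "nat \<Rightarrow> nat \<Rightarrow> nat \<Rightarrow> (nat \<Rightarrow> int) \<Rightarrow> ((nat \<Rightarrow> int) \<times> (nat \<Rightarrow> int)) \<times> (nat \<Rightarrow> int)" where
  "heisenberg_y r s t h = ((\<one>\<^bsub>int_power_group r\<^esub>, \<one>\<^bsub>int_power_group s\<^esub>), h)"

context
  fixes r s t :: nat and e :: "nat \<Rightarrow> nat \<Rightarrow> nat \<Rightarrow> int"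
begin

interpretation R: group "int_power_group r" by simp
interpretation S: group "int_power_group s" by simp
interpretation T: group "int_power_group t" by simp
interpretation W: group "heisenberg_product r s t e" by (rule group_heisenberg_product)

lemma heisenberg_c_hom: "heisenberg_c r s t \<in> hom (int_power_group r) (heisenberg_product r s t e)"
  by (rule homI) (simp_all add: heisenberg_c_def carrier_heisenberg_product mult_heisenberg_product)

lemma heisenberg_x_hom: "heisenberg_x r s t \<in> hom (int_power_group s) (heisenberg_product r s t e)"
  by (rule homI) (simp_all add: heisenberg_x_def carrier_heisenberg_product mult_heisenberg_product)

lemma heisenberg_y_hom: "heisenberg_y r s t \<in> hom (int_power_group t) (heisenberg_product r s t e)"
  by (rule homI) (simp_all add: heisenberg_y_def carrier_heisenberg_product mult_heisenberg_product)

lemma heisenberg_c_central: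
  assumes "z \<in> carrier (int_power_group r)" "w \<in> carrier (heisenberg_product r s t e)"
  shows "heisenberg_c r s t z \<otimes>\<^bsub>heisenberg_product r s t e\<^esub> w = w \<otimes>\<^bsub>heisenberg_product r s t e\<^esub>
      heisenberg_c r s t z"
  using assms
  by (auto simp: heisenberg_c_def carrier_heisenberg_product mult_heisenberg_product comm_int_power_group)

lemma power_prod_heisenberg:
  "z \<in> carrier (int_power_group r) \<Longrightarrow>
     power_prod (heisenberg_product r s t e) r (\<lambda>k. heisenberg_c r s t (int_unit r k)) z = heisenberg_c r s t z"
  "m \<in> carrier (int_power_group s) \<Longrightarrow>
     power_prod (heisenberg_product r s t e) s (\<lambda>i. heisenberg_x r s t (int_unit s i)) m = heisenberg_x r s t m"
  "h \<in> carrier (int_power_group t) \<Longrightarrow>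
     power_prod (heisenberg_product r s t e) t (\<lambda>j. heisenberg_y r s t (int_unit t j)) h = heisenberg_y r s t h"
  using hom_power_prod[OF R.is_group W.is_group heisenberg_c_hom, of "int_unit r" r z]
    hom_power_prod[OF S.is_group W.is_group heisenberg_x_hom, of "int_unit s" s m]
    hom_power_prod[OF T.is_group W.is_group heisenberg_y_hom, of "int_unit t" t h]
  by (simp_all add: power_prod_int_units)

lemma heisenberg_product_generators:
  "heisenberg_generators (heisenberg_product r s t e) r s t e (\<lambda>k. heisenberg_c r s t (int_unit r k))
     (\<lambda>i. heisenberg_x r s t (int_unit s i)) (\<lambda>j. heisenberg_y r s t (int_unit t j))"
proof (unfold_locales, goal_cases)
  case 1 show ?case using hom_in_carrier[OF heisenberg_c_hom] by simp
next
  case 2 show ?case using hom_in_carrier[OF heisenberg_x_hom] by simp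
next
  case 3 show ?case using hom_in_carrier[OF heisenberg_y_hom] by simp
next
  case (4 k u) then show ?case by (simp add: heisenberg_c_central)
next
  case (5 i i')
  then show ?case by (simp add: comm_int_power_group flip: hom_mult[OF heisenberg_x_hom])
next
  case (6 i i')
  then show ?case by (simp add: comm_int_power_group flip: hom_mult[OF heisenberg_y_hom])
next
  case (7 j i)
  let ?c = "\<lambda>k. heisenberg_c r s t (int_unit r k)"
  \<comment> \<open>\<open>e j i\<close> is a function on all naturals; its restriction gives the
    same product and is an element of Z^r.\<close>
  have "power_prod (heisenberg_product r s t e) r ?c (e j i) =
      power_prod (heisenberg_product r s t e) r ?c (restrict (e j i) {1..r})"
    by (rule W.power_prod_cong) simp
  also have "\<dots> = heisenberg_c r s t (restrict (e j i) {1..r})"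
    by (rule power_prod_heisenberg) simp
  finally show ?case
    using 7 by (simp add: heisenberg_c_def heisenberg_x_def heisenberg_y_def mult_heisenberg_product
        bilinear_shift_units)
qed

lemma heisenberg_normal_form:
  assumes "z \<in> carrier (int_power_group r)" "m \<in> carrier (int_power_group s)" "h \<in> carrier (int_power_group t)"
  shows "heisenberg_c r s t z \<otimes>\<^bsub>heisenberg_product r s t e\<^esub> heisenberg_x r s t m
    \<otimes>\<^bsub>heisenberg_product r s t e\<^esub> heisenberg_y r s t h = ((z, m), h)"
  using assms by (simp add: heisenberg_c_def heisenberg_x_def heisenberg_y_def mult_heisenberg_product)

text \<open>Forgetting the central coordinate is a homomorphism to an abelian group, so commutators
  lie in its kernel, which is the central factor.\<close>

lemma heisenberg_product_class2:
  assumes w: "w \<in> carrier (heisenberg_product r s t e)" "w' \<in> carrier (heisenberg_product r s t e)"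
    and u: "u \<in> carrier (heisenberg_product r s t e)"
  defines "k \<equiv> w \<otimes>\<^bsub>heisenberg_product r s t e\<^esub> w' \<otimes>\<^bsub>heisenberg_product r s t e\<^esub>
      inv\<^bsub>heisenberg_product r s t e\<^esub> w \<otimes>\<^bsub>heisenberg_product r s t e\<^esub> inv\<^bsub>heisenberg_product r s t e\<^esub> w'"
  shows "k \<otimes>\<^bsub>heisenberg_product r s t e\<^esub> u = u \<otimes>\<^bsub>heisenberg_product r s t e\<^esub> k"
proof -
  let ?A = "int_power_group s \<times>\<times> int_power_group t"
  define p :: "((nat \<Rightarrow> int) \<times> (nat \<Rightarrow> int)) \<times> (nat \<Rightarrow> int) \<Rightarrow> (nat \<Rightarrow> int) \<times> (nat \<Rightarrow> int)"
    where "p = (\<lambda>((z, m), h). (m, h))"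
  interpret A: group ?A by simp
  have "p \<in> hom (heisenberg_product r s t e) ?A"
    by (rule homI) (auto simp: p_def carrier_heisenberg_product mult_heisenberg_product)
  then interpret p: group_hom "heisenberg_product r s t e" ?A p
    by (simp add: group_hom_def group_hom_axioms_def W.is_group A.is_group)
  have "a \<otimes>\<^bsub>?A\<^esub> b = b \<otimes>\<^bsub>?A\<^esub> a" for a b
    by (simp add: mult_DirProd' comm_int_power_group)
  moreover have "b \<otimes>\<^bsub>?A\<^esub> a \<otimes>\<^bsub>?A\<^esub> inv\<^bsub>?A\<^esub> a = b" if "a \<in> carrier ?A" "b \<in> carrier ?A" for a b
    using that by (subst A.m_assoc) (simp_all del: carrier_DirProd inv_DirProd mult_DirProd one_DirProd)
  ultimately have "a \<otimes>\<^bsub>?A\<^esub> b \<otimes>\<^bsub>?A\<^esub> inv\<^bsub>?A\<^esub> a \<otimes>\<^bsub>?A\<^esub> inv\<^bsub>?A\<^esub> b = \<one>\<^bsub>?A\<^esub>"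
    if "a \<in> carrier ?A" "b \<in> carrier ?A" for a b
    using that A.r_inv by metis
  then have "p k = \<one>\<^bsub>?A\<^esub>"
    using w by (simp add: k_def del: carrier_DirProd inv_DirProd mult_DirProd one_DirProd)
  moreover have "k \<in> carrier (heisenberg_product r s t e)" using w by (simp add: k_def)
  ultimately obtain z where "z \<in> carrier (int_power_group r)" "k = heisenberg_c r s t z"
    by (auto simp: p_def carrier_heisenberg_product heisenberg_c_def)
  then show ?thesis using heisenberg_c_central u by simp
qed

end

context heisenberg_generators
begin

lemma normal_form_heisenberg:
  assumes "z \<in> carrier (int_power_group r)" "m \<in> carrier (int_power_group s)" "h \<in> carrier (int_power_group t)"
  shows "normal_form (heisenberg_c r s t z) = \<gamma> z"
    and "normal_form (heisenberg_x r s t m) = power_prod G s x m"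
    and "normal_form (heisenberg_y r s t h) = power_prod G t y h"
proof -
  have "power_prod G q u \<one>\<^bsub>int_power_group q\<^esub> = \<one>" if "u \<in> {1..q} \<rightarrow> carrier G" for q u
    using power_prod_cong[of q "\<one>\<^bsub>int_power_group q\<^esub>" "\<lambda>_. 0" u] power_prod_zero[OF that]
    by (simp add: one_int_power_group)
  then show "normal_form (heisenberg_c r s t z) = \<gamma> z"
    "normal_form (heisenberg_x r s t m) = power_prod G s x m"
    "normal_form (heisenberg_y r s t h) = power_prod G t y h"
    using c_closed x_closed y_closed
    by (simp_all add: normal_form_def heisenberg_c_def heisenberg_x_def heisenberg_y_def)
qed

lemma normal_form_generators:
  "k \<in> {1..r} \<Longrightarrow> normal_form (heisenberg_c r s t (int_unit r k)) = c k"
  "i \<in> {1..s} \<Longrightarrow> normal_form (heisenberg_x r s t (int_unit s i)) = x i"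
  "j \<in> {1..t} \<Longrightarrow> normal_form (heisenberg_y r s t (int_unit t j)) = y j"
  using c_closed x_closed y_closed
  by (simp_all add: normal_form_heisenberg[OF int_unit_closed int_unit_closed int_unit_closed]
      power_prod_int_unit)

end

text \<open>Injectivity cannot be read off inside \<open>G\<close>, where the uniqueness of
  exponents is the very question. A homomorphism \<open>\<psi>\<close> back to the model with the
  right values on generators is a left inverse of \<open>normal_form\<close>, which gives
  injectivity; generation gives surjectivity.\<close>

lemma (in heisenberg_generators) normal_form_iso:
  assumes gen: "carrier G = generate G (c ` {1..r} \<union> x ` {1..s} \<union> y ` {1..t})"
    and \<psi>: "\<psi> \<in> hom G (heisenberg_product r s t e)"
    and \<psi>_c: "\<And>k. k \<in> {1..r} \<Longrightarrow> \<psi> (c k) = heisenberg_c r s t (int_unit r k)"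
    and \<psi>_x: "\<And>i. i \<in> {1..s} \<Longrightarrow> \<psi> (x i) = heisenberg_x r s t (int_unit s i)"
    and \<psi>_y: "\<And>j. j \<in> {1..t} \<Longrightarrow> \<psi> (y j) = heisenberg_y r s t (int_unit t j)"
  shows "normal_form \<in> iso (heisenberg_product r s t e) G"
proof -
  let ?W = "heisenberg_product r s t e"
  interpret W: group ?W by (rule group_heisenberg_product)
  interpret nf: group_hom ?W G normal_form
    using normal_form_hom W.is_group is_group by (simp add: group_hom_def group_hom_axioms_def)
  interpret \<psi>: group_hom G ?W \<psi>
    using \<psi> W.is_group is_group by (simp add: group_hom_def group_hom_axioms_def)
  have 1: "\<psi> (normal_form w) = w" if w: "w \<in> carrier ?W" for w
  proof -
    obtain z m h where zmh: "w = ((z, m), h)" "z \<in> carrier (int_power_group r)"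
      "m \<in> carrier (int_power_group s)" "h \<in> carrier (int_power_group t)"
      using w by (auto simp: carrier_heisenberg_product)
    have "\<psi> (normal_form w) = \<psi> (\<gamma> z) \<otimes>\<^bsub>?W\<^esub> \<psi> (power_prod G s x m) \<otimes>\<^bsub>?W\<^esub> \<psi> (power_prod G t y h)"
      using x_closed y_closed by (simp add: zmh normal_form_def)
    also have "\<psi> (\<gamma> z) = heisenberg_c r s t z"
    proof -
      have "\<psi> (\<gamma> z) = power_prod ?W r (\<lambda>k. \<psi> (c k)) z"
        by (rule hom_power_prod[OF is_group W.is_group \<psi> c_closed])
      also have "\<dots> = power_prod ?W r (\<lambda>k. heisenberg_c r s t (int_unit r k)) z"
        unfolding power_prod_def by (rule W.ordered_prod_cong) (simp add: \<psi>_c)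
      finally show ?thesis using power_prod_heisenberg(1)[OF zmh(2)] by simp
    qed
    also have "\<psi> (power_prod G s x m) = heisenberg_x r s t m"
    proof -
      have "\<psi> (power_prod G s x m) = power_prod ?W s (\<lambda>i. \<psi> (x i)) m"
        by (rule hom_power_prod[OF is_group W.is_group \<psi> x_closed])
      also have "\<dots> = power_prod ?W s (\<lambda>i. heisenberg_x r s t (int_unit s i)) m"
        unfolding power_prod_def by (rule W.ordered_prod_cong) (simp add: \<psi>_x)
      finally show ?thesis using power_prod_heisenberg(2)[OF zmh(3)] by simp
    qed
    also have "\<psi> (power_prod G t y h) = heisenberg_y r s t h"
    proof -
      have "\<psi> (power_prod G t y h) = power_prod ?W t (\<lambda>j. \<psi> (y j)) h"
        by (rule hom_power_prod[OF is_group W.is_group \<psi> y_closed])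
      also have "\<dots> = power_prod ?W t (\<lambda>j. heisenberg_y r s t (int_unit t j)) h"
        unfolding power_prod_def by (rule W.ordered_prod_cong) (simp add: \<psi>_y)
      finally show ?thesis using power_prod_heisenberg(3)[OF zmh(4)] by simp
    qed
    finally show ?thesis using heisenberg_normal_form zmh by simp
  qed
  have "generate G (c ` {1..r} \<union> x ` {1..s} \<union> y ` {1..t}) \<subseteq> normal_form ` carrier ?W"
  proof (rule generate_subgroup_incl[OF _ nf.img_is_subgroup])
    have "c k \<in> normal_form ` carrier ?W" if "k \<in> {1..r}" for k
      using imageI[OF hom_in_carrier[OF heisenberg_c_hom int_unit_closed[of r k]], of normal_form s t e]
        normal_form_generators(1)[OF that] by simp
    moreover have "x i \<in> normal_form ` carrier ?W" if "i \<in> {1..s}" for i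
      using imageI[OF hom_in_carrier[OF heisenberg_x_hom int_unit_closed[of s i]], of normal_form r t e]
        normal_form_generators(2)[OF that] by simp
    moreover have "y j \<in> normal_form ` carrier ?W" if "j \<in> {1..t}" for j
      using imageI[OF hom_in_carrier[OF heisenberg_y_hom int_unit_closed[of t j]], of normal_form r s e]
        normal_form_generators(3)[OF that] by simp
    ultimately show "c ` {1..r} \<union> x ` {1..s} \<union> y ` {1..t} \<subseteq> normal_form ` carrier ?W" by blast
  qed
  then have "normal_form ` carrier ?W = carrier G" using gen by auto
  moreover have "inj_on normal_form (carrier ?W)" using 1 by (rule inj_on_inverseI)
  ultimately show ?thesis using normal_form_hom by (simp add: iso_def bij_betw_def)
qed

section \<open>The centre of the Heisenberg product\<close>

lemma bilinear_shift_int_unit_right: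
  assumes "i \<in> {1..s}" "k \<in> {1..r}"
  shows "bilinear_shift r s t e h (int_unit s i) k = (\<Sum>j\<in>{1..t}. h j * e j i k)"
proof -
  have "(\<Sum>i'\<in>{1..s}. h j * int_unit s i i' * e j i' k) = (\<Sum>i'\<in>{1..s}. if i' = i then h j * e j i k
      else 0)" for j
    using assms by (intro sum.cong refl) (auto simp: int_unit_def)
  then show ?thesis using assms by (simp add: bilinear_shift_def)
qed

lemma bilinear_shift_int_unit_left:
  assumes "j \<in> {1..t}" "k \<in> {1..r}"
  shows "bilinear_shift r s t e (int_unit t j) m k = (\<Sum>i\<in>{1..s}. m i * e j i k)"
proof -
  have "(\<Sum>j'\<in>{1..t}. \<Sum>i\<in>{1..s}. int_unit t j j' * m i * e j' i k) =
      (\<Sum>j'\<in>{1..t}. if j' = j then \<Sum>i\<in>{1..s}. m i * e j i k else 0)"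
    using assms by (intro sum.cong refl) (auto simp: int_unit_def)
  then show ?thesis using assms by (simp add: bilinear_shift_def)
qed

text \<open>Commuting with the \<open>i\<close>-th \<open>x\<close> and the \<open>i\<close>-th
  \<open>y\<close> makes the shift of \<open>h\<close> against the \<open>i\<close>-th unit vector,
  and of that vector against \<open>m\<close>, vanish. The hypothesis is a concrete form of
  nondegeneracy: some central coordinate \<open>k\<close> sees, in row and column \<open>i\<close>,
  only the diagonal entry, so the two equations reduce to h_i e_iik = 0 and m_i e_iik = 0.\<close>

lemma group_centre_heisenberg_product:
  assumes e: "\<And>i. i \<in> {1..s} \<Longrightarrow> \<exists>k\<in>{1..r}. e i i k \<noteq> 0 \<and> (\<forall>j\<in>{1..s} - {i}. e i j k = 0 \<and> e j i k = 0)"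
  shows "group_centre (heisenberg_product r s s e) = heisenberg_c r s s ` carrier (int_power_group r)"
proof
  interpret R: group "int_power_group r" by simp
  interpret S: group "int_power_group s" by simp
  show "heisenberg_c r s s ` carrier (int_power_group r) \<subseteq> group_centre (heisenberg_product r s s e)"
    using heisenberg_c_central[of _ r _ s s e] hom_in_carrier[OF heisenberg_c_hom]
    by (auto simp: group_centre_def)
  show "group_centre (heisenberg_product r s s e) \<subseteq> heisenberg_c r s s ` carrier (int_power_group r)"
  proof
    fix w assume w: "w \<in> group_centre (heisenberg_product r s s e)"
    then obtain z m h where zmh: "w = ((z, m), h)" "z \<in> carrier (int_power_group r)"
      "m \<in> carrier (int_power_group s)" "h \<in> carrier (int_power_group s)"
      by (auto simp: group_centre_def carrier_heisenberg_product)
    have comm: "w \<otimes>\<^bsub>heisenberg_product r s s e\<^esub> u = u \<otimes>\<^bsub>heisenberg_product r s s e\<^esub> w"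
      if "u \<in> carrier (heisenberg_product r s s e)" for u
      using w that by (simp add: group_centre_def)
    have "m i = 0 \<and> h i = 0" if i: "i \<in> {1..s}" for i
    proof -
      obtain k where k: "k \<in> {1..r}" "e i i k \<noteq> 0" "\<And>j. j \<in> {1..s} - {i} \<Longrightarrow> e i j k = 0 \<and> e j i k = 0"
        using e[OF i] by blast
      have "bilinear_shift r s s e h (int_unit s i) = \<one>\<^bsub>int_power_group r\<^esub>"
        using comm[OF hom_in_carrier[OF heisenberg_x_hom int_unit_closed[of s i]]] zmh
        by (simp add: heisenberg_x_def mult_heisenberg_product R.r_cancel_one)
      moreover have "bilinear_shift r s s e (int_unit s i) m = \<one>\<^bsub>int_power_group r\<^esub>"
        using comm[OF hom_in_carrier[OF heisenberg_y_hom int_unit_closed[of s i]]] zmh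
        by (simp add: heisenberg_y_def mult_heisenberg_product R.r_cancel_one)
      ultimately have "(\<Sum>j\<in>{1..s}. h j * e j i k) = 0" "(\<Sum>j\<in>{1..s}. m j * e i j k) = 0"
        using bilinear_shift_int_unit_right[OF i k(1), of s e h] bilinear_shift_int_unit_left[OF i
            k(1), of s e m] k(1)
        by (simp_all add: one_int_power_group)
      moreover have "(\<Sum>j\<in>{1..s}. h j * e j i k) = (\<Sum>j\<in>{1..s}. if j = i then h i * e i i k else 0)"
        "(\<Sum>j\<in>{1..s}. m j * e i j k) = (\<Sum>j\<in>{1..s}. if j = i then m i * e i i k else 0)"
        using k(3) by (intro sum.cong refl; force)+
      ultimately show ?thesis using k(2) i by simp
    qed
    then have "m = \<one>\<^bsub>int_power_group s\<^esub>" "h = \<one>\<^bsub>int_power_group s\<^esub>"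
      using zmh by (auto simp: one_int_power_group carrier_int_power_group PiE_def extensional_def)
    then show "w \<in> heisenberg_c r s s ` carrier (int_power_group r)"
      using zmh by (auto simp: heisenberg_c_def)
  qed
qed

section \<open>The relations of the mixed braid groups\<close>

context group
begin

lemma commute_conj:
  "x \<otimes> u = u \<otimes> x \<Longrightarrow> x \<in> carrier G \<Longrightarrow> u \<in> carrier G \<Longrightarrow> inv u \<otimes> x \<otimes> u = x"
  by (simp add: m_assoc) (simp flip: m_assoc)

lemma commute_commutator:
  assumes "x \<otimes> u = u \<otimes> x" "x \<in> carrier G" "u \<in> carrier G"
  shows "x \<otimes> u \<otimes> inv x \<otimes> inv u = \<one>"
proof -
  have "x \<otimes> u \<otimes> inv x = u" using assms by (simp add: m_assoc)
  then show ?thesis using assms by simp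
qed

lemma commute_if_conj_eq:
  assumes "x \<otimes> u \<otimes> inv x = w" "x \<in> carrier G" "u \<in> carrier G"
  shows "x \<otimes> u = w \<otimes> x"
  using assms by (auto simp: m_assoc)

lemma commute_generate:
  assumes "carrier G = generate G S" "S \<subseteq> carrier G" "x \<in> carrier G" "\<And>u. u \<in> S \<Longrightarrow> x \<otimes> u = u \<otimes> x"
    and u: "u \<in> carrier G"
  shows "x \<otimes> u = u \<otimes> x"
proof -
  have "u \<in> generate G S" using assms by simp
  then show ?thesis
  proof (induction rule: generate.induct)
    case (inv h)
    then show ?case using commute_inv[of h x] assms by auto
  next
    case (eng h h')
    then show ?case
      using commute_mult[of h x h'] assms(1,3) by simp
  qed (use assms in auto)
qed

text \<open>With k = [x, y] central, the two sides of the braid relation are y x (k x) and y x y,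
  whence y = k x. So y is x times a central element and commutes with x, which means k = 1.\<close>

lemma braid_relation_class2:
  assumes braid: "x \<otimes> y \<otimes> x = y \<otimes> x \<otimes> y" and [simp]: "x \<in> carrier G" "y \<in> carrier G"
    and central: "\<And>u. u \<in> carrier G \<Longrightarrow>
      (x \<otimes> y \<otimes> inv x \<otimes> inv y) \<otimes> u = u \<otimes> (x \<otimes> y \<otimes> inv x \<otimes> inv y)"
  shows "x = y"
proof -
  define k where "k = x \<otimes> y \<otimes> inv x \<otimes> inv y"
  have [simp]: "k \<in> carrier G" by (simp add: k_def)
  have k: "k \<otimes> u = u \<otimes> k" if "u \<in> carrier G" for u using central[OF that] by (simp add: k_def)
  have xy: "x \<otimes> y = k \<otimes> (y \<otimes> x)" 
    by (simp add: k_def m_assoc) (simp flip: m_assoc)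
  have "y \<otimes> x \<otimes> y = y \<otimes> x \<otimes> (k \<otimes> x)"
    using braid k[of "y \<otimes> x"] by (simp add: xy flip: m_assoc)
  then have y: "y = k \<otimes> x" by simp
  have "k \<otimes> (y \<otimes> x) = x \<otimes> y" by (simp add: xy)
  also have "x \<otimes> y = k \<otimes> x \<otimes> x" using k[of x, symmetric] by (subst y) (simp flip: m_assoc)
  also have "\<dots> = y \<otimes> x" by (simp flip: y)
  finally have "k = \<one>" by simp
  then show ?thesis using y by simp
qed

lemma int_pow_minus_2: "u \<in> carrier G \<Longrightarrow> u [^] (-2 :: int) = inv (u \<otimes> u)"
  using int_pow_neg[of u 2] int_pow_mult[of u 1 1] by simp

lemma int_pow_minus_1: "u \<in> carrier G \<Longrightarrow> u [^] (-1 :: int) = inv u"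
  using int_pow_neg[of u 1] by simp

end

text \<open>The valuation is total on the letter type, so evaluation is multiplicative without side
  conditions on the alphabet.\<close>

locale word_valuation = group G for G (structure) +
  fixes v :: "'x \<Rightarrow> 'a"
  assumes v_closed [simp]: "v x \<in> carrier G"
begin

abbreviation ev where "ev \<equiv> word_eval G v"

definition satisfies :: "('x gword \<times> 'x gword) set \<Rightarrow> bool" where
  "satisfies R \<longleftrightarrow> (\<forall>(l, r)\<in>R. ev l = ev r)"

lemma satisfies_Un [simp]: "satisfies (R \<union> R') \<longleftrightarrow> satisfies R \<and> satisfies R'"
  by (auto simp: satisfies_def)

lemma satisfiesD: "satisfies R \<Longrightarrow> (l, r) \<in> R \<Longrightarrow> ev l = ev r"
  by (auto simp: satisfies_def)

lemma ev_closed [simp]: "ev w \<in> carrier G"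
  using word_eval_closed[of v UNIV w] by auto

lemma ev_append [simp]: "ev (u @ w) = ev u \<otimes> ev w"
  using word_eval_append[of v UNIV u w] by auto

lemma ev_word_inv [simp]: "ev (word_inv w) = inv (ev w)"
proof (induction w)
  case (Cons p w)
  obtain x b where p: "p = (x, b)" by (cases p)
  have "word_inv (p # w) = word_inv w @ [(x, \<not> b)]" by (simp add: word_inv_def p)
  then show ?case using Cons by (simp add: p inv_mult_group)
qed (simp add: word_inv_def)

lemma ev_word_commutator [simp]: "ev (word_commutator u w) = ev u \<otimes> ev w \<otimes> inv (ev u) \<otimes> inv (ev w)"
  by (simp add: word_commutator_def m_assoc)

lemma ev_word_conj [simp]: "ev (word_conj u w) = inv (ev w) \<otimes> ev u \<otimes> ev w"
  by (simp add: word_conj_def m_assoc)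

text \<open>Since m \<ge> 3 there is an \<open>s 2\<close>; it commutes with all a_i and b_i by the
  relations and has the same value as \<open>s 1\<close>. Hence conjugation by \<open>s 1\<close>
  drops out of the relations for c < d, and a s b = s b s a s shortens to a b = s^2 b a.\<close>

lemma surface_relations_class2:
  assumes R: "satisfies (surface_relations m g s a b)" and m: "m \<ge> 3"
    and class2: "\<forall>x\<in>carrier G. \<forall>y\<in>carrier G. \<forall>u\<in>carrier G.
      (x \<otimes> y \<otimes> inv x \<otimes> inv y) \<otimes> u = u \<otimes> (x \<otimes> y \<otimes> inv x \<otimes> inv y)"
  shows "i \<in> {1..<m} \<Longrightarrow> ev (s i) = ev (s 1)"
    and "c \<in> a ` {1..g} \<union> b ` {1..g} \<Longrightarrow> ev (s 1) \<otimes> ev c = ev c \<otimes> ev (s 1)"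
    and "i \<in> {1..g} \<Longrightarrow> j \<in> {1..g} \<Longrightarrow> i \<noteq> j \<Longrightarrow> c \<in> {a i, b i} \<Longrightarrow> d \<in> {a j, b j} \<Longrightarrow>
      ev c \<otimes> ev d = ev d \<otimes> ev c"
    and "i \<in> {1..g} \<Longrightarrow> ev (a i) \<otimes> ev (b i) = ev (s 1) \<otimes> ev (s 1) \<otimes> (ev (b i) \<otimes> ev (a i))"
proof -
  have R': "ev l = ev r" if "(l, r) \<in> surface_relations m g s a b" for l r
    using satisfiesD[OF R that] .
  have adj: "ev (s i) = ev (s (i + 1))" if "1 \<le> i" "i + 1 < m" for i
  proof (rule braid_relation_class2)
    have "(s i @ s (i+1) @ s i, s (i+1) @ s i @ s (i+1)) \<in> surface_relations m g s a b"
      unfolding surface_relations_def using that by blast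
    from R'[OF this] show "ev (s i) \<otimes> ev (s (i + 1)) \<otimes> ev (s i) = ev (s (i + 1)) \<otimes> ev (s i) \<otimes> ev (s (i + 1))"
      by (simp add: m_assoc)
  qed (simp_all add: class2)
  have ind: "i < m \<longrightarrow> ev (s i) = ev (s 1)" if "1 \<le> i" for i
    using that
  proof (induction i rule: dec_induct)
    case (step i)
    then show ?case using adj[of i] by (simp add: Suc_eq_plus1)
  qed simp
  show s: "ev (s i) = ev (s 1)" if "i \<in> {1..<m}" for i using ind[of i] that by simp
  show comm: "ev (s 1) \<otimes> ev c = ev c \<otimes> ev (s 1)" if "c \<in> a ` {1..g} \<union> b ` {1..g}" for c
  proof -
    have "(2::nat) \<in> {1..<m} \<and> (2::nat) \<noteq> 1" using m by simp
    then have "(c @ s 2, s 2 @ c) \<in> surface_relations m g s a b"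
      unfolding surface_relations_def using that by blast
    from R'[OF this] s[of 2] m show ?thesis by simp
  qed
  have less: "ev c \<otimes> ev d = ev d \<otimes> ev c"
    if "i \<in> {1..g}" "j \<in> {1..g}" "i < j" "c \<in> {a i, b i}" "d \<in> {a j, b j}" for i j c d
  proof -
    have "(word_conj c (s 1) @ d, d @ word_conj c (s 1)) \<in> surface_relations m g s a b"
      unfolding surface_relations_def using that by blast
    moreover have "inv (ev (s 1)) \<otimes> ev c \<otimes> ev (s 1) = ev c"
      by (rule commute_conj) (use comm[of c] that in auto)
    ultimately show ?thesis using R' by fastforce
  qed
  then show "ev c \<otimes> ev d = ev d \<otimes> ev c"
    if "i \<in> {1..g}" "j \<in> {1..g}" "i \<noteq> j" "c \<in> {a i, b i}" "d \<in> {a j, b j}" for i j c d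
    using that by (metis nat_neq_iff)
  show "ev (a i) \<otimes> ev (b i) = ev (s 1) \<otimes> ev (s 1) \<otimes> (ev (b i) \<otimes> ev (a i))" if i: "i \<in> {1..g}" for i
  proof -
    let ?s = "ev (s 1)" and ?a = "ev (a i)" and ?b = "ev (b i)"
    have c: "?s \<otimes> ?a = ?a \<otimes> ?s" "?s \<otimes> ?b = ?b \<otimes> ?s" using comm i by auto
    have "(a i @ s 1 @ b i, s 1 @ b i @ s 1 @ a i @ s 1) \<in> surface_relations m g s a b"
      unfolding surface_relations_def using i by blast
    from R'[OF this] have "?a \<otimes> ?s \<otimes> ?b = ?s \<otimes> (?b \<otimes> ?s) \<otimes> (?a \<otimes> ?s)" by (simp add: m_assoc)
    then have "?s \<otimes> ?a \<otimes> ?b = ?s \<otimes> (?s \<otimes> ?b) \<otimes> (?s \<otimes> ?a)" by (simp only: c)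
    then have "?s \<otimes> (?a \<otimes> ?b) = ?s \<otimes> (?s \<otimes> (?b \<otimes> ?s) \<otimes> ?a)" by (simp add: m_assoc)
    then have "?a \<otimes> ?b = ?s \<otimes> (?b \<otimes> ?s) \<otimes> ?a" by simp
    also have "\<dots> = ?s \<otimes> (?s \<otimes> ?b) \<otimes> ?a" by (simp only: c)
    finally show ?thesis by (simp add: m_assoc)
  qed
qed

text \<open>The converse of \<open>surface_relations_class2\<close>; it holds in any group, without
  assuming that commutators are central.\<close>

lemma surface_relations_satisfied:
  assumes s: "\<And>i. i \<in> {1..<m} \<Longrightarrow> ev (s i) = ev (s 1)"
    and comm: "\<And>c. c \<in> a ` {1..g} \<union> b ` {1..g} \<Longrightarrow> ev (s 1) \<otimes> ev c = ev c \<otimes> ev (s 1)"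
    and ab: "\<And>i j c d. i \<in> {1..g} \<Longrightarrow> j \<in> {1..g} \<Longrightarrow> i \<noteq> j \<Longrightarrow> c \<in> {a i, b i} \<Longrightarrow> d \<in> {a j, b j} \<Longrightarrow>
      ev c \<otimes> ev d = ev d \<otimes> ev c"
    and ba: "\<And>i. i \<in> {1..g} \<Longrightarrow> ev (a i) \<otimes> ev (b i) = ev (s 1) \<otimes> ev (s 1) \<otimes> (ev (b i) \<otimes> ev (a i))"
  shows "satisfies (surface_relations m g s a b)"
proof -
  let ?s = "ev (s 1)"
  have s4: "ev c \<otimes> (?s \<otimes> (ev c \<otimes> ?s)) = ?s \<otimes> (ev c \<otimes> (?s \<otimes> ev c))" if "c \<in> a ` {1..g} \<union> b ` {1..g}" for c
  proof -
    have "ev c \<otimes> (?s \<otimes> (ev c \<otimes> ?s)) = (ev c \<otimes> ?s) \<otimes> (ev c \<otimes> ?s)" by (simp add: m_assoc)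
    also have "\<dots> = (?s \<otimes> ev c) \<otimes> (?s \<otimes> ev c)" by (simp only: comm[OF that])
    finally show ?thesis by (simp add: m_assoc)
  qed
  have s5: "ev (a i) \<otimes> (?s \<otimes> ev (b i)) = ?s \<otimes> (ev (b i) \<otimes> (?s \<otimes> (ev (a i) \<otimes> ?s)))" if i: "i \<in> {1..g}" for i
  proof -
    let ?a = "ev (a i)" and ?b = "ev (b i)"
    have c: "?s \<otimes> ?a = ?a \<otimes> ?s" "?s \<otimes> ?b = ?b \<otimes> ?s" using comm i by auto
    have "?a \<otimes> (?s \<otimes> ?b) = (?a \<otimes> ?s) \<otimes> ?b" by (simp add: m_assoc)
    also have "\<dots> = (?s \<otimes> ?a) \<otimes> ?b" by (simp only: c)
    also have "\<dots> = ?s \<otimes> (?a \<otimes> ?b)" by (simp add: m_assoc)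
    also have "\<dots> = ?s \<otimes> (?s \<otimes> (?s \<otimes> ?b) \<otimes> ?a)" by (simp add: ba[OF i] m_assoc)
    also have "\<dots> = ?s \<otimes> (?s \<otimes> (?b \<otimes> ?s) \<otimes> ?a)" by (simp only: c)
    also have "\<dots> = ?s \<otimes> ((?s \<otimes> ?b) \<otimes> (?s \<otimes> ?a))" by (simp add: m_assoc)
    also have "\<dots> = ?s \<otimes> ((?b \<otimes> ?s) \<otimes> (?a \<otimes> ?s))" by (simp only: c)
    finally show ?thesis by (simp add: m_assoc)
  qed
  have s6: "inv ?s \<otimes> ev c \<otimes> ?s = ev c" if "c \<in> a ` {1..g} \<union> b ` {1..g}" for c
    by (rule commute_conj) (simp_all add: comm[OF that])
  show ?thesis
    unfolding surface_relations_def satisfies_Un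
  proof (intro conjI, goal_cases)
    case 1
    show ?case unfolding satisfies_def
    proof clarify
      fix i j assume "i \<in> {1..<m}" "j \<in> {1..<m}"
      then show "ev (s i @ s j) = ev (s j @ s i)" by (simp only: ev_append s)
    qed
  next
    case 2
    show ?case unfolding satisfies_def
    proof clarify
      fix i assume "1 \<le> i" "i + 1 < m"
      then show "ev (s i @ s (i + 1) @ s i) = ev (s (i + 1) @ s i @ s (i + 1))"
        using s[of i] s[of "i + 1"] by simp
    qed
  next
    case 3
    show ?case unfolding satisfies_def
    proof clarify
      fix c i assume "c \<in> a ` {1..g} \<union> b ` {1..g}" "i \<in> {1..<m}"
      then show "ev (c @ s i) = ev (s i @ c)" by (simp only: ev_append s comm)
    qed
  next
    case 4 then show ?case using s4 by (auto simp: satisfies_def)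
  next
    case 5 then show ?case using s5 by (auto simp: satisfies_def)
  next
    case 6
    show ?case unfolding satisfies_def
    proof clarify
      fix c d i j assume "i \<in> {1..g}" "j \<in> {1..g}" "i < j" "c \<in> {a i, b i}" "d \<in> {a j, b j}"
      then have "ev c \<otimes> ev d = ev d \<otimes> ev c" "c \<in> a ` {1..g} \<union> b ` {1..g}"
        using ab[of i j c d] by auto
      then show "ev (word_conj c (s 1) @ d) = ev (d @ word_conj c (s 1))"
        using s6 by simp
    qed
  qed
qed

end

text \<open>The relations that survive in the quotient, kept in the names of the presentation. The
  locale is used in both directions: derived for the quotient from the braid relations, and verified
  for the Heisenberg product in order to recover the braid relations there.\<close>

locale surface_braid_quotient = group G for G (structure) +
  fixes g :: nat and s t z :: 'a and a b a' b' :: "nat \<Rightarrow> 'a"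
  assumes central_closed: "s \<in> carrier G" "t \<in> carrier G" "z \<in> carrier G"
    and a_closed: "i \<in> {1..g} \<Longrightarrow> a i \<in> carrier G" "i \<in> {1..g} \<Longrightarrow> a' i \<in> carrier G"
    and b_closed: "i \<in> {1..g} \<Longrightarrow> b i \<in> carrier G" "i \<in> {1..g} \<Longrightarrow> b' i \<in> carrier G"
    and central: "u \<in> {s, t, z} \<Longrightarrow> w \<in> carrier G \<Longrightarrow> u \<otimes> w = w \<otimes> u"
    and aa: "i \<in> {1..g} \<Longrightarrow> j \<in> {1..g} \<Longrightarrow> u \<in> {a i, a' i} \<Longrightarrow> w \<in> {a j, a' j} \<Longrightarrow> u \<otimes> w = w \<otimes> u"
    and bb: "i \<in> {1..g} \<Longrightarrow> j \<in> {1..g} \<Longrightarrow> u \<in> {b i, b' i} \<Longrightarrow> w \<in> {b j, b' j} \<Longrightarrow> u \<otimes> w = w \<otimes> u"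
    and ab: "i \<in> {1..g} \<Longrightarrow> j \<in> {1..g} \<Longrightarrow> i \<noteq> j \<Longrightarrow> u \<in> {a i, a' i} \<Longrightarrow> w \<in> {b j, b' j} \<Longrightarrow>
      u \<otimes> w = w \<otimes> u"
    and a_b: "i \<in> {1..g} \<Longrightarrow> a i \<otimes> b i = s \<otimes> s \<otimes> (b i \<otimes> a i)"
    and a'_b': "i \<in> {1..g} \<Longrightarrow> a' i \<otimes> b' i = t \<otimes> t \<otimes> (b' i \<otimes> a' i)"
    and a'_b: "i \<in> {1..g} \<Longrightarrow> a' i \<otimes> b i = z \<otimes> (b i \<otimes> a' i)"
    and a_b': "i \<in> {1..g} \<Longrightarrow> a i \<otimes> b' i = z \<otimes> (b' i \<otimes> a i)"

lemma (in group) commute_conj':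
  assumes "x \<otimes> u = u \<otimes> x" "x \<in> carrier G" "u \<in> carrier G"
  shows "x \<otimes> (u \<otimes> inv x) = u"
proof -
  have "x \<otimes> (u \<otimes> inv x) = (x \<otimes> u) \<otimes> inv x" using assms(2,3) by (simp add: m_assoc)
  also have "\<dots> = (u \<otimes> x) \<otimes> inv x" by (simp only: assms(1))
  also have "\<dots> = u" using assms(2,3) by (simp add: m_assoc)
  finally show ?thesis .
qed

text \<open>The nested unions are taken apart once here, so that later each relation can be quoted
  by its shape.\<close>

lemma mixed_relationsI:
  fixes s s' a b a' b' z :: "nat \<Rightarrow> 'x gword" and k n g :: nat
  defines "M \<equiv> mixed_relations k n g s s' a b a' b' z"
  shows "y \<in> s' ` {1..<n} \<union> a' ` {1..g} \<union> b' ` {1..g} \<Longrightarrow> j \<in> {1..<k} \<Longrightarrow> (y @ s j, s j @ y) \<in> M"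
    and "i \<in> {1..<n} \<Longrightarrow> c \<in> a ` {1..g} \<union> b ` {1..g} \<Longrightarrow> (s' i @ c, c @ s' i) \<in> M"
    and "i \<in> {1..<n} \<Longrightarrow> (s' i @ z (i+1) @ word_inv (s' i), z i) \<in> M"
    and "i \<in> {1..<n} \<Longrightarrow> j \<in> {1..n} \<Longrightarrow> j \<noteq> i \<Longrightarrow> j \<noteq> i + 1 \<Longrightarrow> (s' i @ z j @ word_inv (s' i), z j) \<in> M"
    and "i \<in> {1..g} \<Longrightarrow> (y, x) \<in> {(a' i, a i), (b' i, b i)} \<Longrightarrow>
      (y @ z 1 @ word_inv y, word_conj (z 1) (x @ z 1)) \<in> M"
    and "i \<in> {1..g} \<Longrightarrow> (y, x) \<in> {(a' i, a i), (b' i, b i)} \<Longrightarrow>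
      (y @ x @ word_inv y, word_inv (z 1) @ x @ z 1) \<in> M"
    and "i \<in> {1..g} \<Longrightarrow> (y, x) \<in> {(a' i, a i), (b' i, b i)} \<Longrightarrow> j \<in> {1..g} \<Longrightarrow> j < i \<Longrightarrow> d \<in> {a j, b j} \<Longrightarrow>
      (y @ d @ word_inv y, word_conj d (word_commutator (word_inv x) (word_inv (z 1)))) \<in> M"
    and "i \<in> {1..g} \<Longrightarrow> (y, x) \<in> {(a' i, a i), (b' i, b i)} \<Longrightarrow> j \<in> {1..g} \<Longrightarrow> i < j \<Longrightarrow> d \<in> {a j, b j} \<Longrightarrow>
      (y @ d @ word_inv y, d) \<in> M"
    and "i \<in> {1..g} \<Longrightarrow> (a' i @ b i @ word_inv (a' i), b i @ z 1) \<in> M"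
    and "i \<in> {1..g} \<Longrightarrow> (b' i @ a i @ word_inv (b' i),
      word_inv (z 1) @ a i @ word_commutator (word_inv (b i)) (word_inv (z 1))) \<in> M"
  unfolding M_def mixed_relations_def
  subgoal by (rule UnI1, rule UnI1, rule UnI1, rule UnI1, rule UnI1, rule UnI1, rule UnI1) blast
  subgoal by (rule UnI1, rule UnI1, rule UnI1, rule UnI1, rule UnI1, rule UnI1, rule UnI2) blast
  subgoal by (rule UnI1, rule UnI1, rule UnI1, rule UnI1, rule UnI1, rule UnI2) blast
  subgoal by (rule UnI1, rule UnI1, rule UnI1, rule UnI2) blast
  subgoal by (rule UnI1, rule UnI1, rule UnI2, rule UN_I[of i], assumption, rule UN_I[of "(y, x)"]) auto
  subgoal by (rule UnI1, rule UnI1, rule UnI2, rule UN_I[of i], assumption, rule UN_I[of "(y, x)"]) auto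
  subgoal by (rule UnI1, rule UnI1, rule UnI2, rule UN_I[of i], assumption, rule UN_I[of "(y, x)"],
      assumption) (unfold prod.case, blast)
  subgoal by (rule UnI1, rule UnI1, rule UnI2, rule UN_I[of i], assumption, rule UN_I[of "(y, x)"],
      assumption) (unfold prod.case, blast)
  subgoal by (rule UnI1, rule UnI2) blast
  subgoal by (rule UnI2) blast
  done

context word_valuation
begin

lemma satisfies_UN: "satisfies (\<Union>i\<in>I. F i) \<longleftrightarrow> (\<forall>i\<in>I. satisfies (F i))"
  by (auto simp: satisfies_def)

text \<open>As for the a_i and b_i: \<zeta>_l commutes with \<open>s 2\<close>, which has the value
  of \<open>s 1\<close>, and then conjugation of \<zeta>_l by \<open>s 1\<close> is trivial.\<close>

lemma zeta_relations_class2: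
  assumes R: "satisfies (zeta_relations k n g s a b z)" and k: "k \<ge> 3"
    and s: "ev (s 2) = ev (s 1)" and l: "l \<in> {1..n}"
  shows "ev (s 1) \<otimes> ev (z l) = ev (z l) \<otimes> ev (s 1)"
    and "c \<in> a ` {1..g} \<union> b ` {1..g} \<Longrightarrow> ev (z l) \<otimes> ev c = ev c \<otimes> ev (z l)"
proof -
  have R': "ev u = ev w" if "(u, w) \<in> zeta_relations k n g s a b z" for u w
    using satisfiesD[OF R that] .
  have "(2::nat) \<in> {1..<k} \<and> (2::nat) \<noteq> 1" using k by simp
  then have "(z l @ s 2, s 2 @ z l) \<in> zeta_relations k n g s a b z"
    unfolding zeta_relations_def using l by blast
  from R'[OF this] show comm: "ev (s 1) \<otimes> ev (z l) = ev (z l) \<otimes> ev (s 1)"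
    by (simp only: ev_append s)
  show "ev (z l) \<otimes> ev c = ev c \<otimes> ev (z l)" if "c \<in> a ` {1..g} \<union> b ` {1..g}"
  proof -
    have "(word_conj (z l) (s 1) @ c, c @ word_conj (z l) (s 1)) \<in> zeta_relations k n g s a b z"
      unfolding zeta_relations_def using l that by blast
    from R'[OF this] show ?thesis
      using commute_conj[OF comm[symmetric]] by simp
  qed
qed

text \<open>Centrality of the three common values can be tested only against generators, which is
  why generation is among the hypotheses. That commutators are central is used through the two
  copies of \<open>surface_relations_class2\<close>.\<close>

lemma surface_braid_quotientI:
  assumes k: "k \<ge> 3" and n: "n \<ge> 3"
    and surface: "satisfies (surface_relations k g s a b)"
    and surface': "satisfies (surface_relations n g s' a' b')"
    and zeta: "satisfies (zeta_relations k n g s a b z)"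
    and mixed: "satisfies (mixed_relations k n g s s' a b a' b' z)"
    and class2: "\<forall>x\<in>carrier G. \<forall>y\<in>carrier G. \<forall>u\<in>carrier G.
      (x \<otimes> y \<otimes> inv x \<otimes> inv y) \<otimes> u = u \<otimes> (x \<otimes> y \<otimes> inv x \<otimes> inv y)"
    and gen: "carrier G = generate G (ev ` (s ` {1..<k} \<union> s' ` {1..<n} \<union> a ` {1..g} \<union> b ` {1..g}
      \<union> a' ` {1..g} \<union> b' ` {1..g} \<union> z ` {1..n}))"
  shows "surface_braid_quotient G g (ev (s 1)) (ev (s' 1)) (ev (z 1))
      (\<lambda>i. ev (a i)) (\<lambda>i. ev (b i)) (\<lambda>i. ev (a' i)) (\<lambda>i. ev (b' i))"
    and "\<And>i. i \<in> {1..<k} \<Longrightarrow> ev (s i) = ev (s 1)"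
    and "\<And>i. i \<in> {1..<n} \<Longrightarrow> ev (s' i) = ev (s' 1)"
    and "\<And>i. i \<in> {1..n} \<Longrightarrow> ev (z i) = ev (z 1)"
proof -
  let ?s = "ev (s 1)" and ?t = "ev (s' 1)" and ?z = "ev (z 1)"
  have R: "ev u = ev w" if "(u, w) \<in> mixed_relations k n g s s' a b a' b' z" for u w
    using satisfiesD[OF mixed that] .
  note M = mixed_relationsI[where k = k and n = n and g = g and s = s and s' = s'
      and a = a and b = b and a' = a' and b' = b' and z = z]
  note S = surface_relations_class2[OF surface k class2]
  note S' = surface_relations_class2[OF surface' n class2]
  have "(2::nat) \<in> {1..<k}" "(2::nat) \<in> {1..<n}" using k n by simp_all
  note two = this
  have "ev (s 2) = ?s" by (rule S(1)[OF two(1)])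
  note Z = zeta_relations_class2[OF zeta k this]
  have t2: "ev (s' 2) = ?t" by (rule S'(1)[OF two(2)])
  have ys: "ev y \<otimes> ?s = ?s \<otimes> ev y" if "y \<in> s' ` {1..<n} \<union> a' ` {1..g} \<union> b' ` {1..g}" for y
  proof -
    have "1 \<in> {1..<k}" using k by simp
    from R[OF M(1)[OF that this]] show ?thesis by simp
  qed
  have tc: "?t \<otimes> ev c = ev c \<otimes> ?t" if "c \<in> a ` {1..g} \<union> b ` {1..g}" for c
  proof -
    have "1 \<in> {1..<n}" using n by simp
    from R[OF M(2)[OF this that]] show ?thesis by simp
  qed
  have tz: "?t \<otimes> ?z = ?z \<otimes> ?t"
  proof -
    \<comment> \<open>The relation \<sigma>t_2 \<zeta>_1 \<sigma>t_2^{-1} = \<zeta>_1, available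
      because n \<ge> 3; \<sigma>t_1 has the same value as \<sigma>t_2.\<close>
    have "(2::nat) \<in> {1..<n}" "(1::nat) \<in> {1..n}" "(1::nat) \<noteq> 2" "(1::nat) \<noteq> 2 + 1" using n by simp_all
    from R[OF M(4)[OF this]] show ?thesis by (intro commute_if_conj_eq) (simp_all add: t2 m_assoc)
  qed
  \<comment> \<open>Induction along \<sigma>t_i \<zeta>_{i+1} \<sigma>t_i^{-1} = \<zeta>_i: the left
    conjugation is by the common value of the \<sigma>t's, which commutes with \<zeta>_1, so
    \<zeta>_i = \<zeta>_1 passes on to \<zeta>_{i+1}.\<close>
  have zz: "i \<le> n \<longrightarrow> ev (z i) = ?z" if "1 \<le> i" for i
    using that
  proof (induction i rule: dec_induct)
    case (step i)
    show ?case
    proof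
      assume "Suc i \<le> n"
      then have i: "i \<in> {1..<n}" "ev (z i) = ?z" using step by auto
      from R[OF M(3)[OF i(1)]] have "?t \<otimes> ev (z (i + 1)) \<otimes> inv ?t = ?z"
        by (simp add: S'(1)[OF i(1)] i(2) m_assoc)
      then have "?t \<otimes> ev (z (i + 1)) = ?t \<otimes> ?z"
        using commute_if_conj_eq[of ?t "ev (z (i + 1))" ?z] tz by simp
      then show "ev (z (Suc i)) = ?z" by (simp add: Suc_eq_plus1)
    qed
  qed simp
  \<comment> \<open>As \<zeta>_1 commutes with a_i and b_i, the conjugating words x \<zeta>_1,
    \<zeta>_1 and [x^{-1}, \<zeta>_1^{-1}] on the right-hand sides act trivially, and each relation
    becomes a commutation.\<close>
  have xt: "(y, x) \<in> {(a' i, a i), (b' i, b i)} \<Longrightarrow> ev y \<otimes> ?z = ?z \<otimes> ev y"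
    "(y, x) \<in> {(a' i, a i), (b' i, b i)} \<Longrightarrow> ev y \<otimes> ev x = ev x \<otimes> ev y"
    "(y, x) \<in> {(a' i, a i), (b' i, b i)} \<Longrightarrow> j \<in> {1..g} \<Longrightarrow> i \<noteq> j \<Longrightarrow> d \<in> {a j, b j} \<Longrightarrow> ev y \<otimes> ev d = ev d \<otimes> ev y"
    if i: "i \<in> {1..g}" for i j x y d
  proof -
    assume yx: "(y, x) \<in> {(a' i, a i), (b' i, b i)}"
    have zx: "?z \<otimes> ev x = ev x \<otimes> ?z" using Z(2)[of 1 x] n i yx by auto
    from R[OF M(5)[OF i yx]] have "ev y \<otimes> ?z \<otimes> inv (ev y) = inv (ev x \<otimes> ?z) \<otimes> ?z \<otimes> (ev x \<otimes> ?z)"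
      by (simp add: m_assoc)
    also have "\<dots> = ?z"
      by (rule commute_conj) (simp_all add: zx m_assoc flip: zx)
    finally show "ev y \<otimes> ?z = ?z \<otimes> ev y" by (rule commute_if_conj_eq) simp_all
    from R[OF M(6)[OF i yx]] have "ev y \<otimes> ev x \<otimes> inv (ev y) = inv ?z \<otimes> ev x \<otimes> ?z"
      by (simp add: m_assoc)
    also have "\<dots> = ev x" by (rule commute_conj) (simp_all add: zx)
    finally show "ev y \<otimes> ev x = ev x \<otimes> ev y" by (rule commute_if_conj_eq) simp_all
    assume j: "j \<in> {1..g}" "i \<noteq> j" and d: "d \<in> {a j, b j}"
    have k1: "inv (ev x) \<otimes> inv ?z \<otimes> inv (inv (ev x)) \<otimes> inv (inv ?z) = \<one>"
      by (rule commute_commutator) (simp_all add: zx flip: inv_mult_group)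
    have "ev y \<otimes> ev d \<otimes> inv (ev y) = ev d"
    proof (cases "j < i")
      case True
      from R[OF M(7)[OF i yx j(1) True d]] show ?thesis using k1 by (simp add: m_assoc)
    next
      case False
      then have "i < j" using j by simp
      from R[OF M(8)[OF i yx j(1) this d]] show ?thesis by (simp add: m_assoc)
    qed
    then show "ev y \<otimes> ev d = ev d \<otimes> ev y" by (rule commute_if_conj_eq) simp_all
  qed
  have z1: "1 \<in> {1..n}" using n by simp
  let ?S = "s ` {1..<k} \<union> s' ` {1..<n} \<union> a ` {1..g} \<union> b ` {1..g} \<union> a' ` {1..g} \<union> b' ` {1..g} \<union> z ` {1..n}"
  \<comment> \<open>By now every generator has collapsed to one of the three values or is one of the
    a's and b's, with or without tilde.\<close>
  have central: "u \<otimes> w = w \<otimes> u" if u: "u \<in> {?s, ?t, ?z}" and w: "w \<in> carrier G" for u w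
  proof (rule commute_generate[OF gen _ _ _ w])
    have s1: "s' 1 \<in> s' ` {1..<n}" using n by simp
    have sz: "?z \<otimes> ?s = ?s \<otimes> ?z" "?t \<otimes> ?s = ?s \<otimes> ?t" using Z(1)[OF z1] ys[of "s' 1"] s1 by simp_all
    fix x assume "x \<in> ev ` ?S"
    then consider "x = ?s" | "x = ?t" | "x = ?z" | c where "c \<in> a ` {1..g} \<union> b ` {1..g}" "x = ev c"
      | c where "c \<in> a' ` {1..g} \<union> b' ` {1..g}" "x = ev c"
      using S(1) S'(1) zz by (auto simp only: image_iff Un_iff atLeastAtMost_iff)
    then show "u \<otimes> x = x \<otimes> u"
    proof cases
      case 4
      then show ?thesis using u S(2)[of c] tc[of c] Z(2)[OF z1, of c] by auto
    next
      case 5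
      then obtain i where "i \<in> {1..g}" "c = a' i \<or> c = b' i" by blast
      then have "ev c \<otimes> ?z = ?z \<otimes> ev c" using xt(1)[of i c "a i"] xt(1)[of i c "b i"] by auto
      then show ?thesis using 5 u S'(2)[of c] ys[of c] by auto
    qed (use u sz tz in auto)
  qed (use u in auto)
  show "surface_braid_quotient G g ?s ?t ?z
      (\<lambda>i. ev (a i)) (\<lambda>i. ev (b i)) (\<lambda>i. ev (a' i)) (\<lambda>i. ev (b' i))"
  proof unfold_locales
    show "u \<otimes> w = w \<otimes> u" if "u \<in> {?s, ?t, ?z}" "w \<in> carrier G" for u w using that by (rule central)
  next
    fix i j u w assume i: "i \<in> {1..g}" and j: "j \<in> {1..g}"
      and u: "u \<in> {ev (a i), ev (a' i)}" and w: "w \<in> {ev (a j), ev (a' j)}"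
    show "u \<otimes> w = w \<otimes> u"
      using i j u w S(3)[of i j "a i" "a j"] S'(3)[of i j "a' i" "a' j"]
        xt(3)[of i "a' i" "a i" j "a j"] xt(3)[of j "a' j" "a j" i "a i"] xt(2)[of i "a' i" "a i"]
      by (cases "i = j") auto
  next
    fix i j u w assume i: "i \<in> {1..g}" and j: "j \<in> {1..g}"
      and u: "u \<in> {ev (b i), ev (b' i)}" and w: "w \<in> {ev (b j), ev (b' j)}"
    show "u \<otimes> w = w \<otimes> u"
      using i j u w S(3)[of i j "b i" "b j"] S'(3)[of i j "b' i" "b' j"]
        xt(3)[of i "b' i" "b i" j "b j"] xt(3)[of j "b' j" "b j" i "b i"] xt(2)[of i "b' i" "b i"]
      by (cases "i = j") auto
  next
    fix i j u w assume i: "i \<in> {1..g}" and j: "j \<in> {1..g}" and ij: "i \<noteq> j"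
      and u: "u \<in> {ev (a i), ev (a' i)}" and w: "w \<in> {ev (b j), ev (b' j)}"
    show "u \<otimes> w = w \<otimes> u"
      using i j ij u w S(3)[of i j "a i" "b j"] S'(3)[of i j "a' i" "b' j"]
        xt(3)[of i "a' i" "a i" j "b j"] xt(3)[of j "b' j" "b j" i "a i"]
      by auto
  next
    fix i assume i: "i \<in> {1..g}"
    show "ev (a i) \<otimes> ev (b i) = ?s \<otimes> ?s \<otimes> (ev (b i) \<otimes> ev (a i))" using S(4)[OF i] .
    show "ev (a' i) \<otimes> ev (b' i) = ?t \<otimes> ?t \<otimes> (ev (b' i) \<otimes> ev (a' i))" using S'(4)[OF i] .
    \<comment> \<open>This relation contributes the commutator [at_i, b_i] = \<zeta>.\<close>
    from R[OF M(9)[OF i]] have "ev (a' i) \<otimes> ev (b i) \<otimes> inv (ev (a' i)) = ev (b i) \<otimes> ?z" by (simp add: m_assoc)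
    also have "\<dots> = ?z \<otimes> ev (b i)" using central[of ?z "ev (b i)"] by simp
    finally show "ev (a' i) \<otimes> ev (b i) = ?z \<otimes> (ev (b i) \<otimes> ev (a' i))"
      using commute_if_conj_eq[of "ev (a' i)" "ev (b i)" "?z \<otimes> ev (b i)"] by (simp add: m_assoc)
    \<comment> \<open>The trailing commutator [b_i^{-1}, \<zeta>_1^{-1}] in the relation for bt_i
      and a_i is trivial as \<zeta> is central, leaving bt_i a_i bt_i^{-1} = \<zeta>^{-1}
      a_i.\<close>
    have "inv (ev (b i)) \<otimes> inv ?z \<otimes> inv (inv (ev (b i))) \<otimes> inv (inv ?z) = \<one>"
      by (rule commute_commutator) (use central[of ?z "ev (b i)"] in \<open>simp_all flip: inv_mult_group\<close>)
    with R[OF M(10)[OF i]]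
    have "ev (b' i) \<otimes> ev (a i) \<otimes> inv (ev (b' i)) = inv ?z \<otimes> ev (a i)"
      by (simp add: m_assoc)
    then have "ev (b' i) \<otimes> ev (a i) = inv ?z \<otimes> ev (a i) \<otimes> ev (b' i)"
      by (rule commute_if_conj_eq) simp_all
    then show "ev (a i) \<otimes> ev (b' i) = ?z \<otimes> (ev (b' i) \<otimes> ev (a i))"
      by (simp add: m_assoc) (simp flip: m_assoc)
  qed simp_all
  show "\<And>i. i \<in> {1..<k} \<Longrightarrow> ev (s i) = ev (s 1)" using S(1) .
  show "\<And>i. i \<in> {1..<n} \<Longrightarrow> ev (s' i) = ev (s' 1)" using S'(1) .
  show "ev (z i) = ev (z 1)" if "i \<in> {1..n}" for i using zz[of i] that by simp
qed

text \<open>With one central value for each of the families \<sigma>_i, \<sigma>t_i and \<zeta>_i,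
  all conjugations by them are trivial, and the presentation asks for no more than the commutator
  relations of the locale.\<close>

lemma braid_relations_satisfied:
  assumes Q: "surface_braid_quotient G g S T Z (\<lambda>i. ev (a i)) (\<lambda>i. ev (b i)) (\<lambda>i. ev (a' i)) (\<lambda>i. ev (b' i))"
    and s: "\<And>i. ev (s i) = S" and s': "\<And>i. ev (s' i) = T" and z: "\<And>i. ev (z i) = Z"
  shows "satisfies (surface_relations k g s a b)"
    and "satisfies (surface_relations n g s' a' b')"
    and "satisfies (zeta_relations k n g s a b z)"
    and "satisfies (mixed_relations k n g s s' a b a' b' z)"
proof -
  interpret Q: surface_braid_quotient G g S T Z "\<lambda>i. ev (a i)" "\<lambda>i. ev (b i)" "\<lambda>i. ev (a' i)" "\<lambda>i. ev (b' i)"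
    by (rule Q)
  note [simp] = Q.central_closed
  have S: "S \<otimes> ev w = ev w \<otimes> S" and T: "T \<otimes> ev w = ev w \<otimes> T" and Z: "Z \<otimes> ev w = ev w \<otimes> Z" for w
    using Q.central[of S "ev w"] Q.central[of T "ev w"] Q.central[of Z "ev w"] by simp_all
  have ST: "S \<otimes> T = T \<otimes> S" and SZ: "S \<otimes> Z = Z \<otimes> S" and TZ: "T \<otimes> Z = Z \<otimes> T"
    using Q.central[of S T] Q.central[of S Z] Q.central[of T Z] by simp_all
  show "satisfies (surface_relations k g s a b)"
  proof (rule surface_relations_satisfied)
    fix i j c d assume ij: "i \<in> {1..g}" "j \<in> {1..g}" "i \<noteq> j" "c \<in> {a i, b i}" "d \<in> {a j, b j}"
    show "ev c \<otimes> ev d = ev d \<otimes> ev c"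
      using ij Q.aa[of i j "ev c" "ev d"] Q.bb[of i j "ev c" "ev d"] Q.ab[of i j "ev c" "ev d"]
        Q.ab[of j i "ev d" "ev c"] by auto
  qed (simp_all only: s S Q.a_b)
  show "satisfies (surface_relations n g s' a' b')"
  proof (rule surface_relations_satisfied)
    fix i j c d assume ij: "i \<in> {1..g}" "j \<in> {1..g}" "i \<noteq> j" "c \<in> {a' i, b' i}" "d \<in> {a' j, b' j}"
    show "ev c \<otimes> ev d = ev d \<otimes> ev c"
      using ij Q.aa[of i j "ev c" "ev d"] Q.bb[of i j "ev c" "ev d"] Q.ab[of i j "ev c" "ev d"]
        Q.ab[of j i "ev d" "ev c"] by auto
  qed (simp_all only: s' T Q.a'_b')
  have Z_conj: "inv S \<otimes> Z \<otimes> S = Z" by (rule commute_conj) (simp_all add: SZ)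
  show "satisfies (zeta_relations k n g s a b z)"
    unfolding zeta_relations_def satisfies_Un
  proof (intro conjI, goal_cases)
    case 1 then show ?case by (auto simp: satisfies_def s z SZ)
  next
    case 2
    have "(Z \<otimes> S) \<otimes> (Z \<otimes> S) = (S \<otimes> Z) \<otimes> (S \<otimes> Z)" by (simp only: SZ)
    then show ?case by (auto simp: satisfies_def s z m_assoc)
  next
    case 3 then show ?case by (auto simp: satisfies_def s z Z Z_conj)
  next
    case 4 then show ?case by (auto simp: satisfies_def s z Z_conj)
  qed
  have tz: "T \<otimes> (Z \<otimes> inv T) = Z" by (rule commute_conj') (simp_all add: TZ)
  \<comment> \<open>The right-hand side \<zeta>_i^{-1} \<zeta>_{i+1} \<zeta>_i with all factors at
    the common value.\<close>
  have ztz: "inv Z \<otimes> (Z \<otimes> Z) = Z" by (simp flip: m_assoc)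
  have xt: "ev y \<otimes> (ev (z j) \<otimes> inv (ev y)) = Z"
    "inv (ev x \<otimes> Z) \<otimes> Z \<otimes> (ev x \<otimes> Z) = Z"
    "inv (ev x) \<otimes> inv Z \<otimes> inv (inv (ev x)) \<otimes> inv (inv Z) = \<one>"
    "inv Z \<otimes> ev x \<otimes> Z = ev x" for x y j
  proof -
    show "ev y \<otimes> (ev (z j) \<otimes> inv (ev y)) = Z" unfolding z by (rule commute_conj') (simp_all add: Z)
    show "inv (ev x \<otimes> Z) \<otimes> Z \<otimes> (ev x \<otimes> Z) = Z"
      by (rule commute_conj) (simp_all add: m_assoc flip: Z)
    show "inv (ev x) \<otimes> inv Z \<otimes> inv (inv (ev x)) \<otimes> inv (inv Z) = \<one>"
      by (rule commute_commutator) (simp_all add: Z flip: inv_mult_group)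
    show "inv Z \<otimes> ev x \<otimes> Z = ev x" by (rule commute_conj) (simp_all add: Z)
  qed
  have conj: "ev y \<otimes> (ev d \<otimes> inv (ev y)) = ev d" if "ev y \<otimes> ev d = ev d \<otimes> ev y" for y d
    using that by (rule commute_conj') simp_all
  have yx: "ev y \<otimes> ev x = ev x \<otimes> ev y" if "i \<in> {1..g}" "(y, x) \<in> {(a' i, a i), (b' i, b i)}" for i x y
    using that Q.aa[of i i "ev y" "ev x"] Q.bb[of i i "ev y" "ev x"] by auto
  have yd: "ev y \<otimes> ev d = ev d \<otimes> ev y"
    if "i \<in> {1..g}" "(y, x) \<in> {(a' i, a i), (b' i, b i)}" "j \<in> {1..g}" "i \<noteq> j" "d \<in> {a j, b j}" for i x y j d
    using that Q.aa[of i j "ev y" "ev d"] Q.bb[of i j "ev y" "ev d"] Q.ab[of i j "ev y" "ev d"]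
      Q.ab[of j i "ev d" "ev y"] by auto
  show "satisfies (mixed_relations k n g s s' a b a' b' z)"
    unfolding mixed_relations_def satisfies_Un
  proof (intro conjI, goal_cases)
    case 1 then show ?case by (auto simp: satisfies_def s s' S T ST)
  next
    case 2 then show ?case by (auto simp: satisfies_def s' T)
  next
    case 3 then show ?case by (auto simp: satisfies_def s' z tz)
  next
    case 4 then show ?case by (auto simp: satisfies_def s' z tz ztz)
  next
    case 5 then show ?case by (auto simp: satisfies_def s' z tz)
  next
    case 6
    \<comment> \<open>The relations for (at_i, a_i) and (bt_i, b_i) have the same shape and are
      checked for either pair at once.\<close>
    have "satisfies ({y @ z 1 @ word_inv y \<doteq> word_conj (z 1) (x @ z 1)}
      \<union> {y @ z j @ word_inv y \<doteq>
           word_conj (z j) (word_commutator (word_inv x) (word_inv (z 1))) | j.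
           j \<in> {1..n} \<and> j \<noteq> 1}
      \<union> {y @ x @ word_inv y \<doteq> word_inv (z 1) @ x @ z 1}
      \<union> {y @ d @ word_inv y \<doteq>
           word_conj d (word_commutator (word_inv x) (word_inv (z 1))) | d j.
           j \<in> {1..g} \<and> j < i \<and> d \<in> {a j, b j}}
      \<union> {y @ d @ word_inv y \<doteq> d | d j. j \<in> {1..g} \<and> i < j \<and> d \<in> {a j, b j}})"
      if i: "i \<in> {1..g}" and p: "(y, x) \<in> {(a' i, a i), (b' i, b i)}" for i x y
      unfolding satisfies_Un
    proof (intro conjI, goal_cases)
      case 1 then show ?case using xt(1,2) by (simp add: satisfies_def z)
    next
      case 2 then show ?case using xt(1,3) by (auto simp: satisfies_def z)
    next
      case 3 then show ?case using xt(4) conj[OF yx[OF i p]] by (simp add: satisfies_def z m_assoc)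
    next
      case 4
      show ?case unfolding satisfies_def
      proof clarify
        fix d j assume "j \<in> {1..g}" "j < i" "d \<in> {a j, b j}"
        then have "ev y \<otimes> (ev d \<otimes> inv (ev y)) = ev d" using conj[OF yd[OF i p, of j d]] by simp
        then show "ev (y @ d @ word_inv y) = ev (word_conj d (word_commutator (word_inv x) (word_inv (z 1))))"
          using xt(3) by (simp add: z)
      qed
    next
      case 5
      show ?case unfolding satisfies_def
      proof clarify
        fix d j assume "j \<in> {1..g}" "i < j" "d \<in> {a j, b j}"
        then show "ev (y @ d @ word_inv y) = ev d" using conj[OF yd[OF i p, of j d]] by simp
      qed
    qed
    note pair = this
    show ?case unfolding satisfies_UN
    proof (intro ballI, goal_cases)
      case (1 i p)
      then show ?case using pair[of i "fst p" "snd p"] by (simp only: split_beta prod.collapse)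
    qed
  next
    case 7
    have "ev (a' i) \<otimes> (ev (b i) \<otimes> inv (ev (a' i))) = ev (b i) \<otimes> Z" if "i \<in> {1..g}" for i
      using Q.a'_b[OF that] Z[of "b i"] by (simp flip: m_assoc) (simp add: m_assoc)
    then show ?case by (auto simp: satisfies_def z)
  next
    case 8
    have "ev (b' i) \<otimes> (ev (a i) \<otimes> inv (ev (b' i))) = inv Z \<otimes> ev (a i)" if "i \<in> {1..g}" for i
    proof -
      have "ev (b' i) \<otimes> ev (a i) = inv Z \<otimes> (Z \<otimes> (ev (b' i) \<otimes> ev (a i)))" by (simp flip: m_assoc)
      also have "\<dots> = inv Z \<otimes> ev (a i) \<otimes> ev (b' i)" by (simp add: Q.a_b'[OF that] m_assoc)
      finally have "ev (b' i) \<otimes> ev (a i) \<otimes> inv (ev (b' i)) = inv Z \<otimes> ev (a i) \<otimes> ev (b' i) \<otimes> inv (ev (b' i))"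
        by simp
      then show ?thesis by (simp add: m_assoc)
    qed
    then show ?case using xt(3) by (auto simp: satisfies_def z)
  qed
qed

end

section \<open>The Heisenberg structure of the quotient\<close>

text \<open>
  The generators \<open>a i\<close> and \<open>a' i\<close> are numbered \<open>2 * i - 1\<close> and \<open>2 * i\<close>, so that the products
  over \<open>{1..2 * g}\<close> become the products of pairs in the normal form.
\<close>

definition interleave :: "(nat \<Rightarrow> 'b) \<Rightarrow> (nat \<Rightarrow> 'b) \<Rightarrow> nat \<Rightarrow> 'b" where
  "interleave f f' i = (if odd i then f ((i + 1) div 2) else f' (i div 2))"

text \<open>The exponents of [y_j, x_i] in \<sigma>, \<sigma>t, \<zeta>, numbered k = 1, 2, 3. The
  diagonal entries come from [b_p, a_p] = \<sigma>^{-2} at odd and [bt_p, at_p] = \<sigma>t^{-2} at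
  even indices; the two mixed commutators within the \<open>p\<close>-th pair, where (i + 1) div 2 =
  (j + 1) div 2 = p, are \<zeta>^{-1}.\<close>

definition braid_form :: "nat \<Rightarrow> nat \<Rightarrow> nat \<Rightarrow> int" where
  "braid_form j i k =
     (if i = j \<and> k = (if odd i then 1 else 2) then -2
      else if i \<noteq> j \<and> k = 3 \<and> (i + 1) div 2 = (j + 1) div 2 then -1 else 0)"

definition three :: "'b \<Rightarrow> 'b \<Rightarrow> 'b \<Rightarrow> nat \<Rightarrow> 'b" where
  "three s t z k = (if k = 1 then s else if k = 2 then t else z)"

lemma interleave_odd: "1 \<le> p \<Longrightarrow> interleave f f' (2 * p - 1) = f p"
  by (auto simp: interleave_def)

lemma interleave_even: "interleave f f' (2 * p) = f' p"
  by (auto simp: interleave_def)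

lemma interleave_cases:
  fixes i g :: nat
  assumes "i \<in> {1..2 * g}"
  obtains p where "p \<in> {1..g}" "p = (i + 1) div 2" "i = 2 * p - 1"
  | p where "p \<in> {1..g}" "p = (i + 1) div 2" "i = 2 * p"
proof (cases "odd i")
  case True
  then obtain q where "i = 2 * q + 1" by (rule oddE)
  then have "q + 1 \<in> {1..g}" "q + 1 = (i + 1) div 2" "i = 2 * (q + 1) - 1" using assms by simp_all
  then show ?thesis by (rule that(1))
next
  case False
  then obtain q where i: "i = 2 * q" by auto
  then have "q \<in> {1..g}" "q = (i + 1) div 2" using assms by auto
  then show ?thesis using i by (rule that(2))
qed

lemma interleave_mem:
  assumes "i \<in> {1..2 * g}"
  shows "(i + 1) div 2 \<in> {1..g} \<and> interleave f f' i \<in> {f ((i + 1) div 2), f' ((i + 1) div 2)}"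
proof (rule interleave_cases[OF assms])
  fix p assume "p \<in> {1..g}" "p = (i + 1) div 2" "i = 2 * p - 1"
  then show ?thesis using interleave_odd[of p f f'] by (metis atLeastAtMost_iff insertCI)
next
  fix p assume "p \<in> {1..g}" "p = (i + 1) div 2" "i = 2 * p"
  then show ?thesis using interleave_even[of f f' p] by (metis insertCI)
qed

lemma interleave_image: "interleave f f' ` {1..2 * g} = (\<Union>i\<in>{1..g}. {f i, f' i})"
proof
  show "interleave f f' ` {1..2 * g} \<subseteq> (\<Union>i\<in>{1..g}. {f i, f' i})"
    using interleave_mem[of _ g f f'] by blast
  show "(\<Union>i\<in>{1..g}. {f i, f' i}) \<subseteq> interleave f f' ` {1..2 * g}"
  proof clarify
    fix i u assume i: "i \<in> {1..g}" and u: "u \<in> {f i, f' i}"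
    have "f i \<in> interleave f f' ` {1..2 * g}"
      using i interleave_odd[of i f f'] by (intro image_eqI[of _ _ "2 * i - 1"]) auto
    moreover have "f' i \<in> interleave f f' ` {1..2 * g}"
      using i interleave_even[of f f' i] by (intro image_eqI[of _ _ "2 * i"]) auto
    ultimately show "u \<in> interleave f f' ` {1..2 * g}" using u by blast
  qed
qed

lemma three_simps [simp]: "three s t z 1 = s" "three s t z 2 = t" "three s t z 3 = z"
  by (simp_all add: three_def)

lemma atLeastAtMost_1_3: "{1..3::nat} = {1, 2, 3}"
  by auto

lemma three_image: "three s t z ` {1..3} = {s, t, z}"
  by (simp add: atLeastAtMost_1_3 insert_commute)

lemma (in group) power_prod_3:
  assumes "c \<in> {1..3} \<rightarrow> carrier G"
  shows "power_prod G 3 c m = c 1 [^] m 1 \<otimes> c 2 [^] m 2 \<otimes> c 3 [^] m 3"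
proof -
  have "c 1 \<in> carrier G" "c 2 \<in> carrier G" "c 3 \<in> carrier G" using assms by auto
  then show ?thesis
    by (simp add: power_prod_def ordered_prod_def upt_rec[of 1] upt_rec[of 2] upt_rec[of 3] m_assoc
        numeral_3_eq_3 numeral_2_eq_2 One_nat_def)
qed

context surface_braid_quotient
begin

text \<open>Generators from different pairs commute and the form vanishes on them. Within one pair,
  the four commutator relations, solved for b a instead of a b, give the four nonzero entries of the
  form.\<close>

lemma heisenberg_generators:
  "heisenberg_generators G 3 (2 * g) (2 * g) braid_form (three s t z) (interleave a a') (interleave b b')"
proof -
  note [simp] = central_closed
  have c: "three s t z \<in> {1..3} \<rightarrow> carrier G" by (auto simp: atLeastAtMost_1_3)
  have x: "interleave a a' i \<in> carrier G" and y: "interleave b b' i \<in> carrier G" if "i \<in> {1..2 * g}" for i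
    using interleave_mem[OF that, of a a'] interleave_mem[OF that, of b b'] a_closed b_closed by auto
  show ?thesis
  proof unfold_locales
    show "three s t z k \<otimes> u = u \<otimes> three s t z k" if "k \<in> {1..3}" "u \<in> carrier G" for k u
      using central[of "three s t z k" u] that by (auto simp: atLeastAtMost_1_3)
    show "interleave a a' i \<otimes> interleave a a' i' = interleave a a' i' \<otimes> interleave a a' i"
      if "i \<in> {1..2 * g}" "i' \<in> {1..2 * g}" for i i'
      using interleave_mem[OF that(1), of a a'] interleave_mem[OF that(2), of a a'] by (blast intro: aa)
    show "interleave b b' i \<otimes> interleave b b' i' = interleave b b' i' \<otimes> interleave b b' i"
      if "i \<in> {1..2 * g}" "i' \<in> {1..2 * g}" for i i'
      using interleave_mem[OF that(1), of b b'] interleave_mem[OF that(2), of b b'] by (blast intro: bb)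
    fix j i assume j: "j \<in> {1..2 * g}" and i: "i \<in> {1..2 * g}"
    let ?x = "interleave a a' i" and ?y = "interleave b b' j"
    show "?y \<otimes> ?x = power_prod G 3 (three s t z) (braid_form j i) \<otimes> (?x \<otimes> ?y)"
    proof (cases "(i + 1) div 2 = (j + 1) div 2")
      case False
      then have "braid_form j i = (\<lambda>k. 0)" by (auto simp: braid_form_def)
      moreover have "?x \<otimes> ?y = ?y \<otimes> ?x"
        using interleave_mem[OF i, of a a'] interleave_mem[OF j, of b b'] False by (blast intro: ab)
      ultimately show ?thesis using x[OF i] y[OF j] by (simp add: power_prod_zero[OF c])
    next
      case True
      define p where "p = (i + 1) div 2"
      have p: "p \<in> {1..g}" using interleave_mem[OF i, of a a'] by (simp add: p_def)
      have i': "i = 2 * p - 1 \<or> i = 2 * p" and j': "j = 2 * p - 1 \<or> j = 2 * p"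
        using i j True by (auto simp: p_def)
      have [simp]: "a p \<in> carrier G" "a' p \<in> carrier G" "b p \<in> carrier G" "b' p \<in> carrier G"
        using a_closed b_closed p by auto
      have [simp]: "2 * p \<noteq> 2 * p - 1" "2 * p - 1 \<noteq> 2 * p" using p by auto
      have solve: "inv u \<otimes> (u \<otimes> w) = w" if "u \<in> carrier G" "w \<in> carrier G" for u w
        using that by (simp flip: m_assoc)
      consider "i = 2 * p - 1" "j = 2 * p - 1" | "i = 2 * p - 1" "j = 2 * p"
        | "i = 2 * p" "j = 2 * p - 1" | "i = 2 * p" "j = 2 * p" using i' j' by blast
      then show ?thesis
      proof cases
        case 1
        have "power_prod G 3 (three s t z) (braid_form j i) = inv (s \<otimes> s)"
          using p 1 by (simp add: power_prod_3[OF c] braid_form_def int_pow_minus_2)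
        then show ?thesis using 1 p by (simp add: interleave_odd a_b solve)
      next
        case 2
        have "power_prod G 3 (three s t z) (braid_form j i) = inv z"
          using p 2 by (simp add: power_prod_3[OF c] braid_form_def int_pow_minus_1)
        then show ?thesis using 2 p by (simp add: interleave_odd interleave_even a_b' solve)
      next
        case 3
        have "power_prod G 3 (three s t z) (braid_form j i) = inv z"
          using p 3 by (simp add: power_prod_3[OF c] braid_form_def int_pow_minus_1)
        then show ?thesis using 3 p by (simp add: interleave_odd interleave_even a'_b solve)
      next
        case 4
        have "power_prod G 3 (three s t z) (braid_form j i) = inv (t \<otimes> t)"
          using p 4 by (simp add: power_prod_3[OF c] braid_form_def int_pow_minus_2)
        then show ?thesis using 4 p by (simp add: interleave_even a'_b' solve)
      qed
    qed
  qed (use c x y in \<open>auto simp del: atLeastAtMost_iff\<close>)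
qed

end

text \<open>The numbering read backwards. Applied to the Heisenberg product, it is the first step in
  showing that the model satisfies the braid relations.\<close>

lemma surface_braid_quotient_of_heisenberg:
  assumes "heisenberg_generators G 3 (2 * g) (2 * g) braid_form c x y"
  shows "surface_braid_quotient G g (c 1) (c 2) (c 3)
    (\<lambda>i. x (2 * i - 1)) (\<lambda>i. y (2 * i - 1)) (\<lambda>i. x (2 * i)) (\<lambda>i. y (2 * i))"
proof -
  interpret H: heisenberg_generators G 3 "2 * g" "2 * g" braid_form c x y by (rule assms)
  have c: "c k \<in> carrier G" if "k \<in> {1, 2, 3}" for k using H.c_closed that by (auto simp: atLeastAtMost_1_3)
  note [simp] = c[of 1, simplified] c[of 2, simplified] c[of 3, simplified]
  have mem: "2 * i - 1 \<in> {1..2 * g}" "2 * i \<in> {1..2 * g}" if "i \<in> {1..g}" for i using that by auto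
  have x: "x i \<in> carrier G" and y: "y i \<in> carrier G" if "i \<in> {1..2 * g}" for i
    using H.x_closed H.y_closed that by auto
  have solve: "u \<otimes>\<^bsub>G\<^esub> (inv\<^bsub>G\<^esub> u \<otimes>\<^bsub>G\<^esub> w) = w" if "u \<in> carrier G" "w \<in> carrier G" for u w
    using that by (simp flip: H.m_assoc)
  show ?thesis
  proof unfold_locales
    show "u \<otimes>\<^bsub>G\<^esub> w = w \<otimes>\<^bsub>G\<^esub> u" if "u \<in> {c 1, c 2, c 3}" "w \<in> carrier G" for u w
      using that H.c_central[of 1 w] H.c_central[of 2 w] H.c_central[of 3 w] by auto
    show "u \<otimes>\<^bsub>G\<^esub> w = w \<otimes>\<^bsub>G\<^esub> u"
      if "i \<in> {1..g}" "j \<in> {1..g}" "u \<in> {x (2 * i - 1), x (2 * i)}" "w \<in> {x (2 * j - 1), x (2 * j)}" for i j u w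
      using that mem[OF that(1)] mem[OF that(2)] by (blast intro: H.x_comm)
    show "u \<otimes>\<^bsub>G\<^esub> w = w \<otimes>\<^bsub>G\<^esub> u"
      if "i \<in> {1..g}" "j \<in> {1..g}" "u \<in> {y (2 * i - 1), y (2 * i)}" "w \<in> {y (2 * j - 1), y (2 * j)}" for i j u w
      using that mem[OF that(1)] mem[OF that(2)] by (blast intro: H.y_comm)
    have comm: "x i \<otimes>\<^bsub>G\<^esub> y j = y j \<otimes>\<^bsub>G\<^esub> x i"
      if "i \<in> {1..2 * g}" "j \<in> {1..2 * g}" "(i + 1) div 2 \<noteq> (j + 1) div 2" for i j
    proof -
      have "braid_form j i = (\<lambda>k. 0)" using that by (auto simp: braid_form_def)
      then show ?thesis using H.y_x[OF that(2,1)] x y that by (simp add: H.power_prod_zero[OF H.c_closed])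
    qed
    show "u \<otimes>\<^bsub>G\<^esub> w = w \<otimes>\<^bsub>G\<^esub> u"
      if "i \<in> {1..g}" "j \<in> {1..g}" "i \<noteq> j" "u \<in> {x (2 * i - 1), x (2 * i)}" "w \<in> {y (2 * j - 1), y
          (2 * j)}" for i j u w
    proof -
      have "(2 * i - 1 + 1) div 2 = i" "(2 * j - 1 + 1) div 2 = j" "(2 * i + 1) div 2 = i" "(2 * j +
          1) div 2 = j"
        using that by auto
      then show ?thesis using that comm mem[OF that(1)] mem[OF that(2)] by (elim insertE emptyE) simp_all
    qed
    fix p assume p: "p \<in> {1..g}"
    have [simp]: "2 * p \<noteq> 2 * p - 1" "2 * p - 1 \<noteq> 2 * p" using p by auto
    note m = mem[OF p]
    note [simp] = x[OF m(1)] x[OF m(2)] y[OF m(1)] y[OF m(2)]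
    have "power_prod G 3 c (braid_form (2 * p - 1) (2 * p - 1)) = inv\<^bsub>G\<^esub> (c 1 \<otimes>\<^bsub>G\<^esub> c 1)"
      using p by (simp add: H.power_prod_3[OF H.c_closed] braid_form_def H.int_pow_minus_2)
    then show "x (2 * p - 1) \<otimes>\<^bsub>G\<^esub> y (2 * p - 1) = c 1 \<otimes>\<^bsub>G\<^esub> c 1 \<otimes>\<^bsub>G\<^esub> (y (2 * p - 1) \<otimes>\<^bsub>G\<^esub> x (2 * p - 1))"
      unfolding H.y_x[OF m(1) m(1)] by (simp add: solve)
    have "power_prod G 3 c (braid_form (2 * p) (2 * p)) = inv\<^bsub>G\<^esub> (c 2 \<otimes>\<^bsub>G\<^esub> c 2)"
      using p by (simp add: H.power_prod_3[OF H.c_closed] braid_form_def H.int_pow_minus_2)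
    then show "x (2 * p) \<otimes>\<^bsub>G\<^esub> y (2 * p) = c 2 \<otimes>\<^bsub>G\<^esub> c 2 \<otimes>\<^bsub>G\<^esub> (y (2 * p) \<otimes>\<^bsub>G\<^esub> x (2 * p))"
      unfolding H.y_x[OF m(2) m(2)] by (simp add: solve)
    have "power_prod G 3 c (braid_form (2 * p - 1) (2 * p)) = inv\<^bsub>G\<^esub> c 3"
      using p by (simp add: H.power_prod_3[OF H.c_closed] braid_form_def H.int_pow_minus_1)
    then show "x (2 * p) \<otimes>\<^bsub>G\<^esub> y (2 * p - 1) = c 3 \<otimes>\<^bsub>G\<^esub> (y (2 * p - 1) \<otimes>\<^bsub>G\<^esub> x (2 * p))"
      unfolding H.y_x[OF m(1) m(2)] by (simp add: solve)
    have "power_prod G 3 c (braid_form (2 * p) (2 * p - 1)) = inv\<^bsub>G\<^esub> c 3"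
      using p by (simp add: H.power_prod_3[OF H.c_closed] braid_form_def H.int_pow_minus_1)
    then show "x (2 * p - 1) \<otimes>\<^bsub>G\<^esub> y (2 * p) = c 3 \<otimes>\<^bsub>G\<^esub> (y (2 * p) \<otimes>\<^bsub>G\<^esub> x (2 * p - 1))"
      unfolding H.y_x[OF m(2) m(1)] by (simp add: solve)
  qed (use mem x y in simp_all)
qed

lemma braid_form_nondegenerate:
  assumes "i \<in> {1..2 * g}"
  shows "\<exists>k\<in>{1..3}. braid_form i i k \<noteq> 0 \<and> (\<forall>j\<in>{1..2 * g} - {i}. braid_form i j k = 0 \<and> braid_form j i k = 0)"
proof -
  \<comment> \<open>The witness is the coordinate of \<sigma> for odd and of \<sigma>t for even
    indices; off the diagonal the form takes values only in the coordinate of \<zeta>.\<close>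
  have "(if odd i then 1 else 2 :: nat) \<in> {1..3}" by simp
  then show ?thesis by (rule bexI[rotated]) (auto simp: braid_form_def)
qed

section \<open>The three factors, the centre and the exponents under the normal form\<close>

context heisenberg_generators
begin

lemma normal_form_image:
  "normal_form ` ((carrier (int_power_group r) \<times> {\<one>\<^bsub>int_power_group s\<^esub>}) \<times> {\<one>\<^bsub>int_power_group t\<^esub>})
     = generate G (c ` {1..r})"
  "normal_form ` (({\<one>\<^bsub>int_power_group r\<^esub>} \<times> carrier (int_power_group s)) \<times> {\<one>\<^bsub>int_power_group t\<^esub>})
     = generate G (x ` {1..s})"
  "normal_form ` ({(\<one>\<^bsub>int_power_group r\<^esub>, \<one>\<^bsub>int_power_group s\<^esub>)} \<times> carrier (int_power_group t))
     = generate G (y ` {1..t})"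
proof -
  interpret R: group "int_power_group r" by simp
  interpret S: group "int_power_group s" by simp
  interpret T: group "int_power_group t" by simp
  \<comment> \<open>The three equations of \<open>normal_form_heisenberg\<close> share their three
    membership premises. Each line leaves one slot free and fills the others with units; of the nine
    resulting facts, numbers 1, 5 and 9 concern the free slot.\<close>
  note nf = normal_form_heisenberg[OF _ S.one_closed T.one_closed] normal_form_heisenberg[OF
      R.one_closed _ T.one_closed]
    normal_form_heisenberg[OF R.one_closed S.one_closed]
  have gen: "\<gamma> ` carrier (int_power_group r) = generate G (c ` {1..r})"
    "power_prod G s x ` carrier (int_power_group s) = generate G (x ` {1..s})"
    "power_prod G t y ` carrier (int_power_group t) = generate G (y ` {1..t})"
    by (rule power_prod_image[OF c_closed c_comm] power_prod_image[OF x_closed x_comm]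
        power_prod_image[OF y_closed y_comm]; assumption)+
  have 1: "(carrier (int_power_group r) \<times> {\<one>\<^bsub>int_power_group s\<^esub>}) \<times> {\<one>\<^bsub>int_power_group t\<^esub>}
      = heisenberg_c r s t ` carrier (int_power_group r)" by (auto simp: heisenberg_c_def)
  have 2: "({\<one>\<^bsub>int_power_group r\<^esub>} \<times> carrier (int_power_group s)) \<times> {\<one>\<^bsub>int_power_group t\<^esub>}
      = heisenberg_x r s t ` carrier (int_power_group s)" by (auto simp: heisenberg_x_def)
  have 3: "{(\<one>\<^bsub>int_power_group r\<^esub>, \<one>\<^bsub>int_power_group s\<^esub>)} \<times> carrier (int_power_group t)
      = heisenberg_y r s t ` carrier (int_power_group t)" by (auto simp: heisenberg_y_def)
  show "normal_form ` ((carrier (int_power_group r) \<times> {\<one>\<^bsub>int_power_group s\<^esub>}) \<times> {\<one>\<^bsub>int_power_group t\<^esub>})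
     = generate G (c ` {1..r})"
    unfolding 1 image_image gen(1)[symmetric] by (rule image_cong) (simp_all add: nf(1))
  show "normal_form ` (({\<one>\<^bsub>int_power_group r\<^esub>} \<times> carrier (int_power_group s)) \<times> {\<one>\<^bsub>int_power_group t\<^esub>})
     = generate G (x ` {1..s})"
    unfolding 2 image_image gen(2)[symmetric] by (rule image_cong) (simp_all add: nf(5))
  show "normal_form ` ({(\<one>\<^bsub>int_power_group r\<^esub>, \<one>\<^bsub>int_power_group s\<^esub>)} \<times> carrier (int_power_group t))
     = generate G (y ` {1..t})"
    unfolding 3 image_image gen(3)[symmetric] by (rule image_cong) (simp_all add: nf(9))
qed

end

lemma group_centre_iso_image:
  assumes "group H" and f: "f \<in> iso H G"
  shows "group_centre G = f ` group_centre H"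
proof -
  have hom: "f (u \<otimes>\<^bsub>H\<^esub> w) = f u \<otimes>\<^bsub>G\<^esub> f w" if "u \<in> carrier H" "w \<in> carrier H" for u w
    using f that by (simp add: iso_def hom_def)
  have bij: "inj_on f (carrier H)" "f ` carrier H = carrier G" using f by (auto simp: iso_def bij_betw_def)
  have "f u \<otimes>\<^bsub>G\<^esub> f w = f w \<otimes>\<^bsub>G\<^esub> f u \<longleftrightarrow> u \<otimes>\<^bsub>H\<^esub> w = w \<otimes>\<^bsub>H\<^esub> u" if "u \<in> carrier H" "w \<in> carrier H" for u w
    using that inj_onD[OF bij(1), of "u \<otimes>\<^bsub>H\<^esub> w" "w \<otimes>\<^bsub>H\<^esub> u"] monoid.m_closed[OF group.is_monoid[OF assms(1)]]
    by (auto simp flip: hom)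
  then show ?thesis unfolding group_centre_def bij(2)[symmetric] by auto
qed

lemma iso_on_image:
  assumes h: "h \<in> hom H G" and inj: "inj_on h (carrier H)"
  shows "H \<cong> G\<lparr>carrier := h ` carrier H\<rparr>"
proof -
  have "h \<in> iso H (G\<lparr>carrier := h ` carrier H\<rparr>)"
    using assms by (auto simp: iso_def hom_def bij_betw_def)
  then show ?thesis by (auto simp: is_iso_def)
qed

text \<open>Coordinates in the Heisenberg product of the exponents in the normal form. The
  restrictions make the families extensional, as members of the carrier must be.\<close>

definition exponents_encode where
  "exponents_encode g = (\<lambda>(p, q, r, m, mt, l, lt).
     ((\<lambda>k\<in>{1..3}. three p q r k, \<lambda>i\<in>{1..2 * g}. interleave m mt i),
      \<lambda>i\<in>{1..2 * g}. interleave l lt i))"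

text \<open>The ranks are specialised by equations because the locale keeps them general.\<close>

lemma (in heisenberg_generators) normal_form_encode:
  assumes rst: "r = 3" "s = 2 * g" "t = 2 * g"
  shows "normal_form (exponents_encode g (p, q, w, m, mt, l, lt)) =
    c 1 [^] p \<otimes> c 2 [^] q \<otimes> c 3 [^] w
     \<otimes> ordered_prod G g (\<lambda>i. x (2 * i - 1) [^] m i \<otimes> x (2 * i) [^] mt i)
     \<otimes> ordered_prod G g (\<lambda>i. y (2 * i - 1) [^] l i \<otimes> y (2 * i) [^] lt i)"
proof -
  have *: "power_prod G (2 * g) u (\<lambda>i\<in>{1..2 * g}. interleave m mt i) =
      ordered_prod G g (\<lambda>i. u (2 * i - 1) [^] m i \<otimes> u (2 * i) [^] mt i)"
    if "u \<in> {1..2 * g} \<rightarrow> carrier G" for u m mt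
  proof -
    have "power_prod G (2 * g) u (\<lambda>i\<in>{1..2 * g}. interleave m mt i) = power_prod G (2 * g) u (interleave m mt)"
      by (rule power_prod_cong) simp
    also have "\<dots> = ordered_prod G g (\<lambda>i. u (2 * i - 1) [^] interleave m mt (2 * i - 1) \<otimes> u (2 * i)
        [^] interleave m mt (2 * i))"
      unfolding power_prod_def by (rule ordered_prod_double) (use that in auto)
    also have "\<dots> = ordered_prod G g (\<lambda>i. u (2 * i - 1) [^] m i \<otimes> u (2 * i) [^] mt i)"
      by (rule ordered_prod_cong) (simp add: interleave_odd interleave_even)
    finally show ?thesis .
  qed
  have "\<gamma> (\<lambda>k\<in>{1..3}. three p q w k) = c 1 [^] p \<otimes> c 2 [^] q \<otimes> c 3 [^] w"
    using c_closed by (simp add: rst power_prod_3)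
  then show ?thesis
    using x_closed y_closed 
    unfolding exponents_encode_def normal_form_def prod.case unfolding rst by (simp add: *)
qed

text \<open>The exponent families have to be extensional: values outside \<open>{1..g}\<close> are
  lost in the encoding.\<close>

lemma bij_betw_exponents_encode:
  "bij_betw (exponents_encode g)
     {(p, q, r, m, mt, l, lt). {m, mt, l, lt} \<subseteq> {1..g} \<rightarrow>\<^sub>E (UNIV :: int set)}
     (carrier (heisenberg_product 3 (2 * g) (2 * g) e))"
proof -
  have odd_even: "\<exists>p\<in>{1..g}. i = 2 * p - 1 \<or> i = 2 * p" if "i \<in> {1..2 * g}" for i :: nat
    by (rule interleave_cases[OF that]) blast+
  have eq: "interleave (\<lambda>i\<in>{1..g}. u (2 * i - 1)) (\<lambda>i\<in>{1..g}. u (2 * i)) i = (u i :: int)" if i: "i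
      \<in> {1..2 * g}" for u i
    using odd_even[OF i] by (auto simp: interleave_odd interleave_even)
  \<comment> \<open>The inverse: odd positions give the exponents of the plain generators, even
    positions those of the generators with tilde.\<close>
  define dec :: "((nat \<Rightarrow> int) \<times> (nat \<Rightarrow> int)) \<times> (nat \<Rightarrow> int) \<Rightarrow> _" where
    "dec = (\<lambda>((z, m), h). (z 1, z 2, z 3, \<lambda>i\<in>{1..g}. m (2 * i - 1), \<lambda>i\<in>{1..g}. m (2 * i),
       \<lambda>i\<in>{1..g}. h (2 * i - 1), \<lambda>i\<in>{1..g}. h (2 * i)))"
  have ext: "(\<lambda>i\<in>{1..g}. restrict (interleave m mt) {1..2 * g} (2 * i - 1)) = m"
    "(\<lambda>i\<in>{1..g}. restrict (interleave m' m) {1..2 * g} (2 * i)) = m"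
    if "m \<in> {1..g} \<rightarrow>\<^sub>E (UNIV :: int set)" for m m' mt
    using that by (auto simp: fun_eq_iff interleave_odd interleave_even PiE_def extensional_def)
  show ?thesis
  proof (rule bij_betw_byWitness[where f' = dec])
    show "\<forall>v\<in>{(p, q, r, m, mt, l, lt). {m, mt, l, lt} \<subseteq> {1..g} \<rightarrow>\<^sub>E (UNIV :: int set)}.
        dec (exponents_encode g v) = v"
      by (clarsimp simp only: exponents_encode_def dec_def prod.case mem_Collect_eq insert_subset ext)
        (simp add: ext[simplified restrict_apply])
    show "\<forall>w\<in>carrier (heisenberg_product 3 (2 * g) (2 * g) e). exponents_encode g (dec w) = w"
    proof clarify
      fix z m h assume w: "((z, m), h) \<in> carrier (heisenberg_product 3 (2 * g) (2 * g) e)"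
      have "(\<lambda>k\<in>{1..3}. three (z 1) (z 2) (z 3) k) = z"
        using w by (auto simp: fun_eq_iff carrier_heisenberg_product carrier_int_power_group PiE_def
            extensional_def atLeastAtMost_1_3)
      moreover have "(\<lambda>i\<in>{1..2 * g}. interleave (\<lambda>i\<in>{1..g}. u (2 * i - 1)) (\<lambda>i\<in>{1..g}. u (2 * i)) i) = u"
        if "u \<in> carrier (int_power_group (2 * g))" for u
      proof
        fix i
        show "restrict (interleave (\<lambda>i\<in>{1..g}. u (2 * i - 1)) (\<lambda>i\<in>{1..g}. u (2 * i))) {1..2 * g} i = u i"
          using that eq[of i u]
          by (cases "i \<in> {1..2 * g}") (auto simp: carrier_int_power_group PiE_def extensional_def)
      qed
      ultimately show "exponents_encode g (dec ((z, m), h)) = ((z, m), h)"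
        using w by (simp add: exponents_encode_def dec_def carrier_heisenberg_product)
    qed
    show "exponents_encode g ` {(p, q, r, m, mt, l, lt). {m, mt, l, lt} \<subseteq> {1..g} \<rightarrow>\<^sub>E (UNIV :: int set)}
        \<subseteq> carrier (heisenberg_product 3 (2 * g) (2 * g) e)"
      by (auto simp: exponents_encode_def carrier_heisenberg_product)
    show "dec ` carrier (heisenberg_product 3 (2 * g) (2 * g) e)
        \<subseteq> {(p, q, r, m, mt, l, lt). {m, mt, l, lt} \<subseteq> {1..g} \<rightarrow>\<^sub>E (UNIV :: int set)}"
      by (auto simp: dec_def)
  qed
qed

section \<open>The quotient by the third term of the lower central series\<close>

lemma word_eval_cong:
  "(\<And>x e. (x, e) \<in> set w \<Longrightarrow> v x = v' x) \<Longrightarrow> word_eval G v w = word_eval G v' w"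
  unfolding word_eval_def by (rule foldr_cong) auto

abbreviation (input) letter :: "('i \<Rightarrow> 'x) \<Rightarrow> 'i \<Rightarrow> 'x gword" where
  "letter f \<equiv> \<lambda>i. [(f i, True)]"

lemma braid_relations_eq:
  "braid_relations k n g =
     surface_relations k g (letter Sig) (letter A) (letter B)
     \<union> zeta_relations k n g (letter Sig) (letter A) (letter B) (letter Zeta)
     \<union> surface_relations n g (letter Sigt) (letter At) (letter Bt)
     \<union> mixed_relations k n g (letter Sig) (letter Sigt) (letter A) (letter B) (letter At) (letter
         Bt) (letter Zeta)"
  by (simp add: braid_relations_def Let_def)

text \<open>The rule \<open>relation\<close> of \<open>word_eq\<close> applies only to words over
  the alphabet. Several families mention \<sigma>_1 or \<sigma>t_1 without restricting an index, so
  these letters must exist, hence the bounds.\<close>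

lemma braid_relations_lists:
  assumes "(l, r) \<in> braid_relations k n g" "k \<ge> 2" "n \<ge> 2"
  shows "l \<in> lists (braid_gens k n g \<times> UNIV) \<and> r \<in> lists (braid_gens k n g \<times> UNIV)"
proof -
  have gens: "Sig i \<in> braid_gens k n g \<longleftrightarrow> i \<in> {1..<k}" "Sigt i \<in> braid_gens k n g \<longleftrightarrow> i \<in> {1..<n}"
    "Zeta i \<in> braid_gens k n g \<longleftrightarrow> i \<in> {1..n}"
    "A i \<in> braid_gens k n g \<longleftrightarrow> i \<in> {1..g}" "B i \<in> braid_gens k n g \<longleftrightarrow> i \<in> {1..g}"
    "At i \<in> braid_gens k n g \<longleftrightarrow> i \<in> {1..g}" "Bt i \<in> braid_gens k n g \<longleftrightarrow> i \<in> {1..g}" for i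
    by (auto simp: braid_gens_def)
  have one: "1 < k" "1 < n" "1 \<le> n" using assms by auto
  from assms(1) show ?thesis
    unfolding braid_relations_eq
  proof (elim UnE, goal_cases)
    case 1
    then show ?case
      unfolding surface_relations_def
      by (elim UnE) (auto simp: word_conj_def word_inv_def gens one)
  next
    case 2
    then show ?case
      unfolding zeta_relations_def
      by (elim UnE) (auto simp: word_conj_def word_inv_def gens one)
  next
    case 3
    then show ?case
      unfolding surface_relations_def
      by (elim UnE) (auto simp: word_conj_def word_inv_def gens one)
  next
    case 4
    then show ?case
      unfolding mixed_relations_def
      by (elim UnE) (auto simp: word_conj_def word_inv_def word_commutator_def gens one)
  qed
qed

lemma bij_betw_imp_ex1: "bij_betw f V U \<Longrightarrow> u \<in> U \<Longrightarrow> \<exists>!v. v \<in> V \<and> f v = u"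
  unfolding bij_betw_def by (metis imageE inj_onD)

lemma ex1_iff_ex1: "\<exists>!v. R v \<Longrightarrow> (\<And>v. P v \<longleftrightarrow> R v) \<Longrightarrow> \<exists>!v. P v"
  by simp

lemma interleave_eqI:
  fixes g :: nat
  assumes "i \<in> {1..2 * g}"
    and odd: "\<And>p. p \<in> {1..g} \<Longrightarrow> F (u p) = E (2 * p - 1)"
    and even: "\<And>p. p \<in> {1..g} \<Longrightarrow> F (u' p) = E (2 * p)"
  shows "F (interleave u u' i) = E i"
proof (rule interleave_cases[OF assms(1)])
  fix p assume "p \<in> {1..g}" "i = 2 * p - 1"
  then show ?thesis using odd[of p] interleave_odd[of p u u'] by simp
next
  fix p assume "p \<in> {1..g}" "i = 2 * p"
  then show ?thesis using even[of p] interleave_even[of u u' p] by simp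
qed

lemma braid_gens_image:
  "v ` braid_gens k n g = v ` Sig ` {1..<k} \<union> v ` Sigt ` {1..<n} \<union> v ` A ` {1..g} \<union> v ` B ` {1..g}
     \<union> v ` At ` {1..g} \<union> v ` Bt ` {1..g} \<union> v ` Zeta ` {1..n}"
  by (simp add: braid_gens_def image_Un)

text \<open>Allows a change of the families outside \<open>{1..g}\<close>, where a valuation
  extended by a default value differs from the images of the generators.\<close>

lemma surface_braid_quotient_cong:
  assumes "surface_braid_quotient G g s t z a b a' b'"
    and "s = S" "t = T" "z = Z" and "\<And>i. i \<in> {1..g} \<Longrightarrow> a i = d i" "\<And>i. i \<in> {1..g} \<Longrightarrow> b i = f i"
    "\<And>i. i \<in> {1..g} \<Longrightarrow> a' i = d' i" "\<And>i. i \<in> {1..g} \<Longrightarrow> b' i = f' i"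
  shows "surface_braid_quotient G g S T Z d f d' f'"
proof -
  interpret surface_braid_quotient G g s t z a b a' b' by (rule assms(1))
  show ?thesis
    unfolding assms(2-4)[symmetric]
  proof unfold_locales
    fix u w assume "u \<in> {s, t, z}" "w \<in> carrier G" then show "u \<otimes>\<^bsub>G\<^esub> w = w \<otimes>\<^bsub>G\<^esub> u" by (rule central)
  next
    fix i j u w assume "i \<in> {1..g}" "j \<in> {1..g}" "u \<in> {d i, d' i}" "w \<in> {d j, d' j}"
    then show "u \<otimes>\<^bsub>G\<^esub> w = w \<otimes>\<^bsub>G\<^esub> u" using aa[of i j u w] by (simp only: assms(5-8) simp_thms)
  next
    fix i j u w assume "i \<in> {1..g}" "j \<in> {1..g}" "u \<in> {f i, f' i}" "w \<in> {f j, f' j}"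
    then show "u \<otimes>\<^bsub>G\<^esub> w = w \<otimes>\<^bsub>G\<^esub> u" using bb[of i j u w] by (simp only: assms(5-8) simp_thms)
  next
    fix i j u w assume "i \<in> {1..g}" "j \<in> {1..g}" "i \<noteq> j" "u \<in> {d i, d' i}" "w \<in> {f j, f' j}"
    then show "u \<otimes>\<^bsub>G\<^esub> w = w \<otimes>\<^bsub>G\<^esub> u" using ab[of i j u w] by (simp only: assms(5-8) simp_thms)
  next
    fix i assume i: "i \<in> {1..g}"
    show "d i \<otimes>\<^bsub>G\<^esub> f i = s \<otimes>\<^bsub>G\<^esub> s \<otimes>\<^bsub>G\<^esub> (f i \<otimes>\<^bsub>G\<^esub> d i)" using a_b[OF i] i by (simp only: assms(5-8))
    show "d' i \<otimes>\<^bsub>G\<^esub> f' i = t \<otimes>\<^bsub>G\<^esub> t \<otimes>\<^bsub>G\<^esub> (f' i \<otimes>\<^bsub>G\<^esub> d' i)" using a'_b'[OF i] i by (simp only: assms(5-8))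
    show "d' i \<otimes>\<^bsub>G\<^esub> f i = z \<otimes>\<^bsub>G\<^esub> (f i \<otimes>\<^bsub>G\<^esub> d' i)" using a'_b[OF i] i by (simp only: assms(5-8))
    show "d i \<otimes>\<^bsub>G\<^esub> f' i = z \<otimes>\<^bsub>G\<^esub> (f' i \<otimes>\<^bsub>G\<^esub> d i)" using a_b'[OF i] i by (simp only: assms(5-8))
    show "d i \<in> carrier G" "d' i \<in> carrier G" "f i \<in> carrier G" "f' i \<in> carrier G"
      using a_closed[OF i] b_closed[OF i] i by (simp_all only: assms(5-8))
  qed (rule central_closed)+
qed

section \<open>From the presentation to the Heisenberg product and back\<close>

fun heisenberg_valuation :: "nat \<Rightarrow> braid_gen \<Rightarrow> ((nat \<Rightarrow> int) \<times> (nat \<Rightarrow> int)) \<times> (nat \<Rightarrow> int)" where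
  "heisenberg_valuation g (Sig i) = heisenberg_c 3 (2 * g) (2 * g) (int_unit 3 1)"
| "heisenberg_valuation g (Sigt i) = heisenberg_c 3 (2 * g) (2 * g) (int_unit 3 2)"
| "heisenberg_valuation g (Zeta i) = heisenberg_c 3 (2 * g) (2 * g) (int_unit 3 3)"
| "heisenberg_valuation g (A i) = heisenberg_x 3 (2 * g) (2 * g) (int_unit (2 * g) (2 * i - 1))"
| "heisenberg_valuation g (At i) = heisenberg_x 3 (2 * g) (2 * g) (int_unit (2 * g) (2 * i))"
| "heisenberg_valuation g (B i) = heisenberg_y 3 (2 * g) (2 * g) (int_unit (2 * g) (2 * i - 1))"
| "heisenberg_valuation g (Bt i) = heisenberg_y 3 (2 * g) (2 * g) (int_unit (2 * g) (2 * i))"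

abbreviation braid_heisenberg where
  "braid_heisenberg g \<equiv> heisenberg_product 3 (2 * g) (2 * g) braid_form"

text \<open>The premise of von Dyck's theorem for the map from the presented group to the
  model.\<close>

lemma braid_relations_heisenberg:
  assumes "(l, r) \<in> braid_relations k n g"
  shows "word_eval (braid_heisenberg g) (heisenberg_valuation g) l
    = word_eval (braid_heisenberg g) (heisenberg_valuation g) r"
proof -
  interpret group "braid_heisenberg g" by (rule group_heisenberg_product)
  have closed: "heisenberg_valuation g x \<in> carrier (braid_heisenberg g)" for x
    by (cases x) (simp_all add: hom_in_carrier[OF heisenberg_c_hom] hom_in_carrier[OF heisenberg_x_hom]
        hom_in_carrier[OF heisenberg_y_hom])
  then interpret word_valuation "braid_heisenberg g" "heisenberg_valuation g" by unfold_locales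
  have ev: "ev (letter f i) = heisenberg_valuation g (f i)" for f :: "nat \<Rightarrow> braid_gen" and i by
      (simp add: closed)
  have "surface_braid_quotient (braid_heisenberg g) g
      (heisenberg_c 3 (2 * g) (2 * g) (int_unit 3 1)) (heisenberg_c 3 (2 * g) (2 * g) (int_unit 3 2))
      (heisenberg_c 3 (2 * g) (2 * g) (int_unit 3 3))
      (\<lambda>i. ev (letter A i)) (\<lambda>i. ev (letter B i)) (\<lambda>i. ev (letter At i)) (\<lambda>i. ev (letter Bt i))"
    using surface_braid_quotient_of_heisenberg[OF heisenberg_product_generators[of 3 "2 * g" "2 * g"
        braid_form]]
    by (simp only: ev heisenberg_valuation.simps)
  from braid_relations_satisfied[OF this, where s = "letter Sig" and s' = "letter Sigt" and z = "letter Zeta"]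
  have "satisfies (braid_relations k n g)"
    unfolding braid_relations_eq by (simp only: satisfies_Un ev heisenberg_valuation.simps simp_thms)
  then show ?thesis using assms by (rule satisfiesD)
qed

text \<open>Stated for an arbitrary group isomorphic to the presented one; the surface enters only
  through such an isomorphism. The derived relations make Q a quotient of the model, and the map
  from Q to the model induced by the presentation excludes any further collapse.\<close>

lemma braid_quotient_structure:
  assumes k: "k \<ge> 3" and n: "n \<ge> 3" and G: "group G"
    and \<phi>: "\<phi> \<in> iso (presented_group (braid_gens k n g) (braid_relations k n g)) G"
  defines "Q \<equiv> G Mod lower_central G 3"
  defines "im \<equiv> \<lambda>x. lower_central G 3 #>\<^bsub>G\<^esub> \<phi> (braid_gen_class k n g x)"
  defines "c \<equiv> three (im (Sig 1)) (im (Sigt 1)) (im (Zeta 1))"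
    and "x \<equiv> interleave (\<lambda>i. im (A i)) (\<lambda>i. im (At i))"
    and "y \<equiv> interleave (\<lambda>i. im (B i)) (\<lambda>i. im (Bt i))"
  shows "\<And>i. i \<in> {1..<k} \<Longrightarrow> im (Sig i) = im (Sig 1)"
    and "\<And>i. i \<in> {1..<n} \<Longrightarrow> im (Sigt i) = im (Sigt 1)"
    and "\<And>i. i \<in> {1..n} \<Longrightarrow> im (Zeta i) = im (Zeta 1)"
    and "heisenberg_generators Q 3 (2 * g) (2 * g) braid_form c x y"
    and "heisenberg_generators.normal_form Q 3 (2 * g) (2 * g) c x y \<in> iso (braid_heisenberg g) Q"
proof -
  let ?Y = "braid_gens k n g" and ?R = "braid_relations k n g"
  let ?P = "presented_group ?Y ?R" and ?N = "lower_central G 3"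
  interpret P: group ?P by (rule group_presented_group)
  interpret G: group G by (rule G)
  interpret N: normal ?N G by (rule G.lower_central_normal)
  have Q: "group Q" unfolding Q_def by (rule N.factorgroup_is_group)
  interpret Q: group Q by (rule Q)
  have \<phi>_hom: "\<phi> \<in> hom ?P G" using \<phi> by (simp add: iso_def)
  define h where "h C = ?N #>\<^bsub>G\<^esub> \<phi> C" for C
  have h: "h \<in> hom ?P Q"
    using hom_compose[OF \<phi>_hom N.r_coset_hom_Mod] by (simp add: h_def[abs_def] Q_def comp_def)
  have im: "im x = h (word_class ?Y ?R [(x, True)])" for x by (simp add: im_def h_def braid_gen_class_def)
  have class_closed: "word_class ?Y ?R [(x, True)] \<in> carrier ?P" if "x \<in> ?Y" for x
    unfolding carrier_presented_group using that by (intro imageI) simp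
  \<comment> \<open>The default value one makes the valuation total; letters outside the alphabet
    need not have images in the carrier.\<close>
  define v where "v x = (if x \<in> ?Y then im x else \<one>\<^bsub>Q\<^esub>)" for x
  have v_closed: "v x \<in> carrier Q" for x
    using hom_in_carrier[OF h class_closed] by (simp add: v_def im)
  interpret V: word_valuation Q v using v_closed by unfold_locales
  have ev_eq: "V.ev w = h (word_class ?Y ?R w)" if w: "w \<in> lists (?Y \<times> UNIV)" for w
  proof -
    have "V.ev w = word_eval Q im w" using w by (intro word_eval_cong) (auto simp: v_def)
    also have "\<dots> = h (word_eval ?P (\<lambda>x. word_class ?Y ?R [(x, True)]) w)"
      unfolding im[abs_def] using class_closed
      by (intro hom_word_eval[OF h P.is_group Q _ w, symmetric]) auto
    finally show ?thesis by (simp only: word_eval_presented_group[OF w])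
  qed
  have sat: "V.satisfies ?R"
    unfolding V.satisfies_def
  proof clarify
    fix l r assume lr: "(l, r) \<in> ?R"
    then have L: "l \<in> lists (?Y \<times> UNIV)" "r \<in> lists (?Y \<times> UNIV)"
      using braid_relations_lists[of l r k n g] k n by simp_all
    \<comment> \<open>A single application of a relation, with empty words on both sides.\<close>
    have "word_class ?Y ?R l = word_class ?Y ?R r"
      using word_eq.relation[of "[]" ?Y "[]" l r ?R] lr L by (simp add: word_class_eq_iff)
    then show "V.ev l = V.ev r" using L by (simp only: ev_eq)
  qed
  have ev: "V.ev (letter f i) = v (f i)" for f :: "nat \<Rightarrow> braid_gen" and i by (simp add: v_closed)
  \<comment> \<open>As \<open>\<phi>\<close> is onto and every class is the value of its own word,
    the images of the letters generate.\<close>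
  have gen: "carrier Q = generate Q (v ` ?Y)"
  proof
    show "generate Q (v ` ?Y) \<subseteq> carrier Q" by (rule Q.generate_incl) (use v_closed in auto)
    show "carrier Q \<subseteq> generate Q (v ` ?Y)"
    proof
      fix u assume "u \<in> carrier Q"
      then obtain a where a: "a \<in> carrier G" "u = ?N #>\<^bsub>G\<^esub> a" by (auto simp: Q_def FactGroup_def RCOSETS_def)
      then obtain C where "C \<in> carrier ?P" "a = \<phi> C" using \<phi> by (auto simp: iso_def bij_betw_def)
      then obtain w where w: "w \<in> lists (?Y \<times> UNIV)" "a = \<phi> (word_class ?Y ?R w)"
        unfolding carrier_presented_group by blast
      then have "u = V.ev w" by (simp only: ev_eq a h_def)
      then show "u \<in> generate Q (v ` ?Y)"
        using Q.word_eval_in_generate[of v ?Y w] v_closed w by blast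
    qed
  qed
  have class2: "\<forall>x\<in>carrier Q. \<forall>y\<in>carrier Q. \<forall>u\<in>carrier Q.
      (x \<otimes>\<^bsub>Q\<^esub> y \<otimes>\<^bsub>Q\<^esub> inv\<^bsub>Q\<^esub> x \<otimes>\<^bsub>Q\<^esub> inv\<^bsub>Q\<^esub> y) \<otimes>\<^bsub>Q\<^esub> u = u \<otimes>\<^bsub>Q\<^esub> (x \<otimes>\<^bsub>Q\<^esub> y \<otimes>\<^bsub>Q\<^esub> inv\<^bsub>Q\<^esub> x \<otimes>\<^bsub>Q\<^esub> inv\<^bsub>Q\<^esub> y)"
    unfolding Q_def using G.FactGroup_lower_central_3_class2 by blast
  have "V.ev ` (letter Sig ` {1..<k} \<union> letter Sigt ` {1..<n} \<union> letter A ` {1..g} \<union> letter B ` {1..g}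
      \<union> letter At ` {1..g} \<union> letter Bt ` {1..g} \<union> letter Zeta ` {1..n}) = v ` ?Y"
    unfolding braid_gens_image by (simp only: image_Un image_image ev)
  then have gen': "carrier Q = generate Q (V.ev ` (letter Sig ` {1..<k} \<union> letter Sigt ` {1..<n} \<union>
      letter A ` {1..g} \<union> letter B ` {1..g}
      \<union> letter At ` {1..g} \<union> letter Bt ` {1..g} \<union> letter Zeta ` {1..n}))"
    using gen by simp
  have sats: "V.satisfies (surface_relations k g (letter Sig) (letter A) (letter B))"
    "V.satisfies (surface_relations n g (letter Sigt) (letter At) (letter Bt))"
    "V.satisfies (zeta_relations k n g (letter Sig) (letter A) (letter B) (letter Zeta))"
    "V.satisfies (mixed_relations k n g (letter Sig) (letter Sigt) (letter A) (letter B) (letter At)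
        (letter Bt) (letter Zeta))"
    using sat unfolding braid_relations_eq by simp_all
  note sbq = V.surface_braid_quotientI[OF k n sats class2 gen', unfolded ev]
  have v: "v x = im x" if "x \<in> ?Y" for x using that by (simp add: v_def)
  have Y: "Sig i \<in> ?Y \<longleftrightarrow> i \<in> {1..<k}" "Sigt i \<in> ?Y \<longleftrightarrow> i \<in> {1..<n}" "Zeta i \<in> ?Y \<longleftrightarrow> i \<in> {1..n}"
    "A i \<in> ?Y \<longleftrightarrow> i \<in> {1..g}" "B i \<in> ?Y \<longleftrightarrow> i \<in> {1..g}" "At i \<in> ?Y \<longleftrightarrow> i \<in> {1..g}" "Bt i \<in> ?Y \<longleftrightarrow> i \<in> {1..g}" for i
    by (auto simp: braid_gens_def)
  have v1: "v (Sig 1) = im (Sig 1)" "v (Sigt 1) = im (Sigt 1)" "v (Zeta 1) = im (Zeta 1)"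
    using k n by (simp_all add: v Y)
  show s: "im (Sig i) = im (Sig 1)" if "i \<in> {1..<k}" for i 
    using sbq(2)[OF that] that by (simp only: v1 v Y)
  show t: "im (Sigt i) = im (Sigt 1)" if "i \<in> {1..<n}" for i 
    using sbq(3)[OF that] that by (simp only: v1 v Y)
  show z: "im (Zeta i) = im (Zeta 1)" if "i \<in> {1..n}" for i 
    using sbq(4)[OF that] that by (simp only: v1 v Y)
  have "surface_braid_quotient Q g (im (Sig 1)) (im (Sigt 1)) (im (Zeta 1))
      (\<lambda>i. im (A i)) (\<lambda>i. im (B i)) (\<lambda>i. im (At i)) (\<lambda>i. im (Bt i))"
    using sbq(1) by (rule surface_braid_quotient_cong) (simp_all only: v1 v Y)
  then show H: "heisenberg_generators Q 3 (2 * g) (2 * g) braid_form c x y"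
    unfolding c_def x_def y_def by (rule surface_braid_quotient.heisenberg_generators)
  interpret H: heisenberg_generators Q 3 "2 * g" "2 * g" braid_form c x y by (rule H)
  have W: "group (braid_heisenberg g)" by (rule group_heisenberg_product)
  have val: "heisenberg_valuation g \<in> ?Y \<rightarrow> carrier (braid_heisenberg g)"
  proof
    fix x show "heisenberg_valuation g x \<in> carrier (braid_heisenberg g)"
      by (cases x) (simp_all add: hom_in_carrier[OF heisenberg_c_hom] hom_in_carrier[OF heisenberg_x_hom]
        hom_in_carrier[OF heisenberg_y_hom])
  qed
  obtain h' where h': "h' \<in> hom ?P (braid_heisenberg g)"
    "\<And>x. x \<in> ?Y \<Longrightarrow> h' (word_class ?Y ?R [(x, True)]) = heisenberg_valuation g x"
    by (rule presented_group_hom_exists[OF W val braid_relations_heisenberg], assumption, rule that)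
  have inv: "inv_into (carrier ?P) \<phi> \<in> hom G ?P" using P.iso_set_sym[OF \<phi>] by (simp add: iso_def)
  \<comment> \<open>Von Dyck's map precomposed with the inverse of \<open>\<phi>\<close>. It kills
    the third term of the lower central series because the model has class two, and so it descends
    to the homomorphism \<open>f\<close> on Q.\<close>
  define \<psi> where "\<psi> = h' \<circ> inv_into (carrier ?P) \<phi>"
  have \<psi>: "\<psi> \<in> hom G (braid_heisenberg g)" unfolding \<psi>_def using inv h'(1) by (rule hom_compose)
  have \<psi>_\<phi>: "\<psi> (\<phi> C) = h' C" if "C \<in> carrier ?P" for C
    using that \<phi> by (simp add: \<psi>_def iso_def bij_betw_def)
  have "\<psi> ` ?N \<subseteq> {\<one>\<^bsub>braid_heisenberg g\<^esub>}"
    using heisenberg_product_class2 by (intro G.hom_vanishes_on_lower_central_3[OF W \<psi>])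
  then obtain f where f: "f \<in> hom Q (braid_heisenberg g)" "\<And>a. a \<in> carrier G \<Longrightarrow> f (?N #>\<^bsub>G\<^esub> a) = \<psi> a"
    using N.FactGroup_hom_exists[OF W \<psi>] unfolding Q_def by blast
  have f_im: "f (im x) = heisenberg_valuation g x" if "x \<in> ?Y" for x
    using class_closed[OF that] h'(2)[OF that] hom_in_carrier[OF \<phi>_hom class_closed[OF that]]
    by (simp only: im h_def f(2) \<psi>_\<phi>)
  show "H.normal_form \<in> iso (braid_heisenberg g) Q"
  proof (rule H.normal_form_iso[OF _ f(1)])
    \<comment> \<open>The alphabet has many letters for each of \<sigma>, \<sigma>t and \<zeta>, but
      their images coincide, so three central generators suffice.\<close>
    have gens_sub: "v ` ?Y \<subseteq> c ` {1..3} \<union> x ` {1..2 * g} \<union> y ` {1..2 * g}"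
      unfolding c_def x_def y_def three_image interleave_image
    proof
      fix u assume "u \<in> v ` ?Y"
      then obtain p where p: "p \<in> ?Y" "u = im p" by (auto simp: v)
      show "u \<in> {im (Sig 1), im (Sigt 1), im (Zeta 1)} \<union> (\<Union>i\<in>{1..g}. {im (A i), im (At i)})
          \<union> (\<Union>i\<in>{1..g}. {im (B i), im (Bt i)})"
      proof (cases p)
        case (Sig i)
        then have "u = im (Sig 1)" using p s[of i] by (simp only: Y)
        then show ?thesis by blast
      next
        case (Sigt i)
        then have "u = im (Sigt 1)" using p t[of i] by (simp only: Y)
        then show ?thesis by blast
      next
        case (Zeta i)
        then have "u = im (Zeta 1)" using p z[of i] by (simp only: Y)
        then show ?thesis by blast
      next
        case (A i)
        then have "i \<in> {1..g}" using p(1) by (simp only: Y)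
        then show ?thesis unfolding p(2) A by blast
      next
        case (B i)
        then have "i \<in> {1..g}" using p(1) by (simp only: Y)
        then show ?thesis unfolding p(2) B by blast
      next
        case (At i)
        then have "i \<in> {1..g}" using p(1) by (simp only: Y)
        then show ?thesis unfolding p(2) At by blast
      next
        case (Bt i)
        then have "i \<in> {1..g}" using p(1) by (simp only: Y)
        then show ?thesis unfolding p(2) Bt by blast
      qed
    qed
    have "c ` {1..3} \<union> x ` {1..2 * g} \<union> y ` {1..2 * g} \<subseteq> carrier Q"
      using H.c_closed H.x_closed H.y_closed by blast
    note sub = this
    have "carrier Q \<subseteq> generate Q (c ` {1..3} \<union> x ` {1..2 * g} \<union> y ` {1..2 * g})"
      using Q.mono_generate[OF gens_sub] by (simp only: gen)
    moreover have "generate Q (c ` {1..3} \<union> x ` {1..2 * g} \<union> y ` {1..2 * g}) \<subseteq> carrier Q"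
      by (rule Q.generate_incl[OF sub])
    ultimately show "carrier Q = generate Q (c ` {1..3} \<union> x ` {1..2 * g} \<union> y ` {1..2 * g})" by (rule equalityI)
    show "f (c j) = heisenberg_c 3 (2 * g) (2 * g) (int_unit 3 j)" if "j \<in> {1..3}" for j
    proof -
      have "Sig 1 \<in> ?Y" "Sigt 1 \<in> ?Y" "Zeta 1 \<in> ?Y" using k n by (simp_all add: Y)
      moreover have "j = 1 \<or> j = 2 \<or> j = 3" using that by auto
      ultimately show ?thesis by (elim disjE) (simp_all only: c_def three_simps f_im heisenberg_valuation.simps)
    qed
    show "f (x i) = heisenberg_x 3 (2 * g) (2 * g) (int_unit (2 * g) i)" if "i \<in> {1..2 * g}" for i
      unfolding x_def by (rule interleave_eqI[OF that]) (simp_all only: f_im Y heisenberg_valuation.simps)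
    show "f (y i) = heisenberg_y 3 (2 * g) (2 * g) (int_unit (2 * g) i)" if "i \<in> {1..2 * g}" for i
      unfolding y_def by (rule interleave_eqI[OF that]) (simp_all only: f_im Y heisenberg_valuation.simps)
  qed
qed

text \<open>Uniqueness of exponents ranges over extensional families, as only values on
  \<open>{1..g}\<close> affect the products. In the last part, generation and freeness of the centre
  are separate clauses: the first comes from the image of Z^3 in Q, the second from injectivity of
  that map.\<close>

theorem corollary3p9:
  fixes S :: "'a topology" and k n g :: nat and x0 :: "(nat \<Rightarrow> 'a) set"
    and \<phi> :: "braid_gen gword set \<Rightarrow> (real \<Rightarrow> (nat \<Rightarrow> 'a) set) set"
  assumes "k \<ge> 3" and "n \<ge> 3" and "g \<ge> 1"
    and surface: "genus_surface_one_boundary g S"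
    and basepoint: "x0 \<in> topspace (orbit_configuration_space k n S)"
    and presentation:
      "\<phi> \<in> iso (presented_group (braid_gens k n g) (braid_relations k n g))
             (surface_braid_group k n S x0)"
  defines "G \<equiv> surface_braid_group k n S x0"
  defines "Q \<equiv> G Mod lower_central G 3"
  defines "im \<equiv> \<lambda>x. lower_central G 3 #>\<^bsub>G\<^esub> \<phi> (braid_gen_class k n g x)"
  shows "\<exists>\<sigma> \<sigma>t \<zeta>.
    (\<forall>i\<in>{1..<k}. im (Sig i) = \<sigma>) \<and> (\<forall>i\<in>{1..<n}. im (Sigt i) = \<sigma>t) \<and> (\<forall>i\<in>{1..n}. im (Zeta i) = \<zeta>) \<and>
    (\<exists>\<theta> f.
       \<theta> \<in> hom (int_power_group (2 * g)) (AutoGroup (int_power_group 3 \<times>\<times> int_power_group (2 * g))) \<and>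
       f \<in> iso (semidirect_product (int_power_group 3 \<times>\<times> int_power_group (2 * g))
                  (int_power_group (2 * g)) \<theta>) Q \<and>
       f ` ((carrier (int_power_group 3) \<times> {\<one>\<^bsub>int_power_group (2 * g)\<^esub>})
              \<times> {\<one>\<^bsub>int_power_group (2 * g)\<^esub>}) = generate Q {\<sigma>, \<sigma>t, \<zeta>} \<and>
       f ` (({\<one>\<^bsub>int_power_group 3\<^esub>} \<times> carrier (int_power_group (2 * g)))
              \<times> {\<one>\<^bsub>int_power_group (2 * g)\<^esub>}) = generate Q (\<Union>i\<in>{1..g}. {im (A i), im (At i)}) \<and>
       f ` ({(\<one>\<^bsub>int_power_group 3\<^esub>, \<one>\<^bsub>int_power_group (2 * g)\<^esub>)}
              \<times> carrier (int_power_group (2 * g))) = generate Q (\<Union>i\<in>{1..g}. {im (B i), im (Bt i)})) \<and>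
    (\<forall>\<gamma>\<in>carrier Q. \<exists>!v.
       case v of (p, q, r, m, mt, l, lt) \<Rightarrow>
         {m, mt, l, lt} \<subseteq> {1..g} \<rightarrow>\<^sub>E (UNIV :: int set) \<and>
         \<gamma> = \<sigma> [^]\<^bsub>Q\<^esub> (p :: int) \<otimes>\<^bsub>Q\<^esub> \<sigma>t [^]\<^bsub>Q\<^esub> (q :: int) \<otimes>\<^bsub>Q\<^esub> \<zeta> [^]\<^bsub>Q\<^esub> (r :: int)
             \<otimes>\<^bsub>Q\<^esub> ordered_prod Q g (\<lambda>i. im (A i) [^]\<^bsub>Q\<^esub> m i \<otimes>\<^bsub>Q\<^esub> im (At i) [^]\<^bsub>Q\<^esub> mt i)
             \<otimes>\<^bsub>Q\<^esub> ordered_prod Q g (\<lambda>i. im (B i) [^]\<^bsub>Q\<^esub> l i \<otimes>\<^bsub>Q\<^esub> im (Bt i) [^]\<^bsub>Q\<^esub> lt i)) \<and>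
    (group_centre Q = generate Q {\<sigma>, \<sigma>t, \<zeta>} \<and>
     Q\<lparr>carrier := group_centre Q\<rparr> \<cong> free_Abelian_group {1..3 :: nat})"
proof -
  let ?W = "braid_heisenberg g" and ?A = "int_power_group 3" and ?B = "int_power_group (2 * g)"
  \<comment> \<open>The group axioms come from the isomorphism with the presented group; the
    basepoint guarantees that the constant loop exists.\<close>
  have G: "group G"
    unfolding G_def surface_braid_group_def
    using group_presented_group presentation basepoint
    by (intro group_fundamental_group_iso) (simp_all add: surface_braid_group_def)
  define c where "c = three (im (Sig 1)) (im (Sigt 1)) (im (Zeta 1))"
  define x where "x = interleave (\<lambda>i. im (A i)) (\<lambda>i. im (At i))"
  define y where "y = interleave (\<lambda>i. im (B i)) (\<lambda>i. im (Bt i))"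
  note Q_structure = braid_quotient_structure[OF \<open>k \<ge> 3\<close> \<open>n \<ge> 3\<close> G presentation[folded G_def]]
  interpret H: heisenberg_generators Q 3 "2 * g" "2 * g" braid_form c x y
    unfolding c_def x_def y_def im_def Q_def by (rule Q_structure(4))
  let ?f = "H.normal_form"
  have f: "?f \<in> iso ?W Q"
    unfolding c_def x_def y_def im_def Q_def by (rule Q_structure(5))
  have common: "\<And>i. i \<in> {1..<k} \<Longrightarrow> im (Sig i) = im (Sig 1)" "\<And>i. i \<in> {1..<n} \<Longrightarrow> im (Sigt i) = im (Sigt 1)"
    "\<And>i. i \<in> {1..n} \<Longrightarrow> im (Zeta i) = im (Zeta 1)"
    unfolding im_def by (rule Q_structure(1-3); assumption)+
  have bij: "bij_betw ?f (carrier ?W) (carrier Q)" using f by (simp add: iso_def)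
  have c_image: "c ` {1..3} = {im (Sig 1), im (Sigt 1), im (Zeta 1)}"
    unfolding c_def by (rule three_image)
  have x_image: "x ` {1..2 * g} = (\<Union>i\<in>{1..g}. {im (A i), im (At i)})"
    unfolding x_def by (rule interleave_image)
  have y_image: "y ` {1..2 * g} = (\<Union>i\<in>{1..g}. {im (B i), im (Bt i)})"
    unfolding y_def by (rule interleave_image)
  have nf: "?f (exponents_encode g (p, q, r, m, mt, l, lt)) =
      im (Sig 1) [^]\<^bsub>Q\<^esub> p \<otimes>\<^bsub>Q\<^esub> im (Sigt 1) [^]\<^bsub>Q\<^esub> q \<otimes>\<^bsub>Q\<^esub> im (Zeta 1) [^]\<^bsub>Q\<^esub> r
        \<otimes>\<^bsub>Q\<^esub> ordered_prod Q g (\<lambda>i. im (A i) [^]\<^bsub>Q\<^esub> m i \<otimes>\<^bsub>Q\<^esub> im (At i) [^]\<^bsub>Q\<^esub> mt i)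
        \<otimes>\<^bsub>Q\<^esub> ordered_prod Q g (\<lambda>i. im (B i) [^]\<^bsub>Q\<^esub> l i \<otimes>\<^bsub>Q\<^esub> im (Bt i) [^]\<^bsub>Q\<^esub> lt i)"
    for p q r m mt l lt
  proof -
    have "ordered_prod Q g (\<lambda>i. interleave u u' (2 * i - 1) [^]\<^bsub>Q\<^esub> m i \<otimes>\<^bsub>Q\<^esub> interleave u u' (2 * i) [^]\<^bsub>Q\<^esub> mt i)
        = ordered_prod Q g (\<lambda>i. u i [^]\<^bsub>Q\<^esub> m i \<otimes>\<^bsub>Q\<^esub> u' i [^]\<^bsub>Q\<^esub> mt i)" for u u' and m mt :: "nat \<Rightarrow> int"
      by (rule H.ordered_prod_cong) (simp add: interleave_odd interleave_even)
    then show ?thesis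
      unfolding H.normal_form_encode[OF HOL.refl HOL.refl HOL.refl] by (simp only: c_def x_def y_def
          three_simps)
  qed
  have exponents: "\<exists>!v. case v of (p, q, r, m, mt, l, lt) \<Rightarrow>
         {m, mt, l, lt} \<subseteq> {1..g} \<rightarrow>\<^sub>E (UNIV :: int set) \<and>
         \<gamma> = im (Sig 1) [^]\<^bsub>Q\<^esub> (p :: int) \<otimes>\<^bsub>Q\<^esub> im (Sigt 1) [^]\<^bsub>Q\<^esub> (q :: int) \<otimes>\<^bsub>Q\<^esub> im (Zeta 1) [^]\<^bsub>Q\<^esub> (r :: int)
        \<otimes>\<^bsub>Q\<^esub> ordered_prod Q g (\<lambda>i. im (A i) [^]\<^bsub>Q\<^esub> m i \<otimes>\<^bsub>Q\<^esub> im (At i) [^]\<^bsub>Q\<^esub> mt i)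
        \<otimes>\<^bsub>Q\<^esub> ordered_prod Q g (\<lambda>i. im (B i) [^]\<^bsub>Q\<^esub> l i \<otimes>\<^bsub>Q\<^esub> im (Bt i) [^]\<^bsub>Q\<^esub> lt i)"
    if \<gamma>: "\<gamma> \<in> carrier Q" for \<gamma>
  proof -
    let ?V = "{(p, q, r, m, mt, l, lt). {m, mt, l, lt} \<subseteq> {1..g} \<rightarrow>\<^sub>E (UNIV :: int set)}"
    \<comment> \<open>Encoding of exponents followed by the normal form: existence and uniqueness
      are the two halves of bijectivity.\<close>
    have "bij_betw (?f \<circ> exponents_encode g) ?V (carrier Q)"
      using bij_betw_trans[OF bij_betw_exponents_encode bij] .
    then have "\<exists>!v. v \<in> ?V \<and> (?f \<circ> exponents_encode g) v = \<gamma>"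
      using \<gamma> by (rule bij_betw_imp_ex1)
    moreover have "(case v of (p, q, r, m, mt, l, lt) \<Rightarrow>
         {m, mt, l, lt} \<subseteq> {1..g} \<rightarrow>\<^sub>E (UNIV :: int set) \<and>
         \<gamma> = im (Sig 1) [^]\<^bsub>Q\<^esub> p \<otimes>\<^bsub>Q\<^esub> im (Sigt 1) [^]\<^bsub>Q\<^esub> q \<otimes>\<^bsub>Q\<^esub> im (Zeta 1) [^]\<^bsub>Q\<^esub> r
        \<otimes>\<^bsub>Q\<^esub> ordered_prod Q g (\<lambda>i. im (A i) [^]\<^bsub>Q\<^esub> m i \<otimes>\<^bsub>Q\<^esub> im (At i) [^]\<^bsub>Q\<^esub> mt i)
        \<otimes>\<^bsub>Q\<^esub> ordered_prod Q g (\<lambda>i. im (B i) [^]\<^bsub>Q\<^esub> l i \<otimes>\<^bsub>Q\<^esub> im (Bt i) [^]\<^bsub>Q\<^esub> lt i))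
      \<longleftrightarrow> v \<in> ?V \<and> (?f \<circ> exponents_encode g) v = \<gamma>" for v
      by (cases v) (simp only: prod.case mem_Collect_eq o_apply nf eq_commute)
    ultimately show ?thesis by (rule ex1_iff_ex1)
  qed
  interpret A: group ?A by simp
  \<comment> \<open>The equation also asks for some vectors in the other two factors; a unit vector
    serves for both.\<close>
  have nf_c: "?f (heisenberg_c 3 (2 * g) (2 * g) z) = H.\<gamma> z" if "z \<in> carrier ?A" for z
    using that int_unit_closed[of "2 * g" 1] by (intro H.normal_form_heisenberg(1))
  have centre_W: "group_centre ?W = heisenberg_c 3 (2 * g) (2 * g) ` carrier ?A"
    using braid_form_nondegenerate by (rule group_centre_heisenberg_product)
  have "group_centre Q = ?f ` heisenberg_c 3 (2 * g) (2 * g) ` carrier ?A"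
    using group_centre_iso_image[OF group_heisenberg_product f] centre_W by simp
  also have "\<dots> = H.\<gamma> ` carrier ?A"
    unfolding image_image by (rule image_cong) (simp_all add: nf_c)
  finally have centre_image: "group_centre Q = H.\<gamma> ` carrier ?A" .
  have \<gamma>_hom: "H.\<gamma> \<in> hom ?A Q"
    by (rule H.power_prod_hom[OF H.c_closed H.c_comm])
  have centre: "group_centre Q = generate Q (c ` {1..3})"
    unfolding centre_image by (rule H.power_prod_image[OF H.c_closed H.c_comm])
  \<comment> \<open>On the central factor \<open>H.\<gamma>\<close> is the isomorphism
    \<open>?f\<close> after the coordinate embedding, and both are injective.\<close>
  have "inj_on H.\<gamma> (carrier ?A)"
  proof (rule inj_onI)
    fix z z' assume z: "z \<in> carrier ?A" "z' \<in> carrier ?A" and "H.\<gamma> z = H.\<gamma> z'"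
    then have "?f (heisenberg_c 3 (2 * g) (2 * g) z) = ?f (heisenberg_c 3 (2 * g) (2 * g) z')"
      by (simp add: nf_c)
    then have "heisenberg_c 3 (2 * g) (2 * g) z = heisenberg_c 3 (2 * g) (2 * g) z'"
      using bij hom_in_carrier[OF heisenberg_c_hom] z by (auto simp: bij_betw_def dest: inj_onD)
    then show "z = z'" by (simp add: heisenberg_c_def)
  qed
  then have "?A \<cong> Q\<lparr>carrier := group_centre Q\<rparr>"
    unfolding centre_image by (rule iso_on_image[OF \<gamma>_hom])
  then have centre_free: "Q\<lparr>carrier := group_centre Q\<rparr> \<cong> free_Abelian_group {1..3 :: nat}"
    by (rule iso_trans[OF A.iso_sym int_power_group_iso_free])
  show ?thesis
  proof (rule exI[of _ "im (Sig 1)"], rule exI[of _ "im (Sigt 1)"], rule exI[of _ "im (Zeta 1)"],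
      intro conjI, goal_cases)
    case 1 show ?case by (rule ballI) (rule common(1))
  next
    case 2 show ?case by (rule ballI) (rule common(2))
  next
    case 3 show ?case by (rule ballI) (rule common(3))
  next
    case 4
    show ?case
      by (rule exI[of _ "heisenberg_action 3 (2 * g) (2 * g) braid_form"], rule exI[of _ ?f])
        (intro conjI heisenberg_action_hom f H.normal_form_image[unfolded c_image x_image y_image])
  next
    case 5 show ?case by (rule ballI) (rule exponents)
  next
    case 6 show ?case by (rule centre[unfolded c_image])
  next
    case 7 show ?case by (rule centre_free)
  qed
qed

end
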